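(* Let $0<p<1$. Then, $\mathbb{P}^1$-almost surely, $\mathcal{X}_\infty=\emptyset$; that is, the greedy walk started at $0$ eventually removes every mark of every point of $\mathcal{X}$.
   Context: Fix $0<p<1$. Under $\mathbb{P}$, let $\mathcal{X}$ be a Poisson point process of intensity $1$ on $\mathbb{R}$ and let $\mathcal{Y}$ be a $p$-thinning of $\mathcal{X}$ (conditionally on $\mathcal{X}$, each point of $\mathcal{X}$ is kept in $\mathcal{Y}$ independently with probability $p$). Point processes are viewed both as integer-valued measures and as random subsets of $\mathbb{R}$. Put $\omega=\mathcal{X}+\mathcal{Y}$, so points of $\mathcal{Y}$ carry two marks and the other points of $\mathcal{X}$ carry one mark; $\omega(x)=\omega(\{x\})$ is the number of marks at $x$. $\mathbb{P}^1$ denotes $\mathbb{P}$ conditioned on $0\in\mathcal{X}$ in the Palm sense: under $\mathbb{P}^1$, $\mathcal{X}$ is a Poisson point process of intensity $1$ with an additional point at $0$, and each point of $\mathcal{X}$ (including $0$) belongs to $\mathcal{Y}$ independently with probability $p$. Greedy walk started at $0$ (under $\mathbb{P}^1$): $\omega_0=\omega$, $S_0=0$, and for all $n\ge 0$, $$\omega_{n+1}=\omega_n-\delta_{S_n},\qquad S_{n+1}=\operatorname{arg\,min}\{|y-S_n| : y\in\mathbb{R},\ y\neq S_n,\ \omega_n(y)\ge 1\}.$$ $\mathbb{P}^1$-a.s. the $\operatorname{arg\,min}$ is always unique, so $(S_n)_{n\ge0}$ and $(\omega_n)_{n\ge 0}$ are well defined. Let $\mathcal{X}_n=\{x\in\mathbb{R}:\omega_n(x)\ge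 1\}$ (a decreasing sequence of sets) and $\mathcal{X}_\infty=\bigcap_{n}\mathcal{X}_n$, the set of points left by the walk. *)

theory Defs
  imports "HOL-Probability.Probability"
begin

section \<open>Point processes on the real line\<close>

definition locally_finite :: "real set \<Rightarrow> bool" where
  "locally_finite S \<longleftrightarrow> (\<forall>B. bounded B \<longrightarrow> finite (S \<inter> B))"

text \<open>Locally finite configurations, with the \<open>\<sigma>\<close>-algebra generated by the counts of
  points in bounded Borel sets.\<close>

definition config_space :: "real set measure" where
  "config_space = sigma {S. locally_finite S}
     {{S. locally_finite S \<and> card (S \<inter> B) = k} | B k. B \<in> sets borel \<and> bounded B}"

text \<open>A simple point process is a random configuration. All processes considered here are
  simple, so they are represented by their random support.\<close>

definition point_process :: "'w measure \<Rightarrow> ('w \<Rightarrow> real set) \<Rightarrow> bool" where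
  "point_process M X \<longleftrightarrow> X \<in> measurable M config_space"

text \<open>For \<open>k = 0\<close> and a null set \<open>B\<close> the formula below gives probability one, since
  \<open>0 ^ 0 = 1\<close>.\<close>

definition poisson_process :: "'w measure \<Rightarrow> real \<Rightarrow> ('w \<Rightarrow> real set) \<Rightarrow> bool" where
  "poisson_process M l X \<longleftrightarrow>
     point_process M X \<and>
     (\<forall>B k. B \<in> sets borel \<longrightarrow> bounded B \<longrightarrow>
        measure M {w \<in> space M. card (X w \<inter> B) = k} =
          exp (- (l * measure lborel B)) * (l * measure lborel B) ^ k / fact k) \<and>
     (\<forall>(n :: nat) B. (\<forall>i<n. B i \<in> sets borel \<and> bounded (B i)) \<longrightarrow>
        disjoint_family_on B {..<n} \<longrightarrow>
        prob_space.indep_vars M (\<lambda>_. count_space (UNIV :: nat set))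
          (\<lambda>i w. card (X w \<inter> B i)) {..<n})"

definition sigma_gen :: "'w measure \<Rightarrow> ('w \<Rightarrow> real set) \<Rightarrow> 'w measure" where
  "sigma_gen M X = vimage_algebra (space M) X config_space"

text \<open>\<open>Y\<close> is a \<open>p\<close>-thinning of \<open>X\<close>: conditionally on \<open>X\<close>, any finitely many distinct
  points \<open>\<xi> 0, \<dots>, \<xi> (k - 1)\<close> of \<open>X\<close> (chosen measurably as functions of \<open>X\<close>) all
  belong to \<open>Y\<close> with probability \<open>p ^ k\<close>. As \<open>k\<close> and the points are arbitrary, this says
  that the events that the individual points are kept are conditionally independent, each
  of probability \<open>p\<close>.\<close>

definition thinning :: "'w measure \<Rightarrow> real \<Rightarrow> ('w \<Rightarrow> real set) \<Rightarrow> ('w \<Rightarrow> real set) \<Rightarrow> bool" where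
  "thinning M p X Y \<longleftrightarrow>
     point_process M X \<and> point_process M Y \<and> (\<forall>w\<in>space M. Y w \<subseteq> X w) \<and>
     (\<forall>k (\<xi> :: nat \<Rightarrow> 'w \<Rightarrow> real).
        (\<forall>i<k. \<xi> i \<in> borel_measurable (sigma_gen M X)) \<longrightarrow>
        (AE w in M. (\<forall>i<k. \<xi> i w \<in> X w) \<and> inj_on (\<lambda>i. \<xi> i w) {..<k} \<longrightarrow>
           real_cond_exp M (sigma_gen M X)
             (indicator {w \<in> space M. \<forall>i<k. \<xi> i w \<in> Y w}) w = p ^ k))"

section \<open>The greedy walk\<close>

definition marks :: "real set \<Rightarrow> real set \<Rightarrow> real \<Rightarrow> int" where
  "marks X Y x = of_bool (x \<in> X) + of_bool (x \<in> Y)"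

text \<open>If the nearest remaining point is not unique (a null event for the processes considered
  here), \<^const>\<open>arg_min\<close> picks one of the minimisers.\<close>

fun greedy_env :: "(real \<Rightarrow> int) \<Rightarrow> nat \<Rightarrow> real \<Rightarrow> int"
  and greedy_walk :: "(real \<Rightarrow> int) \<Rightarrow> nat \<Rightarrow> real" where
  "greedy_env \<omega> 0 = \<omega>"
| "greedy_env \<omega> (Suc n) = (\<lambda>x. greedy_env \<omega> n x - of_bool (x = greedy_walk \<omega> n))"
| "greedy_walk \<omega> 0 = 0"
| "greedy_walk \<omega> (Suc n) =
     arg_min (\<lambda>y. \<bar>y - greedy_walk \<omega> n\<bar>) (\<lambda>y. y \<noteq> greedy_walk \<omega> n \<and> greedy_env \<omega> n y \<ge> 1)"

definition points_left :: "(real \<Rightarrow> int) \<Rightarrow> nat \<Rightarrow> real set" where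
  "points_left \<omega> n = {x. greedy_env \<omega> n x \<ge> 1}"

definition points_left_forever :: "(real \<Rightarrow> int) \<Rightarrow> real set" where
  "points_left_forever \<omega> = (\<Inter>n. points_left \<omega> n)"

end

theory Submission
  imports Defs
begin

text \<open>
  The walk never jumps over a remaining point, so a point left forever confines it to one side and
  makes it drift to infinity there. On a half-line the gaps are i.i.d. exponential and the marks
  i.i.d. Bernoulli, and the claim reduces to this: the walk started at a doubly marked boundary
  point \<open>0\<close> of a half-line returns to \<open>0\<close> almost surely.

  Suppose it escapes with probability \<open>q > 0\<close>. Call a point good if its right gap is shorter than
  its left gap and the half-line walk started there escapes. The walk from \<open>0\<close> leaves one mark at
  every good point it passes, and never clears it. By the zero-one law good points exist, and a
  maximal inequality shows that for most indices \<open>n\<close>, looking back from the \<open>n\<close>-th point, every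
  stretch without good points is short compared with its distance from \<open>n\<close>. If now the \<open>n\<close>-th
  point is resampled so that it carries one mark and is followed by a large gap, then the walk, on
  its first arrival there, runs back all the way to \<open>0\<close>: whenever it has cleared a remaining
  point, the gap on its right is larger than the one on its left. So the probability that the walk
  returns to \<open>0\<close> having reached exactly the \<open>n\<close>-th point is, on average over \<open>n\<close>, bounded below.
  But these events are disjoint.
\<close>

section \<open>Greedy runs\<close>

text \<open>A barrier acts on the walk only through its distance. If the half-line walk comes back
  to a far barrier, then a run that finds untouched points on its right, and whose nearest remaining
  point on the left lies in front of the barrier, must visit that point
  (\<open>coupling_hits\<close>). So returns exclude drift whatever the past of the run was.

  The obstacle to proving returns is that the marks left behind depend on the whole path. Goodness
  is designed against this: it is a property of the sequence of gaps and marks alone. The shorter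
  right gap forces the first departure from the point to go right, which leaves one of its two
  marks, and the escape from there makes that mark last.

  Resampling may spoil the goodness of points before n. Goodness is therefore always tested in the
  original sequence: until n is reached both walks coincide, so the marks surviving in one survive
  in the other. The event required at n concerns an independent copy and has the same positive
  probability for all n.

  The Poisson process is given by its counts, so the i.i.d. gaps have to be extracted by a strong
  Markov property at its points.\<close>

definition greedy_run :: "(nat \<Rightarrow> real \<Rightarrow> int) \<Rightarrow> (nat \<Rightarrow> real) \<Rightarrow> bool" where
  "greedy_run E S \<longleftrightarrow>
     (\<forall>n y. E (Suc n) y = E n y - of_bool (y = S n)) \<and>
     (\<forall>y. 0 \<le> E 0 y) \<and> 1 \<le> E 0 (S 0) \<and>
     (\<forall>n. S (Suc n) \<noteq> S n \<and> 1 \<le> E n (S (Suc n)) \<and>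
        (\<forall>y. y \<noteq> S n \<longrightarrow> 1 \<le> E n y \<longrightarrow> \<bar>S (Suc n) - S n\<bar> \<le> \<bar>y - S n\<bar>))"

context
  fixes E S
  assumes run: "greedy_run E S"
begin

lemma run_Suc: "E (Suc n) y = E n y - of_bool (y = S n)"
  and run_start_nonneg: "0 \<le> E 0 y"
  and run_moves: "S (Suc n) \<noteq> S n"
  and run_target: "1 \<le> E n (S (Suc n))"
  and run_nearest: "y \<noteq> S n \<Longrightarrow> 1 \<le> E n y \<Longrightarrow> \<bar>S (Suc n) - S n\<bar> \<le> \<bar>y - S n\<bar>"
  using run unfolding greedy_run_def by blast+

lemma run_present: "1 \<le> E n (S n)"
proof (cases n)
  case 0
  then show ?thesis using run unfolding greedy_run_def by blast
next
  case (Suc m)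
  then show ?thesis using run_target[of m] run_moves[of m] by (simp add: run_Suc)
qed

lemma run_nonneg: "0 \<le> E n y"
proof (induction n)
  case (Suc n)
  then show ?case using run_present[of n] by (auto simp: run_Suc)
qed (rule run_start_nonneg)

lemma run_mono: "m \<le> n \<Longrightarrow> E n y \<le> E m y"
  by (induction n rule: dec_induct) (auto simp: run_Suc)

lemma run_unvisited: "m \<le> n \<Longrightarrow> (\<And>t. m \<le> t \<Longrightarrow> t < n \<Longrightarrow> S t \<noteq> y) \<Longrightarrow> E n y = E m y"
  by (induction n rule: dec_induct) (auto simp: run_Suc)

lemma run_visited: "m \<le> t \<Longrightarrow> t < n \<Longrightarrow> E n (S t) \<le> E m (S t) - 1"
  using run_mono[of m t "S t"] run_mono[of "Suc t" n "S t"] by (simp add: run_Suc)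

lemma run_count: "E n y = E 0 y - int (card {t. t < n \<and> S t = y})"
proof (induction n)
  case (Suc n)
  have "{t. t < Suc n \<and> S t = y} = (if S n = y then insert n {t. t < n \<and> S t = y} else {t. t < n \<and> S t = y})"
    by (auto simp: less_Suc_eq)
  then show ?case using Suc by (auto simp: run_Suc)
qed simp

lemma run_finite_visits: "finite {t. S t = y}"
proof (rule ccontr)
  assume inf: "infinite {t. S t = y}"
  obtain T where T: "T \<subseteq> {t. S t = y}" "finite T" "card T = nat (E 0 y) + 1"
    using infinite_arbitrarily_large[OF inf] by blast
  obtain n where "\<forall>t\<in>T. t < n" using T(2) finite_nat_set_iff_bounded by blast
  then have "T \<subseteq> {t. t < n \<and> S t = y}" using T(1) by auto
  then have "card T \<le> card {t. t < n \<and> S t = y}" by (intro card_mono) auto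
  then show False using T(3) run_count[of n y] run_nonneg[of n y] by simp
qed

lemma run_leaves_finite:
  assumes "finite F" obtains n where "\<And>t. n \<le> t \<Longrightarrow> S t \<notin> F"
proof -
  have "finite (\<Union>y\<in>F. {t. S t = y})" using assms run_finite_visits by blast
  then obtain n where "\<forall>t\<in>(\<Union>y\<in>F. {t. S t = y}). t < n"
    using finite_nat_set_iff_bounded by blast
  then show ?thesis by (intro that[of n]) force
qed

text \<open>From the left of y, the point y itself competes for the next step, so the step can reach
  y but not pass it.\<close>

lemma run_no_jump_right:
  assumes "m \<le> n" "1 \<le> E m y" "\<And>t. m \<le> t \<Longrightarrow> t \<le> n \<Longrightarrow> S t \<noteq> y" "S m < y"
  shows "S n < y"
  using assms(1,3)
proof (induction n rule: dec_induct)
  case base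
  then show ?case using assms(4) by simp
next
  case (step n)
  have lt: "S n < y" using step by force
  have "E n y = E m y" using step by (intro run_unvisited) auto
  with lt have "\<bar>S (Suc n) - S n\<bar> \<le> \<bar>y - S n\<bar>" using assms(2) by (intro run_nearest) auto
  moreover have "S (Suc n) \<noteq> y" using step by auto
  ultimately show ?case using lt by auto
qed

text \<open>A walk stuck on the left of a point is thereby reduced to one stuck on the right. For
  such uses \<open>greedy_run\<close> leaves open the start and the choice among minimisers: it
  covers the walk on the line, its mirror image and the half-line walk alike.\<close>

lemma run_reflect: "greedy_run (\<lambda>n y. E n (- y)) (\<lambda>n. - S n)"
  unfolding greedy_run_def
proof (intro conjI allI impI)
  show "E (Suc n) (- y) = E n (- y) - of_bool (y = - S n)" for n y
    by (auto simp: run_Suc)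
  show "0 \<le> E 0 (- y)" for y by (rule run_start_nonneg)
  show "1 \<le> E 0 (- (- S 0))" using run_present[of 0] by simp
  show "- S (Suc n) \<noteq> - S n" for n using run_moves[of n] by simp
  show "1 \<le> E n (- (- S (Suc n)))" for n using run_target[of n] by simp
  show "\<bar>- S (Suc n) - - S n\<bar> \<le> \<bar>y - - S n\<bar>" if "y \<noteq> - S n" "1 \<le> E n (- y)" for n y
  proof -
    have "\<bar>S (Suc n) - S n\<bar> \<le> \<bar>- y - S n\<bar>" using that by (intro run_nearest) auto
    then show ?thesis by simp
  qed
qed

end

lemma run_no_jump_left:
  assumes "greedy_run E S" "m \<le> n" "1 \<le> E m y" "\<And>t. m \<le> t \<Longrightarrow> t \<le> n \<Longrightarrow> S t \<noteq> y" "y < S m"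
  shows "y < S n"
  using run_no_jump_right[OF run_reflect[OF assms(1)], of m n "- y"] assms by force

section \<open>The walk on a half-line coded by gaps and marks\<close>

text \<open>A sequence \<omega> codes points on a half-line: \<open>fst (\<omega> i)\<close> is the
  gap between the points i and i + 1, \<open>snd (\<omega> i)\<close> tells whether point i has a
  second mark, and point 0 sits at the origin.\<close>

definition pos :: "(nat \<Rightarrow> real \<times> bool) \<Rightarrow> nat \<Rightarrow> real" where
  "pos \<omega> i = (\<Sum>j<i. fst (\<omega> j))"

text \<open>Indices instead of positions keep the walk in a countable set, and \<open>LEAST\<close>
  resolves ties measurably; both serve the measurability proofs.\<close>

fun ienv :: "(nat \<Rightarrow> real \<times> bool) \<Rightarrow> nat \<Rightarrow> nat \<Rightarrow> int"
  and iwalk :: "(nat \<Rightarrow> real \<times> bool) \<Rightarrow> nat \<Rightarrow> nat" where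
  "ienv \<omega> 0 = (\<lambda>i. 1 + of_bool (snd (\<omega> i)))"
| "ienv \<omega> (Suc n) = (\<lambda>i. ienv \<omega> n i - of_bool (i = iwalk \<omega> n))"
| "iwalk \<omega> 0 = 0"
| "iwalk \<omega> (Suc n) = (LEAST j. j \<noteq> iwalk \<omega> n \<and> 1 \<le> ienv \<omega> n j \<and>
     (\<forall>k. k \<noteq> iwalk \<omega> n \<longrightarrow> 1 \<le> ienv \<omega> n k \<longrightarrow>
        \<bar>pos \<omega> j - pos \<omega> (iwalk \<omega> n)\<bar> \<le> \<bar>pos \<omega> k - pos \<omega> (iwalk \<omega> n)\<bar>))"

definition nearest :: "(nat \<Rightarrow> real \<times> bool) \<Rightarrow> nat \<Rightarrow> nat \<Rightarrow> bool" where
  "nearest \<omega> n j \<longleftrightarrow> j \<noteq> iwalk \<omega> n \<and> 1 \<le> ienv \<omega> n j \<and>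
     (\<forall>k. k \<noteq> iwalk \<omega> n \<longrightarrow> 1 \<le> ienv \<omega> n k \<longrightarrow>
        \<bar>pos \<omega> j - pos \<omega> (iwalk \<omega> n)\<bar> \<le> \<bar>pos \<omega> k - pos \<omega> (iwalk \<omega> n)\<bar>)"

lemma iwalk_Suc: "iwalk \<omega> (Suc n) = (LEAST j. nearest \<omega> n j)"
  by (simp add: nearest_def)

definition pos_gaps :: "(nat \<Rightarrow> real \<times> bool) \<Rightarrow> bool" where
  "pos_gaps \<omega> \<longleftrightarrow> (\<forall>i. 0 < fst (\<omega> i))"

definition no_ties :: "(nat \<Rightarrow> real \<times> bool) \<Rightarrow> bool" where
  "no_ties \<omega> \<longleftrightarrow> (\<forall>a b c. a < b \<longrightarrow> b < c \<longrightarrow> pos \<omega> b - pos \<omega> a \<noteq> pos \<omega> c - pos \<omega> b)"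

definition returns :: "(nat \<Rightarrow> real \<times> bool) \<Rightarrow> bool" where
  "returns \<omega> \<longleftrightarrow> (\<exists>t\<ge>1. iwalk \<omega> t = 0)"

text \<open>The second mark of point 0 is the barrier: with a single mark the point is gone after
  the first step, and the walk fails to return for a trivial reason.\<close>

definition escapes :: "(nat \<Rightarrow> real \<times> bool) \<Rightarrow> bool" where
  "escapes \<omega> \<longleftrightarrow> snd (\<omega> 0) \<and> \<not> returns \<omega>"

definition shift :: "nat \<Rightarrow> (nat \<Rightarrow> 'a) \<Rightarrow> nat \<Rightarrow> 'a" where
  "shift k \<omega> i = \<omega> (k + i)"

lemma pos_0 [simp]: "pos \<omega> 0 = 0"
  by (simp add: pos_def)

lemma pos_Suc: "pos \<omega> (Suc i) = pos \<omega> i + fst (\<omega> i)"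
  by (simp add: pos_def)

lemma pos_shift: "pos (shift k \<omega>) i = pos \<omega> (k + i) - pos \<omega> k"
  by (induction i) (auto simp: pos_Suc shift_def)

lemma pos_gaps_shift: "pos_gaps \<omega> \<Longrightarrow> pos_gaps (shift k \<omega>)"
  by (simp add: pos_gaps_def shift_def)

lemma no_ties_shift: "no_ties \<omega> \<Longrightarrow> no_ties (shift k \<omega>)"
  unfolding no_ties_def pos_shift by (metis add_strict_left_mono diff_diff_eq2 diff_add_cancel)

text \<open>Carries the index environment to the real line, without marks off the coded points, so
  that the facts on greedy runs apply to \<open>iwalk\<close>.\<close>

definition renv :: "(nat \<Rightarrow> real \<times> bool) \<Rightarrow> nat \<Rightarrow> real \<Rightarrow> int" where
  "renv \<omega> n y = (if y \<in> range (pos \<omega>) then ienv \<omega> n (inv (pos \<omega>) y) else 0)"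

context
  fixes \<omega> :: "nat \<Rightarrow> real \<times> bool"
  assumes gaps: "pos_gaps \<omega>"
begin

lemma pos_less_iff: "pos \<omega> i < pos \<omega> j \<longleftrightarrow> i < j"
  and pos_le_iff: "pos \<omega> i \<le> pos \<omega> j \<longleftrightarrow> i \<le> j"
  and pos_eq_iff: "pos \<omega> i = pos \<omega> j \<longleftrightarrow> i = j"
proof -
  have "strict_mono (pos \<omega>)"
    using gaps by (auto simp: strict_mono_Suc_iff pos_Suc pos_gaps_def)
  then show "pos \<omega> i < pos \<omega> j \<longleftrightarrow> i < j" "pos \<omega> i \<le> pos \<omega> j \<longleftrightarrow> i \<le> j" "pos \<omega> i = pos \<omega> j \<longleftrightarrow> i = j"
    by (simp_all add: strict_mono_less strict_mono_less_eq strict_mono_eq)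
qed

lemma ienv_fresh: "(\<And>t. t < n \<Longrightarrow> iwalk \<omega> t \<noteq> i) \<Longrightarrow> ienv \<omega> n i = 1 + of_bool (snd (\<omega> i))"
  by (induction n) auto

lemma nearest_iwalk: "nearest \<omega> n (iwalk \<omega> (Suc n))"
proof -
  let ?s = "iwalk \<omega> n"
  let ?C = "{k. k \<noteq> ?s \<and> 1 \<le> ienv \<omega> n k}"
  \<comment> \<open>The index b exceeds all indices visited so far, so it is still present, and
    everything beyond it is farther away; a minimiser need only be sought up to b.\<close>
  obtain b where b: "iwalk \<omega> ` {..n} \<subseteq> {..<b}"
    using finite_nat_iff_bounded by blast
  have sb: "?s < b" using b by auto
  have "iwalk \<omega> t < b" if "t \<le> n" for t using b that by auto
  then have "ienv \<omega> n b = 1 + of_bool (snd (\<omega> b))" by (intro ienv_fresh) (metis less_imp_le_nat nat_neq_iff)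
  then have "1 \<le> ienv \<omega> n b" by simp
  with sb have bC: "b \<in> ?C" by auto
  let ?D = "?C \<inter> {..b}"
  obtain j where j: "j \<in> ?D" "\<And>k. k \<in> ?D \<Longrightarrow> \<bar>pos \<omega> j - pos \<omega> ?s\<bar> \<le> \<bar>pos \<omega> k - pos \<omega> ?s\<bar>"
    using ex_is_arg_min_if_finite[of ?D "\<lambda>k. \<bar>pos \<omega> k - pos \<omega> ?s\<bar>"] bC
    by (auto simp: is_arg_min_linorder)
  have "nearest \<omega> n j"
    unfolding nearest_def
  proof (intro conjI allI impI)
    fix k assume k: "k \<noteq> ?s" "1 \<le> ienv \<omega> n k"
    show "\<bar>pos \<omega> j - pos \<omega> ?s\<bar> \<le> \<bar>pos \<omega> k - pos \<omega> ?s\<bar>"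
    proof (cases "k \<le> b")
      case False
      then have "pos \<omega> b < pos \<omega> k" "pos \<omega> ?s < pos \<omega> b" using sb by (auto simp: pos_less_iff)
      then show ?thesis using j(2)[of b] bC by auto
    qed (use j(2) k in auto)
  qed (use j(1) in auto)
  then show ?thesis unfolding iwalk_Suc by (rule LeastI)
qed

lemma iwalk_1: "iwalk \<omega> (Suc 0) = 1"
  unfolding iwalk_Suc
proof (rule Least_equality)
  have "pos \<omega> 1 \<le> pos \<omega> k" "0 \<le> pos \<omega> k" "0 \<le> pos \<omega> 1" if "k \<noteq> 0" for k
    using that pos_le_iff[of 1 k] pos_le_iff[of 0 k] pos_le_iff[of 0 1] by auto
  then show "nearest \<omega> 0 1" by (auto simp: nearest_def)
qed (auto simp: nearest_def)

lemma renv_pos [simp]: "renv \<omega> n (pos \<omega> i) = ienv \<omega> n i"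
proof -
  have "inj (pos \<omega>)" by (auto simp: inj_def pos_eq_iff)
  then show ?thesis by (simp add: renv_def)
qed

lemma greedy_run_iwalk: "greedy_run (renv \<omega>) (\<lambda>n. pos \<omega> (iwalk \<omega> n))"
  unfolding greedy_run_def
proof (intro conjI allI impI)
  fix n y
  show "renv \<omega> (Suc n) y = renv \<omega> n y - of_bool (y = pos \<omega> (iwalk \<omega> n))"
  proof (cases "y \<in> range (pos \<omega>)")
    case True
    then obtain i where "y = pos \<omega> i" by blast
    then show ?thesis by (simp add: pos_eq_iff)
  qed (auto simp: renv_def)
  show "0 \<le> renv \<omega> 0 y" by (auto simp: renv_def)
  show "1 \<le> renv \<omega> 0 (pos \<omega> (iwalk \<omega> 0))" by (simp del: pos_0)
  note near = nearest_iwalk[of n, unfolded nearest_def]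
  show "pos \<omega> (iwalk \<omega> (Suc n)) \<noteq> pos \<omega> (iwalk \<omega> n)"
    using near by (auto simp: pos_eq_iff simp del: iwalk.simps)
  show "1 \<le> renv \<omega> n (pos \<omega> (iwalk \<omega> (Suc n)))"
    using near by (auto simp del: iwalk.simps)
  assume y: "y \<noteq> pos \<omega> (iwalk \<omega> n)" "1 \<le> renv \<omega> n y"
  then obtain k where k: "y = pos \<omega> k" by (auto simp: renv_def split: if_splits)
  with y have "k \<noteq> iwalk \<omega> n" "1 \<le> ienv \<omega> n k" by auto
  with near k show "\<bar>pos \<omega> (iwalk \<omega> (Suc n)) - pos \<omega> (iwalk \<omega> n)\<bar> \<le> \<bar>y - pos \<omega> (iwalk \<omega> n)\<bar>"
    by blast
qed

end

declare iwalk.simps(2) [simp del]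

text \<open>Two distinct minimisers lie on opposite sides of the walk at equal distance, which
  \<open>no_ties\<close> excludes.\<close>

lemma nearest_unique:
  assumes "pos_gaps \<omega>" "no_ties \<omega>" "nearest \<omega> n j" "nearest \<omega> n j'"
  shows "j = j'"
proof (rule ccontr)
  assume ne: "j \<noteq> j'"
  let ?s = "iwalk \<omega> n"
  have eq: "\<bar>pos \<omega> j - pos \<omega> ?s\<bar> = \<bar>pos \<omega> j' - pos \<omega> ?s\<bar>"
    using assms(3,4) unfolding nearest_def by (intro antisym) blast+
  have "j \<noteq> ?s" "j' \<noteq> ?s" using assms(3,4) by (auto simp: nearest_def)
  with eq ne have op: "pos \<omega> ?s - pos \<omega> j = pos \<omega> j' - pos \<omega> ?s"
    using pos_eq_iff[OF assms(1)] by (smt (verit))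
  have "pos \<omega> j < pos \<omega> ?s \<or> pos \<omega> ?s < pos \<omega> j"
    using \<open>j \<noteq> ?s\<close> pos_eq_iff[OF assms(1), of j ?s] by linarith
  then show False
  proof
    assume "pos \<omega> j < pos \<omega> ?s"
    then have "j < ?s" "?s < j'" using op by (auto simp: pos_less_iff[OF assms(1), symmetric])
    then show False using op assms(2) unfolding no_ties_def by blast
  next
    assume "pos \<omega> ?s < pos \<omega> j"
    then have "j' < ?s" "?s < j" using op by (auto simp: pos_less_iff[OF assms(1), symmetric])
    moreover have "pos \<omega> ?s - pos \<omega> j' = pos \<omega> j - pos \<omega> ?s" using op by linarith
    ultimately show False using assms(2) unfolding no_ties_def by blast
  qed
qed

lemma iwalk_eqI:
  assumes "pos_gaps \<omega>" "no_ties \<omega>" "nearest \<omega> n j"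
  shows "iwalk \<omega> (Suc n) = j"
  using nearest_unique[OF assms(1,2) nearest_iwalk[OF assms(1)] assms(3)] .

section \<open>Comparing a greedy run with a half-line walk\<close>

text \<open>The half-line walk has its barrier (index \<open>0\<close>) at \<open>c\<close>, at least as far away as the nearest
  remaining point \<open>z\<close> to the left of the run. As long as the run does not step to \<open>z\<close>, both
  take the same decisions.\<close>

context
  fixes E S \<omega> n c z
  assumes run: "greedy_run E S" and gaps: "pos_gaps \<omega>" and ties: "no_ties \<omega>" and m0: "snd (\<omega> 0)"
    and start: "S n = c + pos \<omega> 1" and z: "1 \<le> E n z" "c \<le> z" "z < S n"
    and sup: "\<And>y. z < y \<Longrightarrow> 1 \<le> E n y \<Longrightarrow> \<exists>k\<ge>1. y = c + pos \<omega> k"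
    and fresh: "\<And>k. 1 \<le> k \<Longrightarrow> E n (c + pos \<omega> k) = 1 + of_bool (snd (\<omega> k))"
begin

text \<open>The half-line walk is one step ahead, as its first step leads from the barrier to index
  1, where the run starts. Since c \<le> z, the barrier is never closer than z, so it cannot win
  when z does not.\<close>

lemma coupling:
  assumes "\<forall>v\<le>u. S (n + v) \<noteq> z"
  shows "S (n + u) = c + pos \<omega> (iwalk \<omega> (Suc u)) \<and> 1 \<le> iwalk \<omega> (Suc u) \<and>
    (\<forall>k\<ge>1. E (n + u) (c + pos \<omega> k) = ienv \<omega> (Suc u) k) \<and> 1 \<le> ienv \<omega> (Suc u) 0"
  using assms
proof (induction u)
  case 0
  show ?case using start fresh m0 by (auto simp: iwalk_1[OF gaps])
next
  case (Suc u)
  define s where "s = iwalk \<omega> (Suc u)"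
  define y where "y = S (Suc (n + u))"
  have IH: "S (n + u) = c + pos \<omega> s" "1 \<le> s"
      "\<And>k. 1 \<le> k \<Longrightarrow> E (n + u) (c + pos \<omega> k) = ienv \<omega> (Suc u) k" "1 \<le> ienv \<omega> (Suc u) 0"
    using Suc by (auto simp: s_def)
  have "y \<noteq> z" using Suc.prems by (auto simp: y_def)
  have zS: "z < S (n + u)"
    using z(3) start IH(1,2) pos_le_iff[OF gaps, of 1 s] by simp
  have "S t \<noteq> z" if "n \<le> t" "t < n + u" for t
    using Suc.prems[rule_format, of "t - n"] that by simp
  then have "E (n + u) z = E n z" by (intro run_unvisited[OF run]) auto
  then have near_z: "\<bar>y - S (n + u)\<bar> \<le> \<bar>z - S (n + u)\<bar>"
    unfolding y_def using zS z(1) by (intro run_nearest[OF run]) auto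
  with zS \<open>y \<noteq> z\<close> have "z < y" by auto
  moreover have Ey: "1 \<le> E (n + u) y" unfolding y_def by (rule run_target[OF run])
  then have "1 \<le> E n y" using run_mono[OF run, of n "n + u" y] by simp
  ultimately obtain j where j: "1 \<le> j" "y = c + pos \<omega> j" using sup by blast
  have "nearest \<omega> (Suc u) j"
    unfolding nearest_def s_def[symmetric]
  proof (intro conjI allI impI)
    show "j \<noteq> s" using run_moves[OF run, of "n + u"] j(2) IH(1) by (auto simp: y_def)
    show "1 \<le> ienv \<omega> (Suc u) j" using Ey IH(3) j by simp
    fix k assume k: "k \<noteq> s" "1 \<le> ienv \<omega> (Suc u) k"
    show "\<bar>pos \<omega> j - pos \<omega> s\<bar> \<le> \<bar>pos \<omega> k - pos \<omega> s\<bar>"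
    proof (cases "k = 0")
      case True
      then show ?thesis using near_z zS z(2) j(2) IH(1) by auto
    next
      case False
      then have "1 \<le> E (n + u) (c + pos \<omega> k)" using IH(3) k by simp
      then have "\<bar>y - S (n + u)\<bar> \<le> \<bar>c + pos \<omega> k - S (n + u)\<bar>"
        unfolding y_def using k(1) IH(1) pos_eq_iff[OF gaps] by (intro run_nearest[OF run]) auto
      then show ?thesis using j(2) IH(1) by simp
    qed
  qed
  then have "iwalk \<omega> (Suc (Suc u)) = j" by (rule iwalk_eqI[OF gaps ties])
  moreover have "E (Suc (n + u)) (c + pos \<omega> k) = ienv \<omega> (Suc (Suc u)) k" if "1 \<le> k" for k
    using IH(1) IH(3)[OF that] unfolding run_Suc[OF run] ienv.simps(2)[of \<omega> "Suc u"] s_def[symmetric]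
    by (auto simp: pos_eq_iff[OF gaps])
  moreover have "1 \<le> ienv \<omega> (Suc (Suc u)) 0"
    using IH(2,4) unfolding ienv.simps(2)[of \<omega> "Suc u"] s_def[symmetric] by simp
  ultimately show ?case using j by (simp add: y_def)
qed

text \<open>Without a visit to z the coupling would last for ever and keep the half-line walk at
  indices at least 1.\<close>

lemma coupling_hits:
  assumes "returns \<omega>" obtains v where "S (n + v) = z" "v \<ge> 1"
proof -
  have "\<exists>v. S (n + v) = z"
  proof (rule ccontr)
    assume "\<nexists>v. S (n + v) = z"
    then have *: "1 \<le> iwalk \<omega> (Suc u)" for u using coupling[of u] by auto
    obtain t where "t \<ge> 1" "iwalk \<omega> t = 0" using assms by (auto simp: returns_def)
    then show False using *[of "t - 1"] by simp
  qed
  then obtain v where v: "S (n + v) = z" by blast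
  then have "v \<noteq> 0" using z(3) by (intro notI) auto
  with v that show thesis by simp
qed

text \<open>For this direction the barrier is placed exactly at z: at the first visit of the run to
  z the half-line walk, coupled so far, finds its barrier nearest as well and returns.\<close>

lemma coupling_avoids:
  assumes "\<not> returns \<omega>" "c = z" shows "S (n + v) \<noteq> z"
proof
  assume "S (n + v) = z"
  define w where "w = (LEAST v. S (n + v) = z)"
  have w: "S (n + w) = z" "\<And>v. v < w \<Longrightarrow> S (n + v) \<noteq> z"
    using LeastI[of "\<lambda>v. S (n + v) = z" v] not_less_Least[of _ "\<lambda>v. S (n + v) = z"]
      \<open>S (n + v) = z\<close> by (auto simp: w_def)
  have "w \<noteq> 0" using w(1) z(3) by (intro notI) auto
  then obtain u where u: "w = Suc u" using not0_implies_Suc by blast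
  have c: "S (n + u) = c + pos \<omega> (iwalk \<omega> (Suc u))" "1 \<le> iwalk \<omega> (Suc u)"
    "\<And>k. 1 \<le> k \<Longrightarrow> E (n + u) (c + pos \<omega> k) = ienv \<omega> (Suc u) k" "1 \<le> ienv \<omega> (Suc u) 0"
    using coupling[of u] w(2) u by auto
  have "nearest \<omega> (Suc u) 0"
    unfolding nearest_def
  proof (intro conjI allI impI)
    fix k assume k: "k \<noteq> iwalk \<omega> (Suc u)" "1 \<le> ienv \<omega> (Suc u) k"
    show "\<bar>pos \<omega> 0 - pos \<omega> (iwalk \<omega> (Suc u))\<bar> \<le> \<bar>pos \<omega> k - pos \<omega> (iwalk \<omega> (Suc u))\<bar>"
    proof (cases "k = 0")
      case False
      then have "1 \<le> E (n + u) (c + pos \<omega> k)" using c(3) k by simp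
      then have "\<bar>S (Suc (n + u)) - S (n + u)\<bar> \<le> \<bar>c + pos \<omega> k - S (n + u)\<bar>"
        using k(1) c(1) pos_eq_iff[OF gaps] by (intro run_nearest[OF run]) auto
      then show ?thesis using w(1) u c(1) assms(2) by simp
    qed simp
  qed (use c in auto)
  then have "iwalk \<omega> (Suc (Suc u)) = 0" by (rule iwalk_eqI[OF gaps ties])
  moreover have "1 \<le> Suc (Suc u)" by simp
  ultimately show False using assms(1) unfolding returns_def by blast
qed

end

section \<open>Points that are never cleared\<close>

text \<open>Goodness looks only at \<omega> from index i - 1 on, whatever the walk has done before;
  so it is compatible with shifts (\<open>good_shift\<close>).\<close>

definition good :: "(nat \<Rightarrow> real \<times> bool) \<Rightarrow> nat \<Rightarrow> bool" where
  "good \<omega> i \<longleftrightarrow> 1 \<le> i \<and> fst (\<omega> i) < fst (\<omega> (i - 1)) \<and> escapes (shift i \<omega>)"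

lemma iwalk_no_jump:
  assumes gaps: "pos_gaps \<omega>" and "i < iwalk \<omega> u"
  obtains t where "t < u" "iwalk \<omega> t = i"
proof -
  have "\<exists>t\<le>u. iwalk \<omega> t = i"
  proof (cases "i = 0")
    case False
    show ?thesis
    proof (rule ccontr)
      assume *: "\<not> ?thesis"
      have "pos \<omega> (iwalk \<omega> u) < pos \<omega> i"
      proof (rule run_no_jump_right[OF greedy_run_iwalk[OF gaps], where m = 0])
        show "1 \<le> renv \<omega> 0 (pos \<omega> i)" by (simp add: renv_pos[OF gaps])
        show "pos \<omega> (iwalk \<omega> 0) < pos \<omega> i" using False pos_less_iff[OF gaps, of 0 i] by simp
      qed (use * in \<open>auto simp: pos_eq_iff[OF gaps]\<close>)
      then show False using assms by (simp add: pos_less_iff[OF gaps])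
    qed
  qed auto
  then obtain t where t: "t \<le> u" "iwalk \<omega> t = i" by blast
  moreover from t assms(2) have "t \<noteq> u" by auto
  ultimately show thesis using that[of t] by simp
qed

text \<open>The walk leaves the finitely many indices below n for good, and it cannot pass n without
  visiting it.\<close>

lemma first_arrival:
  assumes gaps: "pos_gaps \<omega>"
  obtains t where "iwalk \<omega> t = n" "\<And>u. u < t \<Longrightarrow> iwalk \<omega> u < n"
proof -
  obtain m where m: "\<And>t. m \<le> t \<Longrightarrow> pos \<omega> (iwalk \<omega> t) \<notin> pos \<omega> ` {..<n}"
    using run_leaves_finite[OF greedy_run_iwalk[OF gaps], of "pos \<omega> ` {..<n}"] by blast
  have "n \<le> iwalk \<omega> m" using m[of m] by (auto simp: not_less[symmetric])
  then have "\<exists>t. iwalk \<omega> t = n"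
    using iwalk_no_jump[OF gaps, of n m] by (cases "n = iwalk \<omega> m") auto
  then obtain t where t: "iwalk \<omega> t = n" "\<And>u. u < t \<Longrightarrow> iwalk \<omega> u \<noteq> n"
    using LeastI_ex[of "\<lambda>t. iwalk \<omega> t = n"] not_less_Least[of _ "\<lambda>t. iwalk \<omega> t = n"] by blast
  have "iwalk \<omega> u < n" if "u < t" for u
  proof (rule ccontr)
    assume "\<not> iwalk \<omega> u < n"
    with t(2)[OF that] have "n < iwalk \<omega> u" by simp
    then obtain v where "v < u" "iwalk \<omega> v = n" using iwalk_no_jump[OF gaps] by blast
    with t(2)[of v] that show False by simp
  qed
  with t(1) that show thesis by blast
qed

lemma ienv_unvisited:
  "m \<le> n \<Longrightarrow> (\<And>t. m \<le> t \<Longrightarrow> t < n \<Longrightarrow> iwalk \<omega> t \<noteq> i) \<Longrightarrow> ienv \<omega> n i = ienv \<omega> m i"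
  by (induction n rule: dec_induct) auto

text \<open>A good point is reached for the first time with its right neighbour closer than anything on
  its left; from then on the walk copies the half-line walk started there, which escapes.\<close>

lemma good_stays:
  assumes gaps: "pos_gaps \<omega>" and ties: "no_ties \<omega>" and "good \<omega> i"
  shows "1 \<le> ienv \<omega> t i"
proof -
  have i: "1 \<le> i" "fst (\<omega> i) < fst (\<omega> (i - 1))" "snd (\<omega> i)" "\<not> returns (shift i \<omega>)"
    using assms(3) by (auto simp: good_def escapes_def shift_def)
  obtain t0 where t0: "iwalk \<omega> t0 = i" "\<And>u. u < t0 \<Longrightarrow> iwalk \<omega> u < i"
    using first_arrival[OF gaps] by blast
  have fresh: "ienv \<omega> t0 k = 1 + of_bool (snd (\<omega> k))" if "i \<le> k" for k
    using t0(2) that by (intro ienv_fresh[OF gaps]) force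
  have "nearest \<omega> t0 (Suc i)"
    unfolding nearest_def
  proof (intro conjI allI impI)
    fix k assume k: "k \<noteq> iwalk \<omega> t0"
    have "pos \<omega> (Suc i) - pos \<omega> i = fst (\<omega> i)" by (simp add: pos_Suc)
    moreover have "pos \<omega> i - pos \<omega> (i - 1) = fst (\<omega> (i - 1))"
      using pos_Suc[of \<omega> "i - 1"] i(1) by simp
    moreover have "pos \<omega> k \<le> pos \<omega> (i - 1) \<or> pos \<omega> (Suc i) \<le> pos \<omega> k"
      using k t0(1) by (auto simp: pos_le_iff[OF gaps])
    moreover have "0 < fst (\<omega> i)" using gaps by (simp add: pos_gaps_def)
    ultimately show "\<bar>pos \<omega> (Suc i) - pos \<omega> (iwalk \<omega> t0)\<bar> \<le> \<bar>pos \<omega> k - pos \<omega> (iwalk \<omega> t0)\<bar>"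
      using i(2) unfolding t0(1) by linarith
  qed (use t0 fresh[of "Suc i"] in auto)
  then have next_i: "iwalk \<omega> (Suc t0) = Suc i" by (rule iwalk_eqI[OF gaps ties])
  have Ei: "ienv \<omega> (Suc t0) i = 1" using fresh[of i] i(3) t0(1) by simp
  have avoid: "pos \<omega> (iwalk \<omega> (Suc t0 + v)) \<noteq> pos \<omega> i" for v
  proof (rule coupling_avoids[OF greedy_run_iwalk[OF gaps] pos_gaps_shift[OF gaps] no_ties_shift[OF ties],
        where c = "pos \<omega> i" and z = "pos \<omega> i"])
    show "snd (shift i \<omega> 0)" using i(3) by (simp add: shift_def)
    show "pos \<omega> (iwalk \<omega> (Suc t0)) = pos \<omega> i + pos (shift i \<omega>) 1" by (simp add: pos_shift next_i)
    show "1 \<le> renv \<omega> (Suc t0) (pos \<omega> i)" using Ei by (simp add: renv_pos[OF gaps] del: ienv.simps)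
    show "pos \<omega> i < pos \<omega> (iwalk \<omega> (Suc t0))" by (simp add: next_i pos_less_iff[OF gaps])
    show "\<exists>k\<ge>1. y = pos \<omega> i + pos (shift i \<omega>) k" if y: "pos \<omega> i < y" "1 \<le> renv \<omega> (Suc t0) y" for y
    proof -
      obtain k where "y = pos \<omega> k" using y(2) by (auto simp: renv_def split: if_splits)
      moreover from this y(1) have "i < k" by (simp add: pos_less_iff[OF gaps])
      ultimately show ?thesis by (intro exI[of _ "k - i"]) (auto simp: pos_shift)
    qed
    show "renv \<omega> (Suc t0) (pos \<omega> i + pos (shift i \<omega>) k) = 1 + of_bool (snd (shift i \<omega> k))" if "1 \<le> k" for k
      using that fresh[of "i + k"] t0(1) by (simp add: pos_shift renv_pos[OF gaps] shift_def)
  qed (use i in auto)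
  show ?thesis
  proof (cases "t \<le> t0")
    case True
    then have "iwalk \<omega> u \<noteq> i" if "u < t" for u using t0(2)[of u] that by simp
    then show ?thesis using ienv_fresh[OF gaps, of t i] by simp
  next
    case False
    have "iwalk \<omega> u \<noteq> i" if "Suc t0 \<le> u" for u using avoid[of "u - Suc t0"] that by auto
    then show ?thesis using ienv_unvisited[of "Suc t0" t \<omega> i] False Ei by (simp del: ienv.simps)
  qed
qed

section \<open>Dependence of the walk on an initial segment of the sequence\<close>

lemma pos_cong: "(\<And>i. i < n \<Longrightarrow> \<omega> i = \<omega>' i) \<Longrightarrow> i \<le> n \<Longrightarrow> pos \<omega> i = pos \<omega>' i"
  by (simp add: pos_def)

text \<open>While n is present and the walk is below it, points beyond n are farther than n, so the
  choice depends only on gaps below n and on marks up to n.\<close>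

lemma nearest_upto:
  assumes gaps: "pos_gaps \<omega>" and s: "iwalk \<omega> t < n" and n: "1 \<le> ienv \<omega> t n"
  shows "nearest \<omega> t j \<longleftrightarrow> j \<le> n \<and> j \<noteq> iwalk \<omega> t \<and> 1 \<le> ienv \<omega> t j \<and>
    (\<forall>k. k \<le> n \<longrightarrow> k \<noteq> iwalk \<omega> t \<longrightarrow> 1 \<le> ienv \<omega> t k \<longrightarrow>
      \<bar>pos \<omega> j - pos \<omega> (iwalk \<omega> t)\<bar> \<le> \<bar>pos \<omega> k - pos \<omega> (iwalk \<omega> t)\<bar>)"
    (is "_ \<longleftrightarrow> ?R")
proof -
  define D where "D k = \<bar>pos \<omega> k - pos \<omega> (iwalk \<omega> t)\<bar>" for k
  have far: "D n < D k" if "n < k" for k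
  proof -
    have "pos \<omega> n < pos \<omega> k" "pos \<omega> (iwalk \<omega> t) < pos \<omega> n"
      using that s by (simp_all add: pos_less_iff[OF gaps])
    then show ?thesis by (simp add: D_def)
  qed
  have "j \<le> n" if "D j \<le> D n" using far[of j] that by (meson not_le)
  moreover have "D j \<le> D k" if "D j \<le> D n" "\<not> k \<le> n" for k using far[of k] that by simp
  moreover have "n \<noteq> iwalk \<omega> t" using s by simp
  ultimately show ?thesis using n unfolding nearest_def D_def[symmetric] by blast
qed

text \<open>The environments are compared only below n. The marks at n may differ, but what counts
  before the first visit to n is that n is present in both.\<close>

lemma walks_agree:
  assumes gaps: "pos_gaps \<omega>" "pos_gaps \<omega>'" and eq: "\<And>i. i < n \<Longrightarrow> \<omega> i = \<omega>' i"
    and "\<And>u. u < t \<Longrightarrow> iwalk \<omega> u < n"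
  shows "(\<forall>u\<le>t. iwalk \<omega>' u = iwalk \<omega> u) \<and> (\<forall>i<n. ienv \<omega>' t i = ienv \<omega> t i)"
  using assms(4)
proof (induction t)
  case 0
  then show ?case using eq by simp
next
  case (Suc t)
  have "iwalk \<omega> u < n" if "u < t" for u using Suc.prems that by simp
  from Suc.IH[OF this]
  have IH: "\<And>u. u \<le> t \<Longrightarrow> iwalk \<omega>' u = iwalk \<omega> u" "\<And>i. i < n \<Longrightarrow> ienv \<omega>' t i = ienv \<omega> t i"
    by blast+
  have s: "iwalk \<omega> t < n" "iwalk \<omega>' t = iwalk \<omega> t" using Suc.prems[OF lessI] IH(1)[OF order_refl] .
  have unvisited: "iwalk \<omega> u \<noteq> n" "iwalk \<omega>' u \<noteq> n" if "u < t" for u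
    using Suc.prems[of u] IH(1)[of u] that by auto
  have n: "1 \<le> ienv \<omega> t n" "1 \<le> ienv \<omega>' t n"
    using ienv_fresh[OF gaps(1) unvisited(1)] ienv_fresh[OF gaps(2) unvisited(2)] by simp_all
  have E: "1 \<le> ienv \<omega>' t k \<longleftrightarrow> 1 \<le> ienv \<omega> t k" if "k \<le> n" for k
    using that n IH(2)[of k] by (cases "k = n") auto
  have P: "pos \<omega>' k = pos \<omega> k" if "k \<le> n" for k using pos_cong[OF eq that] by simp
  have s': "iwalk \<omega>' t < n" using s by simp
  have "nearest \<omega>' t j \<longleftrightarrow> nearest \<omega> t j" for j
  proof -
    have "\<bar>pos \<omega>' j - pos \<omega>' (iwalk \<omega> t)\<bar> \<le> \<bar>pos \<omega>' k - pos \<omega>' (iwalk \<omega> t)\<bar> \<longleftrightarrow>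
      \<bar>pos \<omega> j - pos \<omega> (iwalk \<omega> t)\<bar> \<le> \<bar>pos \<omega> k - pos \<omega> (iwalk \<omega> t)\<bar>" if "j \<le> n" "k \<le> n" for k
      using P[OF that(1)] P[OF that(2)] P[OF less_imp_le[OF s(1)]] by simp
    then show ?thesis
      unfolding nearest_upto[OF gaps(1) s(1) n(1)] nearest_upto[OF gaps(2) s' n(2)] s(2)
      using E by blast
  qed
  then have "iwalk \<omega>' (Suc t) = iwalk \<omega> (Suc t)" by (simp add: iwalk_Suc)
  with IH(1) have "\<forall>u\<le>Suc t. iwalk \<omega>' u = iwalk \<omega> u" by (metis le_Suc_eq)
  moreover have "\<forall>i<n. ienv \<omega>' (Suc t) i = ienv \<omega> (Suc t) i" using IH(2) s(2) by simp
  ultimately show ?case ..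
qed

section \<open>The sweep back to the origin\<close>

definition first_return :: "(nat \<Rightarrow> real \<times> bool) \<Rightarrow> nat \<Rightarrow> bool" where
  "first_return \<omega> t \<longleftrightarrow> 1 \<le> t \<and> iwalk \<omega> t = 0 \<and> (\<forall>u. 1 \<le> u \<longrightarrow> u < t \<longrightarrow> iwalk \<omega> u \<noteq> 0)"

definition sweeps :: "nat \<Rightarrow> (nat \<Rightarrow> real \<times> bool) \<Rightarrow> bool" where
  "sweeps n \<omega> \<longleftrightarrow> (\<exists>t. first_return \<omega> t \<and> (\<exists>u\<le>t. iwalk \<omega> u = n) \<and> (\<forall>u\<le>t. iwalk \<omega> u \<le> n))"

lemma first_return_unique:
  assumes "first_return \<omega> t" "first_return \<omega> t'" shows "t = t'"
proof (rule ccontr)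
  assume "t \<noteq> t'"
  then consider "t < t'" | "t' < t" by linarith
  then show False using assms by cases (auto simp: first_return_def)
qed

lemma sweeps_unique:
  assumes "sweeps m \<omega>" "sweeps n \<omega>" shows "m = n"
proof -
  obtain t where t: "first_return \<omega> t" "\<exists>u\<le>t. iwalk \<omega> u = m" "\<forall>u\<le>t. iwalk \<omega> u \<le> m"
    using assms(1) by (auto simp: sweeps_def)
  obtain t' where t': "first_return \<omega> t'" "\<exists>u\<le>t'. iwalk \<omega> u = n" "\<forall>u\<le>t'. iwalk \<omega> u \<le> n"
    using assms(2) by (auto simp: sweeps_def)
  from t(1) t'(1) have "t = t'" by (rule first_return_unique)
  with t t' show ?thesis by (auto intro: order_antisym)
qed

text \<open>With a gap larger than T after n, the inequality says that from b the point a is closer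
  than the point \<open>Suc n\<close>.\<close>

definition dense :: "nat \<Rightarrow> real \<Rightarrow> (nat \<Rightarrow> real \<times> bool) \<Rightarrow> bool" where
  "dense n T \<omega> \<longleftrightarrow> (\<forall>a b. a < b \<longrightarrow> b \<le> n \<longrightarrow> (\<forall>i. a < i \<longrightarrow> i < b \<longrightarrow> \<not> good \<omega> i) \<longrightarrow>
     pos \<omega> b - pos \<omega> a \<le> pos \<omega> n - pos \<omega> b + T)"

text \<open>Invariant while moving left: c holds its last mark, everything in (c, n] is exhausted,
  and the indices below c have at most one mark. By the last premise some remaining point on the
  left is closer than \<open>Suc n\<close>, so the walk steps to the nearest remaining j < c and c
  is cleared. That premise is imposed at time t for all b \<le> c and survives the step: only the
  marks at c change, and for b \<le> j the witnesses lie below j.\<close>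

lemma sweep_left:
  assumes gaps: "pos_gaps \<omega>"
  shows "iwalk \<omega> t = c \<Longrightarrow> c \<le> n \<Longrightarrow> ienv \<omega> t c = 1 \<Longrightarrow> (\<And>j. c < j \<Longrightarrow> j \<le> n \<Longrightarrow> ienv \<omega> t j = 0) \<Longrightarrow>
    (\<And>j. j < c \<Longrightarrow> ienv \<omega> t j \<le> 1) \<Longrightarrow>
    (\<And>b. 1 \<le> b \<Longrightarrow> b \<le> c \<Longrightarrow> \<exists>a<b. 1 \<le> ienv \<omega> t a \<and> pos \<omega> b - pos \<omega> a < pos \<omega> (Suc n) - pos \<omega> b) \<Longrightarrow>
    \<exists>t'\<ge>t. iwalk \<omega> t' = 0 \<and> (\<forall>u. t \<le> u \<longrightarrow> u < t' \<longrightarrow> iwalk \<omega> u \<noteq> 0) \<and>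
      (\<forall>u. t \<le> u \<longrightarrow> u \<le> t' \<longrightarrow> iwalk \<omega> u \<le> n)"
proof (induction c arbitrary: t rule: less_induct)
  case (less c t)
  show ?case
  proof (cases "c = 0")
    case True
    with less.prems show ?thesis by (intro exI[of _ t]) auto
  next
    case False
    then have "1 \<le> c" by simp
    from less.prems(6)[OF this order_refl]
    obtain a where a: "a < c" "1 \<le> ienv \<omega> t a" "pos \<omega> c - pos \<omega> a < pos \<omega> (Suc n) - pos \<omega> c"
      by (elim exE conjE)
    define j where "j = iwalk \<omega> (Suc t)"
    have "nearest \<omega> t j" unfolding j_def by (rule nearest_iwalk[OF gaps])
    then have near: "j \<noteq> c" "1 \<le> ienv \<omega> t j" and
      closest: "\<And>k. k \<noteq> c \<Longrightarrow> 1 \<le> ienv \<omega> t k \<Longrightarrow> \<bar>pos \<omega> j - pos \<omega> c\<bar> \<le> \<bar>pos \<omega> k - pos \<omega> c\<bar>"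
      unfolding nearest_def less.prems(1) by blast+
    have close: "\<bar>pos \<omega> j - pos \<omega> c\<bar> \<le> \<bar>pos \<omega> a - pos \<omega> c\<bar>" using a by (intro closest) auto
    have ac: "pos \<omega> a < pos \<omega> c" using a(1) by (simp add: pos_less_iff[OF gaps])
    have "\<not> Suc n \<le> j"
    proof
      assume "Suc n \<le> j"
      then have "pos \<omega> (Suc n) \<le> pos \<omega> j" by (simp add: pos_le_iff[OF gaps])
      then show False using close ac a(3) by linarith
    qed
    then have jc: "j < c" using near less.prems(4)[of j] by force
    have between: "ienv \<omega> t k = 0" if "j < k" "k < c" for k
    proof (rule ccontr)
      assume "ienv \<omega> t k \<noteq> 0"
      then have "1 \<le> ienv \<omega> t k"
        using run_nonneg[OF greedy_run_iwalk[OF gaps], of t "pos \<omega> k"] by (simp add: renv_pos[OF gaps])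
      with that have "\<bar>pos \<omega> j - pos \<omega> c\<bar> \<le> \<bar>pos \<omega> k - pos \<omega> c\<bar>" by (intro closest) auto
      then show False using that pos_less_iff[OF gaps, of j k] pos_less_iff[OF gaps, of k c] by auto
    qed
    have E: "ienv \<omega> (Suc t) k = ienv \<omega> t k - of_bool (k = c)" for k using less.prems(1) by simp
    have "\<exists>t'\<ge>Suc t. iwalk \<omega> t' = 0 \<and> (\<forall>u. Suc t \<le> u \<longrightarrow> u < t' \<longrightarrow> iwalk \<omega> u \<noteq> 0) \<and>
      (\<forall>u. Suc t \<le> u \<longrightarrow> u \<le> t' \<longrightarrow> iwalk \<omega> u \<le> n)"
    proof (rule less.IH[OF jc])
      show "ienv \<omega> (Suc t) j = 1" using near jc less.prems(5)[of j] by (simp add: E del: ienv.simps)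
      show "ienv \<omega> (Suc t) k = 0" if "j < k" "k \<le> n" for k
        using that between[of k] less.prems(3) less.prems(4)[of k] by (cases k c rule: linorder_cases) (auto simp: E simp del: ienv.simps)
      show "\<exists>a<b. 1 \<le> ienv \<omega> (Suc t) a \<and> pos \<omega> b - pos \<omega> a < pos \<omega> (Suc n) - pos \<omega> b"
        if b: "1 \<le> b" "b \<le> j" for b
      proof -
        have "b \<le> c" using b jc by simp
        from less.prems(6)[OF b(1) this]
        obtain a where "a < b" "1 \<le> ienv \<omega> t a" "pos \<omega> b - pos \<omega> a < pos \<omega> (Suc n) - pos \<omega> b"
          by (elim exE conjE)
        then show ?thesis using b jc by (intro exI[of _ a]) (simp add: E del: ienv.simps)
      qed
    qed (use jc less.prems in \<open>auto simp: j_def[symmetric] E simp del: ienv.simps\<close>)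
    then obtain t' where t': "t' \<ge> Suc t" "iwalk \<omega> t' = 0"
      "\<forall>u. Suc t \<le> u \<longrightarrow> u < t' \<longrightarrow> iwalk \<omega> u \<noteq> 0" "\<forall>u. Suc t \<le> u \<longrightarrow> u \<le> t' \<longrightarrow> iwalk \<omega> u \<le> n" by blast
    show ?thesis
    proof (rule exI[of _ t'], intro conjI allI impI)
      show "iwalk \<omega> u \<noteq> 0" if "t \<le> u" "u < t'" for u
        using that t'(3)[rule_format, of u] less.prems(1) False by (cases "u = t") auto
      show "iwalk \<omega> u \<le> n" if "t \<le> u" "u \<le> t'" for u
        using that t'(4)[rule_format, of u] less.prems(1,2) by (cases "u = t") auto
    qed (use t' in auto)
  qed
qed

text \<open>Good indices and density refer to \<omega>, in which the walk escapes; they need not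
  persist in \<omega>'. They are used only for positions up to n and for the marks below n at the
  first arrival t0, and these the two walks share.\<close>

lemma escape_sweeps:
  assumes gaps: "pos_gaps \<omega>" and ties: "no_ties \<omega>" and gaps': "pos_gaps \<omega>'"
    and eq: "\<And>i. i < n \<Longrightarrow> \<omega> i = \<omega>' i" and n: "1 \<le> n"
    and esc: "escapes \<omega>" and dense: "dense n T \<omega>" and single: "\<not> snd (\<omega>' n)" and big: "T < fst (\<omega>' n)"
  shows "sweeps n \<omega>'"
proof -
  obtain t0 where t0: "iwalk \<omega> t0 = n" "\<And>u. u < t0 \<Longrightarrow> iwalk \<omega> u < n"
    using first_arrival[OF gaps] by blast
  have same: "\<And>u. u \<le> t0 \<Longrightarrow> iwalk \<omega>' u = iwalk \<omega> u" "\<And>i. i < n \<Longrightarrow> ienv \<omega>' t0 i = ienv \<omega> t0 i"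
    using walks_agree[OF gaps gaps' eq t0(2), of t0] by auto
  have pos_eq: "pos \<omega>' k = pos \<omega> k" if "k \<le> n" for k using pos_cong[OF eq that] by simp
  have t0_pos: "1 \<le> t0" using t0(1) n by (cases t0) auto
  \<comment> \<open>Every index below n has been visited before t0, since the walk does not jump, so
    it has lost at least one of its at most two marks.\<close>
  have left: "ienv \<omega>' t0 i \<le> 1" if "i < n" for i
  proof -
    have "i < iwalk \<omega> t0" using t0(1) that by simp
    then obtain t where t: "t < t0" "iwalk \<omega> t = i" by (rule iwalk_no_jump[OF gaps])
    then show ?thesis
      using run_visited[OF greedy_run_iwalk[OF gaps], of 0 t t0] same(2)[OF that]
      by (cases "snd (\<omega> i)") (auto simp: renv_pos[OF gaps])
  qed
  have "\<exists>t'\<ge>t0. iwalk \<omega>' t' = 0 \<and> (\<forall>u. t0 \<le> u \<longrightarrow> u < t' \<longrightarrow> iwalk \<omega>' u \<noteq> 0) \<and>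
      (\<forall>u. t0 \<le> u \<longrightarrow> u \<le> t' \<longrightarrow> iwalk \<omega>' u \<le> n)"
  proof (rule sweep_left[OF gaps'])
    show "iwalk \<omega>' t0 = n" using same(1) t0(1) by simp
    have "iwalk \<omega>' u \<noteq> n" if "u < t0" for u using same(1)[of u] t0(2)[of u] that by simp
    from ienv_fresh[OF gaps' this] show "ienv \<omega>' t0 n = 1" using single by simp
    show "\<exists>a<b. 1 \<le> ienv \<omega>' t0 a \<and> pos \<omega>' b - pos \<omega>' a < pos \<omega>' (Suc n) - pos \<omega>' b"
      if b: "1 \<le> b" "b \<le> n" for b
    proof -
      \<comment> \<open>The stretch around b without good points runs from the last good index (or
        0) before b to the first one (or n) from b on. Its left end a still has a mark at time t0: a
        good index by \<open>good_stays\<close>, and 0 because \<omega> escapes and never takes the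
        second mark of 0.\<close>
      define b' where "b' = (LEAST k. b \<le> k \<and> (good \<omega> k \<or> k = n))"
      define a where "a = Max {k. k < b \<and> (good \<omega> k \<or> k = 0)}"
      have b': "b \<le> b'" "b' \<le> n" "\<And>k. b \<le> k \<Longrightarrow> k < b' \<Longrightarrow> \<not> good \<omega> k"
        unfolding b'_def using b LeastI[of "\<lambda>k. b \<le> k \<and> (good \<omega> k \<or> k = n)" n]
          Least_le[of "\<lambda>k. b \<le> k \<and> (good \<omega> k \<or> k = n)" n]
        by (auto dest: not_less_Least)
      have fin: "finite {k. k < b \<and> (good \<omega> k \<or> k = 0)}" by simp
      have "0 \<in> {k. k < b \<and> (good \<omega> k \<or> k = 0)}" using b by simp
      then have a: "a < b" "good \<omega> a \<or> a = 0"
        using Max_in[OF fin] unfolding a_def[symmetric] by blast+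
      have a_max: "\<not> good \<omega> k" if "a < k" "k < b" for k
        using Max_ge[OF fin, of k] that unfolding a_def[symmetric] by auto
      have "\<not> good \<omega> i" if "a < i" "i < b'" for i
        using that a_max[of i] b'(3)[of i] by (cases "i < b") auto
      then have "pos \<omega> b' - pos \<omega> a \<le> pos \<omega> n - pos \<omega> b' + T"
        using dense a(1) b'(1,2) unfolding dense_def by (meson less_le_trans)
      moreover have "pos \<omega> b \<le> pos \<omega> b'" using b'(1) by (simp add: pos_le_iff[OF gaps])
      moreover have "pos \<omega>' (Suc n) = pos \<omega> n + fst (\<omega>' n)" by (simp add: pos_Suc pos_eq)
      ultimately have "pos \<omega>' b - pos \<omega>' a < pos \<omega>' (Suc n) - pos \<omega>' b"
        using big pos_eq[of b] pos_eq[of a] b a(1) by simp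
      moreover have "1 \<le> ienv \<omega> t0 a"
      proof (cases "good \<omega> a")
        case True
        then show ?thesis by (rule good_stays[OF gaps ties])
      next
        case False
        with a(2) have "a = 0" by simp
        moreover have "iwalk \<omega> u \<noteq> 0" if "1 \<le> u" for u
          using esc that by (auto simp: escapes_def returns_def)
        then have "ienv \<omega> t0 0 = ienv \<omega> 1 0" using t0_pos by (intro ienv_unvisited) auto
        moreover have "ienv \<omega> 1 0 = 1" using esc by (simp add: escapes_def)
        ultimately show ?thesis by simp
      qed
      ultimately show ?thesis using a(1) b(2) same(2)[of a] by (intro exI[of _ a]) auto
    qed
  qed (use left in auto)
  then obtain t' where t': "t' \<ge> t0" "iwalk \<omega>' t' = 0" "\<forall>u. t0 \<le> u \<longrightarrow> u < t' \<longrightarrow> iwalk \<omega>' u \<noteq> 0"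
      "\<forall>u. t0 \<le> u \<longrightarrow> u \<le> t' \<longrightarrow> iwalk \<omega>' u \<le> n" by blast
  show ?thesis
    unfolding sweeps_def first_return_def
  proof (rule exI[of _ t'], intro conjI allI impI)
    show "1 \<le> t'" using t'(1) t0_pos by simp
    show "iwalk \<omega>' u \<noteq> 0" if "1 \<le> u" "u < t'" for u
      using that t'(3) same(1)[of u] esc by (cases "t0 \<le> u") (auto simp: escapes_def returns_def)
    show "\<exists>u\<le>t'. iwalk \<omega>' u = n" using same(1)[of t0] t0(1) t'(1) by auto
    show "iwalk \<omega>' u \<le> n" if "u \<le> t'" for u
      using that t'(4) same(1)[of u] t0(2)[of u] by (cases "t0 \<le> u") auto
  qed (use t' in auto)
qed

section \<open>A greedy run does not drift away from a point\<close>

lemma pos_case_nat: "pos (case_nat x \<omega>) (Suc k) = fst x + pos \<omega> k"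
  by (induction k) (auto simp: pos_Suc)

lemma pos_diff: "pos (\<lambda>i. (T (Suc i) - T i, Q i)) k = T k - T 0"
  by (induction k) (auto simp: pos_Suc)

text \<open>The run stands at the front, with untouched points on its right. A fictitious barrier is
  put at T i - d, beyond z, and \<open>coupling_hits\<close> turns the return to it into a visit of
  z. Arbitrarily large d are asked for because z depends on the run, so its distance is not known in
  advance.\<close>

lemma front_hits:
  fixes T :: "nat \<Rightarrow> real"
  assumes run: "greedy_run E S" and T: "strict_mono T"
    and sup: "\<And>y. T i \<le> y \<Longrightarrow> 1 \<le> E n y \<Longrightarrow> y \<in> range T"
    and fresh: "\<And>k. i \<le> k \<Longrightarrow> E n (T k) = 1 + of_bool (Q k)"
    and ret: "\<And>K. \<exists>d>K. returns (case_nat (d, True) (shift i (\<lambda>i. (T (Suc i) - T i, Q i)))) \<and>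
       no_ties (case_nat (d, True) (shift i (\<lambda>i. (T (Suc i) - T i, Q i))))"
    and n: "S n = T i" and z: "z < T i" "1 \<le> E n z" "\<And>y. z < y \<Longrightarrow> y < T i \<Longrightarrow> E n y < 1"
  obtains v where "v \<ge> 1" "S (n + v) = z"
proof -
  obtain d where d: "T i - z < d"
    "returns (case_nat (d, True) (shift i (\<lambda>i. (T (Suc i) - T i, Q i))))"
    "no_ties (case_nat (d, True) (shift i (\<lambda>i. (T (Suc i) - T i, Q i))))"
    using ret by blast
  define \<omega> where "\<omega> = case_nat (d, True) (shift i (\<lambda>i. (T (Suc i) - T i, Q i)))"
  have pos_\<omega>: "pos \<omega> (Suc k) = d + T (i + k) - T i" for k
    by (simp add: \<omega>_def pos_case_nat pos_shift pos_diff)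
  have gaps: "pos_gaps \<omega>"
    using d(1) z(1) strict_monoD[OF T] by (auto simp: pos_gaps_def \<omega>_def shift_def split: nat.split)
  obtain v where "S (n + v) = z" "v \<ge> 1"
  proof (rule coupling_hits[OF run gaps, where n = n and z = z and c = "T i - d"])
    show "no_ties \<omega>" "returns \<omega>" using d by (simp_all add: \<omega>_def)
    show "snd (\<omega> 0)" by (simp add: \<omega>_def)
    show "S n = T i - d + pos \<omega> 1" using n pos_\<omega>[of 0] by simp
    show "\<exists>k\<ge>1. y = T i - d + pos \<omega> k" if y: "z < y" "1 \<le> E n y" for y
    proof -
      have "T i \<le> y" using z(3)[of y] y by force
      then obtain k where "y = T k" using sup y by blast
      moreover from this \<open>T i \<le> y\<close> have "i \<le> k" using strict_mono_less_eq[OF T] by simp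
      ultimately show ?thesis using pos_\<omega>[of "k - i"] by (intro exI[of _ "Suc (k - i)"]) auto
    qed
    show "E n (T i - d + pos \<omega> k) = 1 + of_bool (snd (\<omega> k))" if "1 \<le> k" for k
    proof -
      obtain l where l: "k = Suc l" using \<open>1 \<le> k\<close> by (cases k) auto
      then show ?thesis using fresh[of "i + l"] pos_\<omega>[of l] by (simp add: \<omega>_def shift_def)
    qed
  qed (use d(1) z n in auto)
  then show thesis using that by blast
qed

text \<open>The run would tend to infinity on the right of \<xi>. Take the last visit m to its
  lowest position after a late time, and wait until it first reaches a fresh point
  \<open>T j\<close>. By then the points between \<open>S m\<close> and \<open>T j\<close> are
  exhausted, so the nearest remaining point z on the left is not above \<open>S m\<close>. By
  \<open>front_hits\<close> the run comes back to z, against the choice of m.\<close>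

lemma no_drift:
  fixes T :: "nat \<Rightarrow> real"
  assumes run: "greedy_run E S" and X: "locally_finite X" and YX: "Y \<subseteq> X"
    and E0: "\<And>y. E 0 y = of_bool (y \<in> X) + of_bool (y \<in> Y)"
    and T: "strict_mono T" "X \<inter> {0<..} = range T"
    and ret: "\<And>i K. \<exists>d>K. returns (case_nat (d, True) (shift i (\<lambda>i. (T (Suc i) - T i, T i \<in> Y)))) \<and>
       no_ties (case_nat (d, True) (shift i (\<lambda>i. (T (Suc i) - T i, T i \<in> Y))))"
    and \<xi>: "\<And>n. 1 \<le> E n \<xi>" and right: "\<And>n. n1 \<le> n \<Longrightarrow> \<xi> < S n"
  shows False
proof -
  have inX: "y \<in> X" if "1 \<le> E n y" for n y
  proof -
    have "1 \<le> E 0 y" using that run_mono[OF run, of 0 n y] by simp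
    then show ?thesis using E0[of y] YX by (cases "y \<in> X"; cases "y \<in> Y") auto
  qed
  have TX: "T k \<in> X" "0 < T k" for k using T(2) by auto
  have E0T: "E 0 (T k) = 1 + of_bool (T k \<in> Y)" for k using TX by (simp add: E0)
  have to_inf: "\<exists>n2. \<forall>n\<ge>n2. K < S n" for K
  proof -
    have "finite (X \<inter> {\<xi>..K})" using X unfolding locally_finite_def by simp
    then obtain n where n: "\<And>t. n \<le> t \<Longrightarrow> S t \<notin> X \<inter> {\<xi>..K}" using run_leaves_finite[OF run] by blast
    have "K < S t" if "max n n1 \<le> t" for t
      using n[of t] right[of t] that inX[OF run_present[OF run, of t]] by auto
    then show ?thesis by blast
  qed
  have unb: "\<exists>i. K < T i" for K
  proof (rule ccontr)
    assume "\<not> ?thesis"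
    then have "range T \<subseteq> X \<inter> {0..K}" using TX(1) less_imp_le[OF TX(2)] by (auto simp: not_less)
    moreover have "finite (X \<inter> {0..K})" using X unfolding locally_finite_def by simp
    ultimately have "finite (range T)" by (rule finite_subset)
    then show False using range_inj_infinite[OF strict_mono_imp_inj_on[OF T(1)]] by simp
  qed
  have front: "\<exists>n>m. S n = T j \<and> (\<forall>t<n. S t < T j)" if m: "\<forall>t\<le>m. S t < T j" for m j
  proof -
    define n where "n = (LEAST t. T j \<le> S t)"
    have "\<exists>t. T j \<le> S t" using to_inf[of "T j"] less_imp_le by blast
    then have n: "T j \<le> S n" "\<And>t. t < n \<Longrightarrow> S t < T j"
      unfolding n_def by (rule LeastI_ex, metis not_less_Least not_le)
    have "m < n" using n(1) m by (meson not_le)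
    moreover have "S n = T j"
    proof (rule ccontr)
      assume "S n \<noteq> T j"
      have "S n < T j"
      proof (rule run_no_jump_right[OF run, of 0])
        show "1 \<le> E 0 (T j)" by (simp add: E0T)
        show "S t \<noteq> T j" if "t \<le> n" for t using that n(2)[of t] \<open>S n \<noteq> T j\<close> by (cases "t = n") auto
      qed (use m in auto)
      with n(1) show False by simp
    qed
    ultimately show ?thesis using n(2) by blast
  qed
  \<comment> \<open>A fresh point beyond all positions up to n1. Being positive, it also witnesses
    below that the run has been to the right of every point y \<le> 0.\<close>
  obtain i where i: "Max (S ` {..n1}) < T i" using unb by blast
  then have "\<forall>t\<le>n1. S t < T i" by (auto simp: Max_less_iff)
  then obtain n' where n': "n1 < n'" "S n' = T i" using front[of n1 i] by blast
  \<comment> \<open>A is finite since the run tends to infinity. Hence b is the lowest position from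
    time n' on, and m is the last time at b.\<close>
  define A where "A = {n. n' \<le> n \<and> S n \<le> S n'}"
  obtain n2 where "\<And>n. n2 \<le> n \<Longrightarrow> S n' < S n" using to_inf[of "S n'"] by blast
  then have "A \<subseteq> {..<n2}" by (force simp: A_def not_less[symmetric])
  then have finA: "finite A" by (rule finite_subset) simp
  have n'A: "n' \<in> A" by (simp add: A_def)
  define b where "b = Min (S ` A)"
  define B where "B = {n \<in> A. S n = b}"
  define m where "m = Max B"
  have "b \<in> S ` A" unfolding b_def using finA n'A by (intro Min_in) auto
  then have "B \<noteq> {}" "finite B" using finA by (auto simp: B_def)
  then have "m \<in> B" unfolding m_def by (intro Max_in)
  then have m: "n' \<le> m" "S m = b" "S m \<le> S n'" by (auto simp: B_def A_def)
  have later: "S m < S n" if "m < n" for n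
  proof (cases "n \<in> A")
    case True
    then have "b \<le> S n" unfolding b_def using finA by (intro Min_le) auto
    moreover have "S n \<noteq> b"
    proof
      assume "S n = b"
      with True have "n \<le> m" unfolding m_def using \<open>finite B\<close> by (intro Max_ge) (auto simp: B_def)
      with that show False by simp
    qed
    ultimately show ?thesis using m(2) by simp
  next
    case False
    then show ?thesis using m that by (auto simp: A_def)
  qed
  \<comment> \<open>\<open>T j\<close> is the first positive point beyond all positions up to m: the
    run has reached or passed every positive point before it, while it and all points to its right
    are untouched.\<close>
  define j where "j = (LEAST j. \<forall>t\<le>m. S t < T j)"
  obtain j0 where "Max (S ` {..m}) < T j0" using unb by blast
  then have "\<forall>t\<le>m. S t < T j0" by (auto simp: Max_less_iff)
  then have j: "\<forall>t\<le>m. S t < T j" unfolding j_def by (rule LeastI)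
  have j_min: "\<exists>t\<le>m. T k \<le> S t" if "k < j" for k
    using not_less_Least[OF that[unfolded j_def]] by (auto simp: not_less)
  obtain n3 where n3: "m < n3" "S n3 = T j" "\<forall>t<n3. S t < T j" using front[OF j] by blast
  \<comment> \<open>Two crossings: coming down to \<open>S m\<close> the run visits y before m,
    going up to \<open>T j\<close> it visits y again after m, and y had at most two marks.\<close>
  have absent: "E n3 y < 1" if y: "S m < y" "y < T j" for y
  proof (rule ccontr)
    assume "\<not> E n3 y < 1"
    then have present: "1 \<le> E t y" if "t \<le> n3" for t using run_mono[OF run that, of y] by simp
    have "y \<in> X" using inX[OF present[of 0]] by simp
    have "\<exists>t\<le>m. y \<le> S t"
    proof (cases "y \<le> 0")
      case True
      then show ?thesis using m(1) n'(2) TX(2)[of i] by (intro exI[of _ n']) auto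
    next
      case False
      with \<open>y \<in> X\<close> have "y \<in> range T" unfolding T(2)[symmetric] by simp
      then obtain k where k: "y = T k" by blast
      with y(2) have "k < j" using strict_mono_less[OF T(1)] by simp
      then show ?thesis using j_min k by blast
    qed
    then obtain t where t: "t \<le> m" "y \<le> S t" by blast
    have "\<exists>u. t \<le> u \<and> u \<le> m \<and> S u = y"
    proof (rule ccontr)
      assume no: "\<not> ?thesis"
      then have "y < S t" using t by force
      have "y < S m"
        by (rule run_no_jump_left[OF run t(1) present]) (use no \<open>y < S t\<close> t n3(1) in auto)
      with y show False by simp
    qed
    then obtain u where u: "u \<le> m" "S u = y" by blast
    with y have "u < m" by (cases "u = m") auto
    then have "E m y \<le> E 0 y - 1" using run_visited[OF run, of 0 u m] u(2) by simp
    moreover have "E 0 y \<le> 2" by (simp add: E0)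
    moreover have "\<exists>u. m \<le> u \<and> u \<le> n3 \<and> S u = y"
    proof (rule ccontr)
      assume no: "\<not> ?thesis"
      have "S n3 < y"
        by (rule run_no_jump_right[OF run less_imp_le[OF n3(1)] present]) (use no y n3(1) in auto)
      with y n3(2) show False by simp
    qed
    then obtain w where w: "m \<le> w" "w \<le> n3" "S w = y" by blast
    with y n3(2) have "w < n3" by (cases "w = n3") auto
    then have "E n3 y \<le> E m y - 1" using run_visited[OF run w(1)] w(3) by simp
    ultimately show False using present[of n3] by simp
  qed
  define Z where "Z = {y \<in> X \<inter> {\<xi>..T j}. y < T j \<and> 1 \<le> E n3 y}"
  have "finite (X \<inter> {\<xi>..T j})" using X unfolding locally_finite_def by simp
  then have finZ: "finite Z" by (rule rev_finite_subset) (auto simp: Z_def)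
  have "\<xi> < T j" using right[of n3] n3 n' m by simp
  then have "\<xi> \<in> Z" using \<xi> inX by (auto simp: Z_def)
  define z where "z = Max Z"
  have "z \<in> Z" unfolding z_def using finZ \<open>\<xi> \<in> Z\<close> by (intro Max_in) auto
  then have z: "z < T j" "1 \<le> E n3 z" "\<xi> \<le> z" by (auto simp: Z_def)
  obtain v where v: "v \<ge> 1" "S (n3 + v) = z"
  proof (rule front_hits[OF run T(1), where i = j and n = n3 and z = z and Q = "\<lambda>i. T i \<in> Y"])
    show "y \<in> range T" if "T j \<le> y" "1 \<le> E n3 y" for y
      using that inX TX(2)[of j] unfolding T(2)[symmetric] by auto
    show "E n3 (T k) = 1 + of_bool (T k \<in> Y)" if "j \<le> k" for k
    proof -
      have "T j \<le> T k" using that strict_mono_less_eq[OF T(1)] by simp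
      then have "E n3 (T k) = E 0 (T k)" using n3(3) by (intro run_unvisited[OF run]) force+
      then show ?thesis by (simp add: E0T)
    qed
    show "E n3 y < 1" if y: "z < y" "y < T j" for y
    proof (rule ccontr)
      assume "\<not> E n3 y < 1"
      then have "1 \<le> E n3 y" by simp
      then have "y \<in> Z" using y z(3) inX by (auto simp: Z_def)
      then have "y \<le> z" unfolding z_def using finZ by (intro Max_ge)
      with y show False by simp
    qed
  qed (use ret n3 z in auto)
  have "z \<le> S m" using absent[of z] z by force
  with later[of "n3 + v"] n3(1) v show False by simp
qed

section \<open>Counting\<close>

text \<open>A one-sided maximal inequality for averages looking backwards from n. If the last index
  is bad with witness a, the block from a to n pays for its own length, and the induction continues
  below a.\<close>

lemma maximal_count:
  fixes v :: "nat \<Rightarrow> real"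
  assumes v: "\<And>i. 0 \<le> v i" and l: "0 < l"
  shows "l * card {n. n < N \<and> (\<exists>a\<le>n. l * (real n + 1 - real a) \<le> (\<Sum>i=a..n. v i))} \<le> (\<Sum>i<N. v i)"
proof (induction N rule: less_induct)
  case (less N)
  define B where "B N = {n. n < N \<and> (\<exists>a\<le>n. l * (real n + 1 - real a) \<le> (\<Sum>i=a..n. v i))}" for N
  have fin: "finite (B N)" for N by (rule finite_subset[of _ "{..<N}"]) (auto simp: B_def)
  show ?case
  proof (cases N)
    case (Suc n)
    show ?thesis
    proof (cases "n \<in> B N")
      case False
      then have "B N = B n" using Suc by (auto simp: B_def less_Suc_eq)
      then show ?thesis using less[of n] Suc v[of n] by (simp add: B_def)
    next
      case True
      then obtain a where a: "a \<le> n" "l * (real n + 1 - real a) \<le> (\<Sum>i=a..n. v i)" by (auto simp: B_def)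
      have "B N \<subseteq> B a \<union> {a..n}" using Suc by (auto simp: B_def less_Suc_eq)
      then have "card (B N) \<le> card (B a \<union> {a..n})" using fin by (intro card_mono) auto
      also have "\<dots> \<le> card (B a) + card {a..n}" by (rule card_Un_le)
      finally have "real (card (B N)) \<le> real (card (B a)) + (real n + 1 - real a)"
        using a(1) by (simp add: of_nat_diff flip: of_nat_le_iff)
      then have "l * card (B N) \<le> l * card (B a) + l * (real n + 1 - real a)"
        using l by (simp add: distrib_left[symmetric])
      also have "\<dots> \<le> (\<Sum>i<a. v i) + (\<Sum>i=a..n. v i)"
        using less[of a] a Suc by (intro add_mono) (auto simp: B_def)
      also have "\<dots> = (\<Sum>i<N. v i)"
        using sum.atLeastLessThan_concat[of 0 a "Suc n" v] a(1)
        by (simp only: Suc lessThan_atLeast0 atLeastLessThanSuc_atLeastAtMost le_SucI le0)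
      finally show ?thesis by (simp add: B_def)
    qed
  qed simp
qed

lemma good_shift: "1 \<le> j \<Longrightarrow> good (shift i \<omega>) j \<longleftrightarrow> good \<omega> (i + j)"
proof -
  assume "1 \<le> j"
  then have "shift i \<omega> (j - 1) = \<omega> (i + j - 1)" by (simp add: shift_def)
  moreover have "shift j (shift i \<omega>) = shift (i + j) \<omega>" by (auto simp: shift_def fun_eq_iff ac_simps)
  ultimately show ?thesis using \<open>1 \<le> j\<close> by (simp add: good_def shift_def)
qed

text \<open>Majorises the gap at 0 when none of the next m indices is good: a gap beyond K is
  charged to the first summand, any other to the second. The mean can be made small by choice of K
  and m (\<open>barren_small\<close>).\<close>

definition barren :: "real \<Rightarrow> nat \<Rightarrow> (nat \<Rightarrow> real \<times> bool) \<Rightarrow> real" where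
  "barren K m \<omega> = fst (\<omega> 0) * of_bool (K < fst (\<omega> 0)) + K * of_bool (\<forall>j. 1 \<le> j \<longrightarrow> j \<le> m \<longrightarrow> \<not> good \<omega> j)"

lemma barren_nonneg: "pos_gaps \<omega> \<Longrightarrow> 0 \<le> K \<Longrightarrow> 0 \<le> barren K m (shift i \<omega>)"
  by (auto simp: barren_def shift_def pos_gaps_def less_imp_le)

lemma pos_sum: "a \<le> b \<Longrightarrow> pos \<omega> b - pos \<omega> a = (\<Sum>i=a..<b. fst (\<omega> i))"
  by (induction b rule: dec_induct) (auto simp: pos_Suc)

text \<open>Let L be the number of indices from a to n. If fewer than half of these gaps are below
  \<delta>, the way from a to the point after n has length at least \<delta> L / 2. If
  \<open>barren\<close> averages less than \<delta>/4, a stretch from a to b without good points has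
  length at most \<delta> L / 4 + K m, that is, half of the former plus K m. Doubling gives the
  inequality of \<open>dense\<close> with T = 2 K m + K, where the last K bounds the gap after
  n.\<close>

lemma not_dense_cases:
  assumes gaps: "pos_gaps \<omega>" and \<delta>: "0 < \<delta>" "\<delta> \<le> 4 * K"
    and nd: "\<not> dense n (2 * K * m + K) \<omega>"
  shows "(\<exists>a\<le>n. 1/2 * (real n + 1 - real a) \<le> (\<Sum>i=a..n. of_bool (fst (\<omega> i) < \<delta>))) \<or>
    (\<exists>a\<le>n. \<delta>/4 * (real n + 1 - real a) \<le> (\<Sum>i=a..n. barren K m (shift i \<omega>)))"
proof (rule ccontr)
  assume neg: "\<not> ?thesis"
  have w: "(\<Sum>i=a..n. of_bool (fst (\<omega> i) < \<delta>)) < 1/2 * (real n + 1 - real a)" if "a \<le> n" for a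
  proof (rule ccontr)
    assume "\<not> ?thesis"
    then have "1/2 * (real n + 1 - real a) \<le> (\<Sum>i=a..n. of_bool (fst (\<omega> i) < \<delta>))" by (rule leI)
    with neg that show False by blast
  qed
  have v: "(\<Sum>i=a..n. barren K m (shift i \<omega>)) < \<delta>/4 * (real n + 1 - real a)" if "a \<le> n" for a
  proof (rule ccontr)
    assume "\<not> ?thesis"
    then have "\<delta>/4 * (real n + 1 - real a) \<le> (\<Sum>i=a..n. barren K m (shift i \<omega>))" by (rule leI)
    with neg that show False by blast
  qed
  have K: "0 \<le> K" using \<delta> by simp
  have nn: "0 \<le> barren K m (shift i \<omega>)" for i by (rule barren_nonneg[OF gaps K])
  have "dense n (2 * K * m + K) \<omega>"
    unfolding dense_def
  proof (intro allI impI)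
    fix a b assume ab: "a < b" "b \<le> n" and no: "\<forall>i. a < i \<longrightarrow> i < b \<longrightarrow> \<not> good \<omega> i"
    define L where "L = real n + 1 - real a"
    \<comment> \<open>The case a = n of the bound on \<open>barren\<close>, combined with \<delta>
      \<le> 4 K.\<close>
    have gap_n: "fst (\<omega> n) \<le> K"
    proof (rule ccontr)
      assume big: "\<not> fst (\<omega> n) \<le> K"
      then have "fst (\<omega> n) \<le> barren K m (shift n \<omega>)" using K by (simp add: barren_def shift_def)
      moreover have "barren K m (shift n \<omega>) < \<delta>/4" using v[of n] by simp
      ultimately show False using big \<delta> by simp
    qed
    have "(\<Sum>i=a..n. \<delta> - \<delta> * of_bool (fst (\<omega> i) < \<delta>)) \<le> (\<Sum>i=a..n. fst (\<omega> i))"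
      using gaps \<delta>(1) by (intro sum_mono) (auto simp: pos_gaps_def less_imp_le)
    moreover have "(\<Sum>i=a..n. \<delta> - \<delta> * of_bool (fst (\<omega> i) < \<delta>)) =
        \<delta> * L - \<delta> * (\<Sum>i=a..n. of_bool (fst (\<omega> i) < \<delta>))"
      using ab by (simp add: sum_subtractf sum_distrib_left L_def of_nat_diff algebra_simps)
    moreover have "\<delta> * (\<Sum>i=a..n. of_bool (fst (\<omega> i) < \<delta>)) \<le> \<delta> * (1/2 * L)"
      using w[of a] ab \<delta>(1) by (intro mult_left_mono) (auto simp: L_def)
    moreover have "(\<Sum>i=a..n. fst (\<omega> i)) = pos \<omega> n + fst (\<omega> n) - pos \<omega> a"
      using pos_sum[of a "Suc n" \<omega>] ab by (simp add: pos_Suc atLeastLessThanSuc_atLeastAtMost)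
    ultimately have lower: "\<delta>/2 * L \<le> pos \<omega> n + K - pos \<omega> a" using gap_n by simp
    \<comment> \<open>If i + m < b, the window of \<open>barren\<close> stays inside the stretch and
      contains no good index; for the last m indices before b the allowance K stands in.\<close>
    have gap_le: "fst (\<omega> i) \<le> barren K m (shift i \<omega>) + K * of_bool (b \<le> i + m)" if "a \<le> i" "i < b" for i
    proof (cases "i + m < b")
      case True
      then have "\<not> good (shift i \<omega>) j" if "1 \<le> j" "j \<le> m" for j
        using no that \<open>a \<le> i\<close> by (subst good_shift) auto
      then show ?thesis using gaps K True by (auto simp: barren_def shift_def)
    next
      case False
      then show ?thesis using K by (auto simp: barren_def shift_def)
    qed
    have "pos \<omega> b - pos \<omega> a \<le> (\<Sum>i=a..<b. barren K m (shift i \<omega>) + K * of_bool (b \<le> i + m))"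
      using ab by (simp only: pos_sum less_imp_le) (intro sum_mono gap_le, auto)
    also have "\<dots> = (\<Sum>i=a..<b. barren K m (shift i \<omega>)) + K * (\<Sum>i=a..<b. of_bool (b \<le> i + m))"
      by (simp add: sum.distrib sum_distrib_left)
    also have "\<dots> \<le> \<delta>/4 * L + K * m"
    proof (intro add_mono mult_left_mono K)
      have "(\<Sum>i=a..<b. barren K m (shift i \<omega>)) \<le> (\<Sum>i=a..n. barren K m (shift i \<omega>))"
        using ab nn by (intro sum_mono2) auto
      with v[of a] ab show "(\<Sum>i=a..<b. barren K m (shift i \<omega>)) \<le> \<delta>/4 * L" by (simp add: L_def)
      have "(\<Sum>i=a..<b. of_bool (b \<le> i + m)) = real (card {i \<in> {a..<b}. b \<le> i + m})"
        by (simp add: sum.If_cases of_bool_def Int_def)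
      also have "\<dots> \<le> real (card {b - m..<b})" by (intro of_nat_mono card_mono) auto
      also have "\<dots> \<le> m" by simp
      finally show "(\<Sum>i=a..<b. of_bool (b \<le> i + m)) \<le> real m" .
    qed
    finally show "pos \<omega> b - pos \<omega> a \<le> pos \<omega> n - pos \<omega> b + (2 * K * real m + K)"
      using lower by (simp add: algebra_simps)
  qed
  with nd show False by simp
qed

section \<open>Independent gaps and marks\<close>

lemma pred_le_eq_real [measurable (raw)]:
  fixes f g :: "'a \<Rightarrow> real"
  assumes "f \<in> borel_measurable M" "g \<in> borel_measurable M"
  shows "Measurable.pred M (\<lambda>w. f w \<le> g w)" and "Measurable.pred M (\<lambda>w. f w = g w)"
  unfolding Measurable.pred_def
  using assms by (rule borel_measurable_le, rule borel_measurable_eq)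

text \<open>The two tail formulas describe a unit exponential gap with an independent second mark of
  probability p.\<close>

locale gap_mark_law = prob_space \<mu> for \<mu> :: "(real \<times> bool) measure" +
  fixes p :: real
  assumes sets_\<mu>: "sets \<mu> = sets (borel \<Otimes>\<^sub>M count_space UNIV)"
    and tail: "0 \<le> s \<Longrightarrow> prob {z \<in> space \<mu>. s < fst z} = exp (- s)"
    and tail_mark: "0 \<le> s \<Longrightarrow> prob {z \<in> space \<mu>. s < fst z \<and> snd z} = p * exp (- s)"
    and p_pos: "0 < p" and p_less: "p < 1"
begin

lemma space_\<mu> [simp]: "space \<mu> = UNIV"
  using sets_eq_imp_space_eq[OF sets_\<mu>] by (simp add: space_pair_measure)

sublocale seq: sequence_space \<mu>
  unfolding sequence_space_def by (rule product_prob_spaceI) (rule prob_space_axioms)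

abbreviation S :: "(nat \<Rightarrow> real \<times> bool) measure" where
  "S \<equiv> \<Pi>\<^sub>M i\<in>UNIV. \<mu>"

sublocale SS: pair_sigma_finite S S
  by unfold_locales

sublocale LS: pair_sigma_finite \<mu> S
  by unfold_locales

lemma space_S [simp]: "space S = UNIV"
  by (simp add: space_PiM)

section \<open>Measurability of the walk and of the events built from it\<close>

lemma sets_CollectI: "Measurable.pred S P \<Longrightarrow> {\<omega>. P \<omega>} \<in> sets S"
  by (simp add: Measurable.pred_def)

lemma emeasure_S_UNIV [simp]: "emeasure S UNIV = 1"
  using seq.P.emeasure_space_1 by simp

lemma fst_meas [measurable]: "fst \<in> borel_measurable \<mu>"
  and snd_meas [measurable]: "snd \<in> measurable \<mu> (count_space UNIV)"
  by (simp_all add: measurable_cong_sets[OF sets_\<mu> refl])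

lemma coord_meas [measurable]: "(\<lambda>\<omega>. \<omega> i) \<in> measurable S \<mu>"
  by (rule measurable_component_singleton) simp

lemma pos_meas [measurable]: "(\<lambda>\<omega>. pos \<omega> i) \<in> borel_measurable S"
  unfolding pos_def by measurable

lemma walk_meas:
  "(\<forall>i. (\<lambda>\<omega>. ienv \<omega> n i) \<in> measurable S (count_space UNIV)) \<and> (\<lambda>\<omega>. iwalk \<omega> n) \<in> measurable S (count_space UNIV)"
proof (induction n)
  case 0
  show ?case by simp
next
  case (Suc n)
  then have [measurable]: "\<And>i. (\<lambda>\<omega>. ienv \<omega> n i) \<in> measurable S (count_space UNIV)"
    "(\<lambda>\<omega>. iwalk \<omega> n) \<in> measurable S (count_space UNIV)" by auto
  have [measurable]: "(\<lambda>\<omega>. pos \<omega> (iwalk \<omega> n)) \<in> borel_measurable S"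
    by (rule measurable_compose_countable) measurable
  have "(\<lambda>\<omega>. ienv \<omega> (Suc n) i) \<in> measurable S (count_space UNIV)" for i
    unfolding ienv.simps by measurable
  moreover have "(\<lambda>\<omega>. iwalk \<omega> (Suc n)) \<in> measurable S (count_space UNIV)"
    unfolding iwalk_Suc nearest_def by measurable
  ultimately show ?case by blast
qed

lemma iwalk_meas [measurable]: "(\<lambda>\<omega>. iwalk \<omega> n) \<in> measurable S (count_space UNIV)"
  using walk_meas by blast

lemma shift_meas [measurable]: "shift k \<in> measurable S S"
proof -
  have "(\<lambda>\<omega> i. \<omega> (k + i)) \<in> measurable S S" by (rule measurable_abs_UNIV) measurable
  then show ?thesis by (simp add: shift_def[abs_def])
qed

lemma escapes_meas [measurable]: "Measurable.pred S escapes"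
  unfolding escapes_def[abs_def] returns_def by measurable

lemma good_meas [measurable]: "Measurable.pred S (\<lambda>\<omega>. good \<omega> i)"
  unfolding good_def by measurable

lemma sweeps_meas [measurable]: "Measurable.pred S (sweeps n)"
  unfolding sweeps_def[abs_def] first_return_def by measurable

lemma dense_meas [measurable]: "Measurable.pred S (dense n T)"
  unfolding dense_def[abs_def] by measurable

lemma barren_meas [measurable]: "barren K m \<in> borel_measurable S"
  unfolding barren_def[abs_def] by measurable

lemma no_ties_meas [measurable]: "Measurable.pred S no_ties"
  unfolding no_ties_def[abs_def] by measurable

lemma pos_gaps_meas [measurable]: "Measurable.pred S pos_gaps"
  unfolding pos_gaps_def[abs_def] by measurable

text \<open>\<open>comb_seq n \<omega> \<omega>'\<close> keeps the first n entries of \<omega> and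
  continues with \<omega>'; resampling the remainder in this way preserves the i.i.d. law.\<close>

lemma nn_integral_comb:
  assumes [measurable]: "f \<in> borel_measurable S"
  shows "(\<integral>\<^sup>+\<omega>. f \<omega> \<partial>S) = (\<integral>\<^sup>+\<omega>. \<integral>\<^sup>+\<omega>'. f (comb_seq n \<omega> \<omega>') \<partial>S \<partial>S)"
proof -
  have "(\<integral>\<^sup>+\<omega>. f \<omega> \<partial>S) = (\<integral>\<^sup>+\<omega>. f \<omega> \<partial>distr (S \<Otimes>\<^sub>M S) S (\<lambda>(\<omega>, \<omega>'). comb_seq n \<omega> \<omega>'))"
    by (simp only: seq.PiM_comb_seq)
  also have "\<dots> = (\<integral>\<^sup>+x. f (case x of (\<omega>, \<omega>') \<Rightarrow> comb_seq n \<omega> \<omega>') \<partial>(S \<Otimes>\<^sub>M S))"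
    by (intro nn_integral_distr) measurable
  also have "\<dots> = (\<integral>\<^sup>+\<omega>. \<integral>\<^sup>+\<omega>'. f (comb_seq n \<omega> \<omega>') \<partial>S \<partial>S)"
    by (subst seq.P.nn_integral_fst[symmetric]) (auto simp: split_beta')
  finally show ?thesis .
qed

lemma AE_comb:
  assumes "AE \<omega> in S. P \<omega>"
  shows "AE \<omega> in S. AE \<omega>' in S. P (comb_seq n \<omega> \<omega>')"
proof -
  have "AE x in S \<Otimes>\<^sub>M S. P (case x of (\<omega>, \<omega>') \<Rightarrow> comb_seq n \<omega> \<omega>')"
    using assms by (intro AE_distrD[OF measurable_comb_seq]) (simp only: seq.PiM_comb_seq)
  from SS.AE_pair[OF this] show ?thesis by simp
qed

lemma AE_comb_iff:
  assumes [measurable]: "Measurable.pred S P"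
  shows "(AE \<omega> in S. P \<omega>) \<longleftrightarrow> (AE \<omega> in S. AE \<omega>' in S. P (comb_seq n \<omega> \<omega>'))"
proof
  have P: "{\<omega>. P \<omega>} \<in> sets S" using assms by (simp add: Measurable.pred_def)
  assume *: "AE \<omega> in S. AE \<omega>' in S. P (comb_seq n \<omega> \<omega>')"
  have "AE x in S \<Otimes>\<^sub>M S. P (case x of (\<omega>, \<omega>') \<Rightarrow> comb_seq n \<omega> \<omega>')"
    using * by (intro SS.AE_pair_measure) (auto simp: split_beta')
  then have "AE \<omega> in distr (S \<Otimes>\<^sub>M S) S (\<lambda>(\<omega>, \<omega>'). comb_seq n \<omega> \<omega>'). P \<omega>"
    by (subst AE_distr_iff) (auto simp: split_beta' P)
  then show "AE \<omega> in S. P \<omega>" by (simp only: seq.PiM_comb_seq)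
qed (rule AE_comb)

lemma AE_Cons:
  assumes "AE \<omega> in S. P \<omega>"
  shows "AE x in \<mu>. AE \<omega> in S. P (case_nat x \<omega>)"
proof -
  have "AE y in \<mu> \<Otimes>\<^sub>M S. P (case y of (x, \<omega>) \<Rightarrow> case_nat x \<omega>)"
    by (rule AE_distrD[where M' = S]) (measurable, simp only: seq.PiM_iter assms)
  from LS.AE_pair[OF this] show ?thesis by simp
qed

lemma AE_Cons_iff:
  assumes [measurable]: "Measurable.pred S P"
  shows "(AE \<omega> in S. P \<omega>) \<longleftrightarrow> (AE x in \<mu>. AE \<omega> in S. P (case_nat x \<omega>))"
proof
  have P: "{\<omega>. P \<omega>} \<in> sets S" using assms by (simp add: Measurable.pred_def)
  assume *: "AE x in \<mu>. AE \<omega> in S. P (case_nat x \<omega>)"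
  have "AE y in \<mu> \<Otimes>\<^sub>M S. P (case y of (x, \<omega>) \<Rightarrow> case_nat x \<omega>)"
    using * by (intro LS.AE_pair_measure) (auto simp: split_beta')
  then have "AE \<omega> in distr (\<mu> \<Otimes>\<^sub>M S) S (\<lambda>(x, \<omega>). case_nat x \<omega>). P \<omega>"
    by (subst AE_distr_iff) (auto simp: split_beta' P)
  then show "AE \<omega> in S. P \<omega>" by (simp only: seq.PiM_iter)
qed (rule AE_Cons)

lemma shift_comb [simp]: "shift n (comb_seq n \<omega> \<omega>') = \<omega>'"
  by (auto simp: shift_def comb_seq_def)

lemma distr_shift: "distr S S (shift k) = S"
proof (rule measure_eqI)
  fix A assume "A \<in> sets (distr S S (shift k))"
  then have [measurable]: "A \<in> sets S" by simp
  have "emeasure (distr S S (shift k)) A = (\<integral>\<^sup>+\<omega>. indicator A \<omega> \<partial>distr S S (shift k))"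
    by simp
  also have "\<dots> = (\<integral>\<^sup>+\<omega>. indicator A (shift k \<omega>) \<partial>S)"
    by (rule nn_integral_distr) measurable
  also have "\<dots> = (\<integral>\<^sup>+\<omega>. \<integral>\<^sup>+\<omega>'. indicator A \<omega>' \<partial>S \<partial>S)"
    by (subst nn_integral_comb[of _ k]) auto
  also have "\<dots> = emeasure S A" by simp
  finally show "emeasure (distr S S (shift k)) A = emeasure S A" .
qed simp

lemma AE_shift:
  assumes "AE \<omega> in S. P \<omega>" shows "AE \<omega> in S. P (shift k \<omega>)"
  by (rule AE_distrD[OF shift_meas]) (simp only: distr_shift assms)

lemma integral_shift:
  fixes f :: "_ \<Rightarrow> real"
  assumes [measurable]: "f \<in> borel_measurable S"
  shows "(\<integral>\<omega>. f (shift k \<omega>) \<partial>S) = (\<integral>\<omega>. f \<omega> \<partial>S)"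
  by (subst (2) distr_shift[of k, symmetric], subst integral_distr) auto

lemma integrable_shift:
  fixes f :: "_ \<Rightarrow> real"
  assumes "integrable S f" shows "integrable S (\<lambda>\<omega>. f (shift k \<omega>))"
  by (rule integrable_distr[where M' = S]) (auto simp: distr_shift assms)

subsection \<open>The law of a single gap\<close>

lemma fst_exponential: "distributed \<mu> lborel fst (exponential_density 1)"
proof (rule exponential_distributedI)
  fix a :: real assume a: "0 \<le> a"
  have "{x \<in> space \<mu>. fst x \<le> a} = space \<mu> - {x \<in> space \<mu>. a < fst x}" by auto
  moreover have "{x \<in> space \<mu>. a < fst x} \<in> events" by measurable
  ultimately have "prob {x \<in> space \<mu>. fst x \<le> a} = 1 - exp (- a)"
    using tail[OF a] by (simp only: prob_compl)
  then show "emeasure \<mu> {x \<in> space \<mu>. fst x \<le> a} = 1 - ennreal (exp (- a * 1))"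
    by (simp add: emeasure_eq_measure ennreal_minus flip: ennreal_1)
qed auto

lemma AE_fst_neq: "AE x in \<mu>. fst x \<noteq> r"
proof -
  have "AE x in distr \<mu> lborel fst. x \<noteq> r"
    unfolding distributed_distr_eq_density[OF fst_exponential]
    using AE_lborel_singleton[of r] by (subst AE_density) auto
  then show ?thesis by (subst (asm) AE_distr_iff) auto
qed

lemma AE_fst_pos: "AE x in \<mu>. 0 < fst x"
  using tail[of 0] by (subst AE_iff_emeasure_eq_1) (auto simp: emeasure_eq_measure)

lemma fst_integrable: "integrable \<mu> fst"
proof -
  \<comment> \<open>A function that is not integrable has integral 0 by convention, so the mean 1
    yields integrability.\<close>
  have "expectation fst = 1" using exponential_distributed_expectation[OF _ fst_exponential] by simp
  then show ?thesis using not_integrable_integral_eq[of \<mu> fst] by auto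
qed

lemma AE_pos_gaps: "AE \<omega> in S. pos_gaps \<omega>"
  unfolding pos_gaps_def AE_all_countable
proof
  show "AE \<omega> in S. 0 < fst (\<omega> i)" for i
    by (rule AE_PiM_component) (auto intro: AE_fst_pos prob_space_axioms)
qed

text \<open>With the other gaps fixed, the sum varies with the first gap, whose law has no
  atoms.\<close>

lemma AE_pos_neq: "1 \<le> l \<Longrightarrow> AE \<omega> in S. pos \<omega> l \<noteq> r"
proof -
  assume "1 \<le> l"
  then obtain k where k: "l = Suc k" by (cases l) auto
  have "AE \<omega> in S. AE x in \<mu>. fst x + pos \<omega> k \<noteq> r"
  proof (rule AE_I2)
    show "AE x in \<mu>. fst x + pos \<omega> k \<noteq> r" for \<omega>
      using AE_fst_neq[of "r - pos \<omega> k"] by eventually_elim auto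
  qed
  then have "AE x in \<mu>. AE \<omega> in S. fst x + pos \<omega> k \<noteq> r"
    by (subst LS.AE_commute) auto
  then show ?thesis by (subst AE_Cons_iff) (auto simp: k pos_case_nat)
qed

text \<open>Cutting the sequence at b makes the two distances independent, and the right one has no
  atoms.\<close>

lemma AE_no_ties: "AE \<omega> in S. no_ties \<omega>"
  unfolding no_ties_def AE_all_countable
proof (intro allI)
  fix a b c :: nat
  show "AE \<omega> in S. a < b \<longrightarrow> b < c \<longrightarrow> pos \<omega> b - pos \<omega> a \<noteq> pos \<omega> c - pos \<omega> b"
  proof (cases "a < b \<and> b < c")
    case True
    have eq: "pos (comb_seq b \<omega> \<omega>') b - pos (comb_seq b \<omega> \<omega>') a \<noteq> pos (comb_seq b \<omega> \<omega>') c - pos (comb_seq b \<omega> \<omega>') b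
        \<longleftrightarrow> pos \<omega>' (c - b) \<noteq> pos \<omega> b - pos \<omega> a" for \<omega> \<omega>'
    proof -
      have "pos (comb_seq b \<omega> \<omega>') k = pos \<omega> k" if "k \<le> b" for k
        using pos_cong[of b "comb_seq b \<omega> \<omega>'" \<omega> k] that by (simp add: comb_seq_less)
      moreover have "pos \<omega>' (c - b) = pos (comb_seq b \<omega> \<omega>') c - pos (comb_seq b \<omega> \<omega>') b"
        using pos_shift[of b "comb_seq b \<omega> \<omega>'" "c - b"] True by simp
      ultimately show ?thesis using True by auto
    qed
    have "AE \<omega>' in S. pos \<omega>' (c - b) \<noteq> pos \<omega> b - pos \<omega> a" for \<omega>
      using True by (intro AE_pos_neq) auto
    then have "AE \<omega> in S. AE \<omega>' in S. pos (comb_seq b \<omega> \<omega>') b - pos (comb_seq b \<omega> \<omega>') a \<noteq>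
        pos (comb_seq b \<omega> \<omega>') c - pos (comb_seq b \<omega> \<omega>') b"
      unfolding eq by simp
    then have "AE \<omega> in S. pos \<omega> b - pos \<omega> a \<noteq> pos \<omega> c - pos \<omega> b"
      by (subst AE_comb_iff[of _ b]) auto
    then show ?thesis by eventually_elim auto
  qed auto
qed

lemma exists_of_AE:
  assumes "AE x in \<mu>. P x" and "0 < prob {x. Q x}" shows "\<exists>x. Q x \<and> P x"
proof (rule ccontr)
  assume no: "\<not> ?thesis"
  \<comment> \<open>Sets outside the \<sigma>-algebra have measure 0 by convention, so positive
    measure gives measurability.\<close>
  have meas: "{x. Q x} \<in> events" using assms(2) by (rule_tac ccontr) (simp add: measure_notin_sets)
  from assms(1) have "AE x in \<mu>. x \<notin> {x. Q x}" by eventually_elim (use no in auto)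
  then have "emeasure \<mu> {x. Q x} = 0" using meas by (subst (asm) AE_iff_null_sets[symmetric]) auto
  then show False using assms(2) by (simp add: measure_def)
qed

subsection \<open>Good points recur\<close>

lemma good_Cons: "good (case_nat x \<omega>) 1 \<longleftrightarrow> fst (\<omega> 0) < fst x \<and> escapes \<omega>"
proof -
  have "shift 1 (case_nat x \<omega>) = \<omega>" by (auto simp: shift_def fun_eq_iff)
  then show ?thesis by (simp add: good_def)
qed

text \<open>A gap longer than the first gap of an escaping sequence, put in front of it, makes index
  1 good. If goodness had probability 0, then for every n some prepended gap beyond n would exclude,
  almost surely, an escape with first gap below n.\<close>

lemma good_pos:
  assumes "\<not> (AE \<omega> in S. \<not> escapes \<omega>)" shows "0 < measure S {\<omega>. good \<omega> 1}"
proof (rule ccontr)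
  assume "\<not> ?thesis"
  then have "measure S {\<omega>. good \<omega> 1} = 0" by (simp add: not_less measure_le_0_iff)
  moreover have "{\<omega>. good \<omega> 1} \<in> sets S" by (rule sets_CollectI) measurable
  ultimately have "AE \<omega> in S. \<not> good \<omega> 1" using seq.P.prob_eq_0[of "{\<omega>. good \<omega> 1}"] by simp
  then have Cons: "AE x in \<mu>. AE \<omega> in S. \<not> good (case_nat x \<omega>) 1" by (rule AE_Cons)
  have "AE \<omega> in S. \<not> (fst (\<omega> 0) < real n \<and> escapes \<omega>)" for n :: nat
  proof -
    have "0 < prob {x. real n < fst x}" using tail[of "real n"] by simp
    from exists_of_AE[OF Cons this]
    obtain x where x: "real n < fst x" "AE \<omega> in S. \<not> good (case_nat x \<omega>) 1" by blast
    from x(2) show ?thesis by eventually_elim (use x(1) in \<open>auto simp: good_Cons[unfolded One_nat_def]\<close>)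
  qed
  then have "AE \<omega> in S. \<forall>n. \<not> (fst (\<omega> 0) < real n \<and> escapes \<omega>)" unfolding AE_all_countable by blast
  then have "AE \<omega> in S. \<not> escapes \<omega>" by eventually_elim (use reals_Archimedean2 in blast)
  with assms show False by simp
qed

text \<open>Kolmogorov's argument: by invariance the first n coordinates do not affect A, so A is
  independent of every cylinder set, hence of itself.\<close>

lemma zero_one:
  assumes A [measurable]: "A \<in> sets S" and inv: "\<And>k \<omega>. shift k \<omega> \<in> A \<longleftrightarrow> \<omega> \<in> A"
  shows "measure S A = 0 \<or> measure S A = 1"
proof -
  have "seq.P.indep_set {A} (prod_algebra UNIV (\<lambda>_. \<mu>))"
  proof (rule seq.P.indep_setI)
    show "prod_algebra UNIV (\<lambda>_. \<mu>) \<subseteq> sets S" by (auto simp: sets_PiM)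
    fix a B :: "(nat \<Rightarrow> real \<times> bool) set" assume "a \<in> {A}" and B: "B \<in> prod_algebra UNIV (\<lambda>_. \<mu>)"
    then have a: "a = A" by simp
    have [measurable]: "B \<in> sets S" using B by (auto simp: sets_PiM)
    obtain J E where J: "B = prod_emb UNIV (\<lambda>_. \<mu>) J (Pi\<^sub>E J E)" "finite J"
      using B by (elim prod_algebraE) blast
    then obtain n where n: "J \<subseteq> {..<n}" using finite_nat_iff_bounded by blast
    have B_iff: "\<omega> \<in> B \<longleftrightarrow> (\<forall>j\<in>J. \<omega> j \<in> E j)" for \<omega>
      unfolding J(1) by (auto simp: prod_emb_def PiE_iff)
    have "comb_seq n \<omega> \<omega>' \<in> B \<longleftrightarrow> \<omega> \<in> B" for \<omega> \<omega>'
      using n by (auto simp: B_iff comb_seq_def)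
    moreover have "comb_seq n \<omega> \<omega>' \<in> A \<longleftrightarrow> \<omega>' \<in> A" for \<omega> \<omega>'
      using inv[of n "comb_seq n \<omega> \<omega>'"] by simp
    ultimately have "indicator (A \<inter> B) (comb_seq n \<omega> \<omega>') = (indicator B \<omega> * indicator A \<omega>' :: ennreal)" for \<omega> \<omega>'
      by (auto simp: indicator_def)
    then have "emeasure S (A \<inter> B) = emeasure S A * emeasure S B"
      using nn_integral_comb[of "indicator (A \<inter> B)" n]
      by (simp add: nn_integral_cmult nn_integral_multc mult.commute)
    then show "measure S (a \<inter> B) = measure S a * measure S B"
      by (simp add: a measure_def enn2real_mult)
  qed auto
  then have "seq.P.indep_set (sigma_sets (space S) {A}) (sigma_sets (space S) (prod_algebra UNIV (\<lambda>_. \<mu>)))"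
    by (rule seq.P.indep_set_sigma_sets) (simp add: Int_stable_def, rule Int_stable_prod_algebra)
  moreover have "A \<in> sigma_sets (space S) (prod_algebra UNIV (\<lambda>_. \<mu>))"
    using A unfolding sets_PiM space_PiM .
  ultimately have "measure S (A \<inter> A) = measure S A * measure S A"
    using seq.P.indep_setD by blast
  then show ?thesis by auto
qed

text \<open>Having infinitely many good indices is a shift-invariant event, and by stationarity it
  is at least as likely as goodness of index 1; so it has probability 1.\<close>

lemma AE_good:
  assumes "0 < measure S {\<omega>. good \<omega> 1}" shows "AE \<omega> in S. \<exists>i\<ge>1. good \<omega> i"
proof -
  define F where "F n = {\<omega>. \<exists>i>n. good \<omega> i}" for n
  have F_sets [measurable]: "F n \<in> sets S" for n
    unfolding F_def by (rule sets_CollectI) measurable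
  have "measure S {\<omega>. good \<omega> 1} \<le> measure S (F n)" for n
  proof -
    have g [measurable]: "{\<omega>. good \<omega> 1} \<in> sets S"
    by (rule sets_CollectI) measurable
    have "measure S {\<omega>. good \<omega> 1} = measure (distr S S (shift n)) {\<omega>. good \<omega> 1}"
      by (simp only: distr_shift)
    also have "\<dots> = measure S (shift n -` {\<omega>. good \<omega> 1} \<inter> space S)"
      by (rule measure_distr) measurable
    also have "\<dots> \<le> measure S (F n)"
      by (intro seq.P.finite_measure_mono F_sets) (auto simp: F_def good_shift)
    finally show ?thesis .
  qed
  moreover have "(\<lambda>n. measure S (F n)) \<longlonglongrightarrow> measure S (\<Inter>n. F n)"
  proof (rule seq.P.finite_Lim_measure_decseq)
    show "decseq F" unfolding F_def antimono_def by (blast intro: le_less_trans)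
  qed (use F_sets in blast)
  ultimately have "measure S {\<omega>. good \<omega> 1} \<le> measure S (\<Inter>n. F n)"
    by (intro LIMSEQ_le_const) auto
  moreover have "measure S (\<Inter>n. F n) = 0 \<or> measure S (\<Inter>n. F n) = 1"
  proof (rule zero_one)
    fix k \<omega>
    have "(\<exists>i>n. good (shift k \<omega>) i) \<longleftrightarrow> (\<exists>i>n. good \<omega> (k + i))" for n
      by (metis good_shift less_one not_less0 not_le gr_implies_not0 le_less_linear)
    moreover have "(\<forall>n. \<exists>i>n. good \<omega> (k + i)) \<longleftrightarrow> (\<forall>n. \<exists>i>n. good \<omega> i)"
    proof safe
      fix n assume "\<forall>n. \<exists>i>n. good \<omega> (k + i)"
      then obtain i where "i > n" "good \<omega> (k + i)" by blast
      then show "\<exists>i>n. good \<omega> i" by (intro exI[of _ "k + i"]) auto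
    next
      fix n assume "\<forall>n. \<exists>i>n. good \<omega> i"
      then obtain i where "i > k + n" "good \<omega> i" by blast
      then show "\<exists>i>n. good \<omega> (k + i)" by (intro exI[of _ "i - k"]) auto
    qed
    ultimately show "shift k \<omega> \<in> (\<Inter>n. F n) \<longleftrightarrow> \<omega> \<in> (\<Inter>n. F n)" by (auto simp: F_def)
  qed auto
  ultimately have "measure S (\<Inter>n. F n) = 1" using assms by auto
  then have "AE \<omega> in S. \<omega> \<in> (\<Inter>n. F n)" by (subst (asm) seq.P.prob_eq_1) auto
  then show ?thesis
  proof eventually_elim
    fix \<omega> assume "\<omega> \<in> (\<Inter>n. F n)"
    then have "\<omega> \<in> F 0" by blast
    then show "\<exists>i\<ge>1. good \<omega> i" by (auto simp: F_def Suc_le_eq)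
  qed
qed

lemma gap_integrable: "integrable S (\<lambda>\<omega>. fst (\<omega> i))"
  and integral_gap: "\<And>f :: _ \<Rightarrow> real. f \<in> borel_measurable \<mu> \<Longrightarrow> (\<integral>\<omega>. f (\<omega> i) \<partial>S) = (\<integral>x. f x \<partial>\<mu>)"
proof -
  have d: "distr S \<mu> (\<lambda>\<omega>. \<omega> i) = \<mu>" by (rule seq.PiM_component) simp
  show "integrable S (\<lambda>\<omega>. fst (\<omega> i))"
    using integrable_distr[OF coord_meas[of i], of fst] fst_integrable by (simp add: d)
  show "(\<integral>\<omega>. f (\<omega> i) \<partial>S) = (\<integral>x. f x \<partial>\<mu>)" if "f \<in> borel_measurable \<mu>" for f :: "_ \<Rightarrow> real"
    using integral_distr[OF coord_meas[of i] that] by (simp add: d)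
qed

lemma barren_parts_integrable:
  "integrable S (\<lambda>\<omega>. fst (\<omega> 0) * of_bool (K < fst (\<omega> 0)))"
  "integrable S (\<lambda>\<omega>. K * of_bool (\<forall>j. 1 \<le> j \<longrightarrow> j \<le> m \<longrightarrow> \<not> good \<omega> j))"
proof -
  show "integrable S (\<lambda>\<omega>. fst (\<omega> 0) * of_bool (K < fst (\<omega> 0)))"
    by (rule Bochner_Integration.integrable_bound[OF gap_integrable[of 0]]) auto
  show "integrable S (\<lambda>\<omega>. K * of_bool (\<forall>j. 1 \<le> j \<longrightarrow> j \<le> m \<longrightarrow> \<not> good \<omega> j))"
    by (rule seq.P.integrable_const_bound[where B = "\<bar>K\<bar>"]) auto
qed

lemma barren_integrable: "integrable S (barren K m)"
  unfolding barren_def[abs_def] by (rule Bochner_Integration.integrable_add[OF barren_parts_integrable])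

text \<open>K has to be fixed before m, because the second summand carries the factor K: dominated
  convergence makes the first summand small for large K, and then the second one small for large m.
  The bound \<open>K0\<close> is there to secure \<delta> \<le> K in the application.\<close>

lemma barren_small:
  assumes "AE \<omega> in S. \<exists>i\<ge>1. good \<omega> i" "0 < \<epsilon>"
  obtains K m where "K0 \<le> K" "0 \<le> K" "(\<integral>\<omega>. barren K m \<omega> \<partial>S) < \<epsilon>"
proof -
  have "(\<lambda>n. \<integral>\<omega>. fst (\<omega> 0) * of_bool (real n < fst (\<omega> 0)) \<partial>S) \<longlonglongrightarrow> (\<integral>\<omega>. 0 \<partial>S)"
  proof (rule integral_dominated_convergence)
    show "integrable S (\<lambda>\<omega>. \<bar>fst (\<omega> 0)\<bar>)" using gap_integrable by (rule integrable_abs)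
    show "AE \<omega> in S. (\<lambda>n. fst (\<omega> 0) * of_bool (real n < fst (\<omega> 0))) \<longlonglongrightarrow> 0"
    proof (rule AE_I2)
      fix \<omega> :: "nat \<Rightarrow> real \<times> bool"
      obtain k :: nat where "fst (\<omega> 0) < real k" using reals_Archimedean2 by blast
      then have "\<forall>\<^sub>F n in sequentially. fst (\<omega> 0) * of_bool (real n < fst (\<omega> 0)) = 0"
        by (intro eventually_sequentiallyI[of k]) auto
      then show "(\<lambda>n. fst (\<omega> 0) * of_bool (real n < fst (\<omega> 0))) \<longlonglongrightarrow> 0" by (rule tendsto_eventually)
    qed
  qed auto
  then have "\<forall>\<^sub>F n in sequentially. (\<integral>\<omega>. fst (\<omega> 0) * of_bool (real n < fst (\<omega> 0)) \<partial>S) < \<epsilon> / 2"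
    using assms(2) by (intro order_tendstoD(2)) auto
  then obtain n0 where n0: "\<And>n. n0 \<le> n \<Longrightarrow> (\<integral>\<omega>. fst (\<omega> 0) * of_bool (real n < fst (\<omega> 0)) \<partial>S) < \<epsilon> / 2"
    by (auto simp: eventually_sequentially)
  define K where "K = real (max n0 (nat \<lceil>K0\<rceil>))"
  have K: "K0 \<le> K" "0 \<le> K" unfolding K_def by linarith+
  have tail_K: "(\<integral>\<omega>. fst (\<omega> 0) * of_bool (K < fst (\<omega> 0)) \<partial>S) < \<epsilon> / 2"
    unfolding K_def by (rule n0) simp
  have "(\<lambda>m. \<integral>\<omega>. K * of_bool (\<forall>j. 1 \<le> j \<longrightarrow> j \<le> m \<longrightarrow> \<not> good \<omega> j) \<partial>S) \<longlonglongrightarrow> (\<integral>\<omega>. 0 \<partial>S)"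
  proof (rule integral_dominated_convergence)
    show "integrable S (\<lambda>\<omega>. K)" by simp
    show "AE \<omega> in S. (\<lambda>m. K * of_bool (\<forall>j. 1 \<le> j \<longrightarrow> j \<le> m \<longrightarrow> \<not> good \<omega> j)) \<longlonglongrightarrow> 0"
      using assms(1)
    proof eventually_elim
      fix \<omega> assume "\<exists>i\<ge>1. good \<omega> i"
      then obtain i where "1 \<le> i" "good \<omega> i" by blast
      then have "\<forall>\<^sub>F m in sequentially. K * of_bool (\<forall>j. 1 \<le> j \<longrightarrow> j \<le> m \<longrightarrow> \<not> good \<omega> j) = 0"
        by (intro eventually_sequentiallyI[of i]) auto
      then show "(\<lambda>m. K * of_bool (\<forall>j. 1 \<le> j \<longrightarrow> j \<le> m \<longrightarrow> \<not> good \<omega> j)) \<longlonglongrightarrow> 0"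
        by (rule tendsto_eventually)
    qed
  qed (use K in auto)
  then have "\<forall>\<^sub>F m in sequentially. (\<integral>\<omega>. K * of_bool (\<forall>j. 1 \<le> j \<longrightarrow> j \<le> m \<longrightarrow> \<not> good \<omega> j) \<partial>S) < \<epsilon> / 2"
    using assms(2) by (intro order_tendstoD(2)) auto
  then obtain m where m: "(\<integral>\<omega>. K * of_bool (\<forall>j. 1 \<le> j \<longrightarrow> j \<le> m \<longrightarrow> \<not> good \<omega> j) \<partial>S) < \<epsilon> / 2"
    by (auto simp: eventually_sequentially)
  have "(\<integral>\<omega>. barren K m \<omega> \<partial>S) = (\<integral>\<omega>. fst (\<omega> 0) * of_bool (K < fst (\<omega> 0)) \<partial>S) +
      (\<integral>\<omega>. K * of_bool (\<forall>j. 1 \<le> j \<longrightarrow> j \<le> m \<longrightarrow> \<not> good \<omega> j) \<partial>S)"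
    unfolding barren_def by (rule Bochner_Integration.integral_add[OF barren_parts_integrable])
  with tail_K m have "(\<integral>\<omega>. barren K m \<omega> \<partial>S) < \<epsilon>" by simp
  with K that show thesis by blast
qed

subsection \<open>The walk on the half-line returns\<close>

lemma prob_small_gap: "0 \<le> \<delta> \<Longrightarrow> (\<integral>\<omega>. of_bool (fst (\<omega> i) < \<delta>) \<partial>S) \<le> \<delta>"
proof -
  assume \<delta>: "0 \<le> \<delta>"
  have ev: "{x \<in> space \<mu>. \<delta> < fst x} \<in> events" by measurable
  have "(\<integral>\<omega>. of_bool (fst (\<omega> i) < \<delta>) \<partial>S) = (\<integral>x. of_bool (fst x < \<delta>) \<partial>\<mu> :: real)"
  proof -
    have "(\<lambda>x. of_bool (fst x < \<delta>) :: real) \<in> borel_measurable \<mu>" by measurable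
    from integral_gap[OF this, of i] show ?thesis by simp
  qed
  also have "\<dots> = (\<integral>x. indicator {x \<in> space \<mu>. fst x < \<delta>} x \<partial>\<mu>)"
    by (intro Bochner_Integration.integral_cong) (auto simp: indicator_def)
  also have "\<dots> = prob {x \<in> space \<mu>. fst x < \<delta>}" by simp
  also have "\<dots> \<le> prob (space \<mu> - {x \<in> space \<mu>. \<delta> < fst x})"
    using sets.compl_sets[OF ev] by (intro finite_measure_mono) auto
  also have "\<dots> = 1 - exp (- \<delta>)" using tail[OF \<delta>] ev by (simp only: prob_compl)
  also have "\<dots> \<le> \<delta>" using exp_ge_add_one_self[of "- \<delta>"] by simp
  finally show ?thesis .
qed

text \<open>\<open>maximal_count\<close> at the levels 1/2 and \<delta>/4 gives the factors 2 and
  4/\<delta>. By stationarity the N terms have equal means, and a gap is below \<delta> with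
  probability at most \<delta>.\<close>

lemma sum_not_dense:
  assumes \<delta>: "0 < \<delta>" "\<delta> \<le> 4 * K"
  shows "(\<Sum>n<N. measure S {\<omega>. \<not> dense n (2 * K * m + K) \<omega>}) \<le>
    real N * (2 * \<delta> + 4 / \<delta> * (\<integral>\<omega>. barren K m \<omega> \<partial>S))"
proof -
  define T where "T = 2 * K * m + K"
  have K: "0 \<le> K" using \<delta> by simp
  have [measurable]: "{\<omega>. \<not> dense n T \<omega>} \<in> sets S" for n
    by (rule sets_CollectI) measurable
  have int_w: "integrable S (\<lambda>\<omega>. of_bool (fst (\<omega> i) < \<delta>) :: real)" for i
    by (rule seq.P.integrable_const_bound[where B = 1]) auto
  have int_b: "integrable S (\<lambda>\<omega>. barren K m (shift i \<omega>))" for i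
    by (intro integrable_shift barren_integrable)
  have "(\<Sum>n<N. measure S {\<omega>. \<not> dense n T \<omega>}) = (\<integral>\<omega>. (\<Sum>n<N. indicator {\<omega>. \<not> dense n T \<omega>} \<omega>) \<partial>S)"
    by (subst Bochner_Integration.integral_sum) (auto simp: less_top[symmetric])
  also have "\<dots> \<le> (\<integral>\<omega>. 2 * (\<Sum>i<N. of_bool (fst (\<omega> i) < \<delta>)) + 4 / \<delta> * (\<Sum>i<N. barren K m (shift i \<omega>)) \<partial>S)"
  proof (rule integral_mono_AE)
    show "AE \<omega> in S. (\<Sum>n<N. indicator {\<omega>. \<not> dense n T \<omega>} \<omega>) \<le>
        2 * (\<Sum>i<N. of_bool (fst (\<omega> i) < \<delta>)) + 4 / \<delta> * (\<Sum>i<N. barren K m (shift i \<omega>))"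
      using AE_pos_gaps
    proof eventually_elim
      fix \<omega> assume gaps: "pos_gaps \<omega>"
      define B1 where "B1 = {n. n < N \<and> (\<exists>a\<le>n. 1/2 * (real n + 1 - real a) \<le> (\<Sum>i=a..n. of_bool (fst (\<omega> i) < \<delta>)))}"
      define B2 where "B2 = {n. n < N \<and> (\<exists>a\<le>n. \<delta>/4 * (real n + 1 - real a) \<le> (\<Sum>i=a..n. barren K m (shift i \<omega>)))}"
      have fin: "finite B1" "finite B2" by (auto simp: B1_def B2_def)
      have c1: "1/2 * card B1 \<le> (\<Sum>i<N. of_bool (fst (\<omega> i) < \<delta>))"
        unfolding B1_def by (rule maximal_count) auto
      have c2: "\<delta>/4 * card B2 \<le> (\<Sum>i<N. barren K m (shift i \<omega>))"
        unfolding B2_def using \<delta>(1) by (intro maximal_count barren_nonneg[OF gaps K]) auto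
      have "(\<Sum>n<N. indicator {\<omega>. \<not> dense n T \<omega>} \<omega>) = real (card {n \<in> {..<N}. \<not> dense n T \<omega>})"
        by (simp add: indicator_def sum.If_cases Int_def)
      also have "\<dots> \<le> real (card (B1 \<union> B2))"
        using not_dense_cases[OF gaps \<delta>] fin
        by (intro of_nat_mono card_mono) (auto simp: B1_def B2_def T_def)
      also have "\<dots> \<le> real (card B1) + real (card B2)"
        using card_Un_le[of B1 B2] by linarith
      also have "real (card B2) \<le> 4 / \<delta> * (\<Sum>i<N. barren K m (shift i \<omega>))"
        using c2 \<delta>(1) by (simp add: field_simps)
      finally show "(\<Sum>n<N. indicator {\<omega>. \<not> dense n T \<omega>} \<omega>) \<le>
        2 * (\<Sum>i<N. of_bool (fst (\<omega> i) < \<delta>)) + 4 / \<delta> * (\<Sum>i<N. barren K m (shift i \<omega>))"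
        using c1 by linarith
    qed
    show "integrable S (\<lambda>\<omega>. \<Sum>n<N. indicator {\<omega>. \<not> dense n T \<omega>} \<omega> :: real)"
      by (intro Bochner_Integration.integrable_sum) (auto simp: less_top[symmetric])
    show "integrable S (\<lambda>\<omega>. 2 * (\<Sum>i<N. of_bool (fst (\<omega> i) < \<delta>)) + 4 / \<delta> * (\<Sum>i<N. barren K m (shift i \<omega>)))"
      by (intro Bochner_Integration.integrable_add integrable_mult_right Bochner_Integration.integrable_sum int_w int_b)
  qed
  also have "\<dots> = 2 * (\<Sum>i<N. \<integral>\<omega>. of_bool (fst (\<omega> i) < \<delta>) \<partial>S) + 4 / \<delta> * (\<Sum>i<N. \<integral>\<omega>. barren K m \<omega> \<partial>S)"
    by (subst Bochner_Integration.integral_add)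
      (intro integrable_mult_right Bochner_Integration.integrable_sum int_w int_b,
       intro integrable_mult_right Bochner_Integration.integrable_sum int_w int_b,
       simp only: integral_mult_right_zero Bochner_Integration.integral_sum[OF int_w]
         Bochner_Integration.integral_sum[OF int_b] integral_shift[OF barren_meas])
  also have "\<dots> \<le> 2 * (\<Sum>i<N. \<delta>) + 4 / \<delta> * (\<Sum>i<N. \<integral>\<omega>. barren K m \<omega> \<partial>S)"
    using \<delta>(1) by (intro add_mono mult_left_mono sum_mono prob_small_gap order_refl) auto
  also have "\<dots> = real N * (2 * \<delta> + 4 / \<delta> * (\<integral>\<omega>. barren K m \<omega> \<partial>S))"
    by (simp add: algebra_simps)
  finally show ?thesis by (simp add: T_def)
qed

text \<open>The first factor concerns \<omega> alone, the second an independent copy \<omega>' whose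
  entry 0 becomes entry n of \<open>comb_seq n \<omega> \<omega>'\<close>. The combined sequence has
  law \<open>S\<close> again and sweeps whenever both events occur.\<close>

lemma sweep_prob:
  assumes n: "1 \<le> n"
  shows "measure S {\<omega>. escapes \<omega> \<and> dense n T \<omega>} * measure S {\<omega>. T < fst (\<omega> 0) \<and> \<not> snd (\<omega> 0)} \<le>
    measure S {\<omega>. sweeps n \<omega>}"
proof -
  define D where "D = {\<omega>. escapes \<omega> \<and> dense n T \<omega>}"
  define B where "B = {\<omega> :: nat \<Rightarrow> real \<times> bool. T < fst (\<omega> 0) \<and> \<not> snd (\<omega> 0)}"
  define W where "W = {\<omega>. sweeps n \<omega>}"
  have [measurable]: "D \<in> sets S" "B \<in> sets S" "W \<in> sets S"
    unfolding D_def B_def W_def by (rule sets_CollectI, measurable)+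
  have "emeasure S D * emeasure S B = (\<integral>\<^sup>+\<omega>. \<integral>\<^sup>+\<omega>'. indicator D \<omega> * indicator B \<omega>' \<partial>S \<partial>S)"
    by (simp add: nn_integral_cmult nn_integral_multc)
  also have "\<dots> \<le> (\<integral>\<^sup>+\<omega>. \<integral>\<^sup>+\<omega>'. indicator W (comb_seq n \<omega> \<omega>') \<partial>S \<partial>S)"
  proof (rule nn_integral_mono_AE)
    show "AE \<omega> in S. (\<integral>\<^sup>+\<omega>'. indicator D \<omega> * indicator B \<omega>' \<partial>S) \<le> (\<integral>\<^sup>+\<omega>'. indicator W (comb_seq n \<omega> \<omega>') \<partial>S)"
      using AE_pos_gaps AE_no_ties
    proof eventually_elim
      fix \<omega> assume \<omega>: "pos_gaps \<omega>" "no_ties \<omega>"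
      show "(\<integral>\<^sup>+\<omega>'. indicator D \<omega> * indicator B \<omega>' \<partial>S) \<le> (\<integral>\<^sup>+\<omega>'. indicator W (comb_seq n \<omega> \<omega>') \<partial>S)"
      proof (rule nn_integral_mono_AE)
        show "AE \<omega>' in S. indicator D \<omega> * indicator B \<omega>' \<le> (indicator W (comb_seq n \<omega> \<omega>') :: ennreal)"
          using AE_pos_gaps
        proof eventually_elim
          fix \<omega>' assume \<omega>': "pos_gaps \<omega>'"
          have "pos_gaps (comb_seq n \<omega> \<omega>')" using \<omega>(1) \<omega>' by (auto simp: pos_gaps_def comb_seq_def)
          then have "sweeps n (comb_seq n \<omega> \<omega>')" if "\<omega> \<in> D" "\<omega>' \<in> B"
            using that n \<omega> by (intro escape_sweeps[of \<omega> _ n T]) (auto simp: D_def B_def comb_seq_def)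
          then show "indicator D \<omega> * indicator B \<omega>' \<le> (indicator W (comb_seq n \<omega> \<omega>') :: ennreal)"
            by (auto simp: indicator_def W_def)
        qed
      qed
    qed
  qed
  also have "\<dots> = emeasure S W" using nn_integral_comb[of "indicator W" n] by simp
  finally have "ennreal (measure S D * measure S B) \<le> ennreal (measure S W)"
    by (simp add: seq.P.emeasure_eq_measure ennreal_mult'')
  then show ?thesis by (simp add: D_def B_def W_def)
qed

lemma big_single_pos: "0 \<le> T \<Longrightarrow> 0 < measure S {\<omega>. T < fst (\<omega> 0) \<and> \<not> snd (\<omega> 0)}"
proof (rule ccontr)
  assume T: "0 \<le> T" and "\<not> 0 < measure S {\<omega>. T < fst (\<omega> 0) \<and> \<not> snd (\<omega> 0)}"
  then have "measure S {\<omega>. T < fst (\<omega> 0) \<and> \<not> snd (\<omega> 0)} = 0" by (simp add: not_less measure_le_0_iff)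
  moreover have "{\<omega> \<in> space S. T < fst (\<omega> 0) \<and> \<not> snd (\<omega> 0)} \<in> sets S" by measurable
  ultimately have "AE \<omega> in S. \<not> (T < fst (\<omega> 0) \<and> \<not> snd (\<omega> 0))"
    using seq.P.prob_eq_0[of "{\<omega>. T < fst (\<omega> 0) \<and> \<not> snd (\<omega> 0)}"] by simp
  from AE_Cons[OF this] have "AE x in \<mu>. \<not> (T < fst x \<and> \<not> snd x)" by simp
  moreover have "0 < prob {x. T < fst x \<and> \<not> snd x}"
  proof -
    have "{x \<in> space \<mu>. T < fst x \<and> snd x} \<in> events" "{x \<in> space \<mu>. T < fst x} \<in> events" by measurable
    then have "prob ({x. T < fst x} - {x. T < fst x \<and> snd x}) = exp (- T) - p * exp (- T)"
      using tail[OF T] tail_mark[OF T] by (subst finite_measure_Diff) auto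
    also have "{x. T < fst x} - {x. T < fst x \<and> snd x} = {x. T < fst x \<and> \<not> snd x}" by auto
    finally have "prob {x. T < fst x \<and> \<not> snd x} = (1 - p) * exp (- T)" by (simp add: algebra_simps)
    then show ?thesis using p_less by simp
  qed
  ultimately show False using exists_of_AE by blast
qed

theorem AE_not_escapes: "AE \<omega> in S. \<not> escapes \<omega>"
proof (rule ccontr)
  assume contr: "\<not> ?thesis"
  define q where "q = measure S {\<omega>. escapes \<omega>}"
  have esc: "{\<omega>. escapes \<omega>} \<in> sets S"
    by (rule sets_CollectI) measurable
  have q: "0 < q"
  proof (rule ccontr)
    assume "\<not> 0 < q"
    then have "q = 0" by (simp add: q_def not_less measure_le_0_iff)
    then have "AE \<omega> in S. \<not> escapes \<omega>" using seq.P.prob_eq_0[OF esc] by (simp add: q_def)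
    with contr show False by simp
  qed
  \<comment> \<open>The constants make density fail at a rate of at most q/2: 2 \<delta> is q/4, and
    the bound \<delta> q / 16 on the mean of \<open>barren\<close>, multiplied by 4/\<delta>, gives
    the other q/4.\<close>
  define \<delta> where "\<delta> = q / 8"
  have \<delta>: "0 < \<delta>" using q by (simp add: \<delta>_def)
  have "0 < \<delta> * q / 16" using \<delta> q by simp
  then obtain K m where K: "\<delta> \<le> K" "0 \<le> K" "(\<integral>\<omega>. barren K m \<omega> \<partial>S) < \<delta> * q / 16"
    using barren_small[OF AE_good[OF good_pos[OF contr]]] by blast
  define T where "T = 2 * K * m + K"
  have T: "0 \<le> T" using K by (simp add: T_def)
  define \<beta> where "\<beta> = measure S {\<omega>. T < fst (\<omega> 0) \<and> \<not> snd (\<omega> 0)}"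
  have \<beta>: "0 < \<beta>" unfolding \<beta>_def by (rule big_single_pos[OF T])
  have dense_sets: "{\<omega>. \<not> dense n T \<omega>} \<in> sets S" "{\<omega>. escapes \<omega> \<and> dense n T \<omega>} \<in> sets S" "{\<omega>. sweeps n \<omega>} \<in> sets S" for n
    by (rule sets_CollectI, measurable)+
  \<comment> \<open>The left side grows linearly in N, while disjointness of the sweeping events
    keeps it below 1. The term - q pays for the index 0, which \<open>sweep_prob\<close>
    excludes.\<close>
  have bound: "\<beta> * (real N * (q / 2) - q) \<le> 1" for N
  proof -
    have "4 / \<delta> * (\<integral>\<omega>. barren K m \<omega> \<partial>S) \<le> 4 / \<delta> * (\<delta> * q / 16)"
      using K(3) \<delta> by (intro mult_left_mono) auto
    also have "\<dots> = q / 4" using \<delta> by simp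
    finally have "real N * (2 * \<delta> + 4 / \<delta> * (\<integral>\<omega>. barren K m \<omega> \<partial>S)) \<le> real N * (q / 2)"
      by (intro mult_left_mono) (auto simp: \<delta>_def)
    moreover have "(\<Sum>n<N. measure S {\<omega>. \<not> dense n T \<omega>}) \<le> real N * (2 * \<delta> + 4 / \<delta> * (\<integral>\<omega>. barren K m \<omega> \<partial>S))"
      unfolding T_def using \<delta> K by (intro sum_not_dense) auto
    ultimately have not_dense: "(\<Sum>n<N. measure S {\<omega>. \<not> dense n T \<omega>}) \<le> real N * (q / 2)" by (rule order_trans[rotated])
    have "q \<le> measure S {\<omega>. escapes \<omega> \<and> dense n T \<omega>} + measure S {\<omega>. \<not> dense n T \<omega>}" for n
    proof -
      have "q \<le> measure S ({\<omega>. escapes \<omega> \<and> dense n T \<omega>} \<union> {\<omega>. \<not> dense n T \<omega>})"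
        unfolding q_def using dense_sets by (intro seq.P.finite_measure_mono) auto
      also have "\<dots> \<le> measure S {\<omega>. escapes \<omega> \<and> dense n T \<omega>} + measure S {\<omega>. \<not> dense n T \<omega>}"
        using dense_sets by (intro measure_Un_le) auto
      finally show ?thesis .
    qed
    then have "(\<Sum>n\<in>{1..<N}. q) \<le> (\<Sum>n\<in>{1..<N}. measure S {\<omega>. escapes \<omega> \<and> dense n T \<omega>} + measure S {\<omega>. \<not> dense n T \<omega>})"
      by (rule sum_mono)
    also have "\<dots> = (\<Sum>n\<in>{1..<N}. measure S {\<omega>. escapes \<omega> \<and> dense n T \<omega>}) + (\<Sum>n\<in>{1..<N}. measure S {\<omega>. \<not> dense n T \<omega>})"
      by (rule sum.distrib)
    also have "(\<Sum>n\<in>{1..<N}. measure S {\<omega>. \<not> dense n T \<omega>}) \<le> (\<Sum>n<N. measure S {\<omega>. \<not> dense n T \<omega>})"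
      by (rule sum_mono2) auto
    finally have "(\<Sum>n\<in>{1..<N}. q) \<le> (\<Sum>n\<in>{1..<N}. measure S {\<omega>. escapes \<omega> \<and> dense n T \<omega>}) + real N * (q / 2)"
      using not_dense by simp
    moreover have "real N * q - q \<le> (\<Sum>n\<in>{1..<N}. q)" using q by (cases N) (auto simp: algebra_simps)
    ultimately have "real N * (q / 2) - q \<le> (\<Sum>n\<in>{1..<N}. measure S {\<omega>. escapes \<omega> \<and> dense n T \<omega>})"
      by (simp add: field_simps)
    then have "\<beta> * (real N * (q / 2) - q) \<le> \<beta> * (\<Sum>n\<in>{1..<N}. measure S {\<omega>. escapes \<omega> \<and> dense n T \<omega>})"
      using \<beta> by (intro mult_left_mono) auto
    also have "\<dots> = (\<Sum>n\<in>{1..<N}. measure S {\<omega>. escapes \<omega> \<and> dense n T \<omega>} * \<beta>)"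
      by (simp add: sum_distrib_left mult.commute)
    also have "\<dots> \<le> (\<Sum>n\<in>{1..<N}. measure S {\<omega>. sweeps n \<omega>})"
      unfolding \<beta>_def by (intro sum_mono sweep_prob) auto
    also have "\<dots> = measure S (\<Union>n\<in>{1..<N}. {\<omega>. sweeps n \<omega>})"
      using dense_sets by (intro seq.P.finite_measure_finite_Union[symmetric])
        (auto simp: disjoint_family_on_def dest: sweeps_unique)
    also have "\<dots> \<le> 1" by (rule seq.P.prob_le_1)
    finally show ?thesis .
  qed
  obtain N :: nat where N: "(1 / \<beta> + q) / (q / 2) < real N" using reals_Archimedean2 by blast
  then have "1 / \<beta> < real N * (q / 2) - q" using q by (simp add: field_simps)
  then have "1 < \<beta> * (real N * (q / 2) - q)" using \<beta> by (simp add: field_simps)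
  with bound[of N] show False by simp
qed

text \<open>The entry x in front is integrated out: for almost every x, almost every continuation
  returns unless x has a single mark. Doubly marked x with gap beyond k have positive probability as
  p > 0, so one such x, chosen in advance, serves almost all \<omega>.\<close>

theorem AE_barrier_hit:
  "AE \<omega> in S. \<forall>i. \<forall>K. \<exists>d>K. returns (case_nat (d, True) (shift i \<omega>)) \<and> no_ties (case_nat (d, True) (shift i \<omega>))"
proof -
  have "AE \<omega> in S. \<not> escapes \<omega> \<and> no_ties \<omega>" using AE_not_escapes AE_no_ties by eventually_elim simp
  from AE_Cons[OF this]
  have Cons: "AE x in \<mu>. AE \<omega> in S. \<not> escapes (case_nat x \<omega>) \<and> no_ties (case_nat x \<omega>)" .
  have "AE \<omega> in S. \<forall>k::nat. \<exists>d>real k. returns (case_nat (d, True) \<omega>) \<and> no_ties (case_nat (d, True) \<omega>)"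
    unfolding AE_all_countable
  proof
    fix k :: nat
    have "0 < prob {x. real k < fst x \<and> snd x}" using tail_mark[of "real k"] p_pos by simp
    from exists_of_AE[OF Cons this] obtain x where x: "real k < fst x" "snd x"
      "AE \<omega> in S. \<not> escapes (case_nat x \<omega>) \<and> no_ties (case_nat x \<omega>)" by blast
    then obtain d where d: "x = (d, True)" "real k < d" by (cases x) auto
    from x(3) show "AE \<omega> in S. \<exists>d>real k. returns (case_nat (d, True) \<omega>) \<and> no_ties (case_nat (d, True) \<omega>)"
      by eventually_elim (use d in \<open>auto simp: escapes_def\<close>)
  qed
  from AE_shift[OF this]
  have "AE \<omega> in S. \<forall>i. \<forall>k::nat. \<exists>d>real k. returns (case_nat (d, True) (shift i \<omega>)) \<and> no_ties (case_nat (d, True) (shift i \<omega>))"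
    by (subst AE_all_countable) blast
  then show ?thesis
  proof eventually_elim
    fix \<omega> assume *: "\<forall>i. \<forall>k::nat. \<exists>d>real k. returns (case_nat (d, True) (shift i \<omega>)) \<and> no_ties (case_nat (d, True) (shift i \<omega>))"
    show "\<forall>i. \<forall>K. \<exists>d>K. returns (case_nat (d, True) (shift i \<omega>)) \<and> no_ties (case_nat (d, True) (shift i \<omega>))"
    proof (intro allI)
      fix i K
      obtain k :: nat where "K < real k" using reals_Archimedean2 by blast
      with * show "\<exists>d>K. returns (case_nat (d, True) (shift i \<omega>)) \<and> no_ties (case_nat (d, True) (shift i \<omega>))"
        by (meson less_trans)
    qed
  qed
qed

end

section \<open>Enumerating the positive points of a configuration\<close>

definition npos :: "real set \<Rightarrow> real \<Rightarrow> nat" where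
  "npos C t = card (C \<inter> {0<..t})"

text \<open>The value \<open>1\<close> for configurations with at most \<open>k\<close> positive points keeps \<open>nth_pos\<close> positive.\<close>

definition nth_pos :: "nat \<Rightarrow> real set \<Rightarrow> real" where
  "nth_pos k C = (if \<exists>n::nat. k < npos C (real n) then Inf {t. k < npos C t} else 1)"

definition unbounded_pos :: "real set \<Rightarrow> bool" where
  "unbounded_pos C \<longleftrightarrow> (\<forall>k. \<exists>n::nat. k < npos C (real n))"

context
  fixes C assumes C: "locally_finite C"
begin

lemma finite_pos: "finite (C \<inter> {0<..t})"
  using C by (auto simp: locally_finite_def)

lemma npos_mono: "s \<le> t \<Longrightarrow> npos C s \<le> npos C t"
  unfolding npos_def by (intro card_mono finite_pos) auto

lemma npos_Max:
  assumes "C \<inter> {0<..t} \<noteq> {}"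
  shows "npos C (Max (C \<inter> {0<..t})) = npos C t" "Max (C \<inter> {0<..t}) \<in> C" "0 < Max (C \<inter> {0<..t})"
    "Max (C \<inter> {0<..t}) \<le> t"
proof -
  let ?m = "Max (C \<inter> {0<..t})"
  have "?m \<in> C \<inter> {0<..t}" using finite_pos assms by (rule Max_in)
  then show m: "?m \<in> C" "0 < ?m" "?m \<le> t" by auto
  have "C \<inter> {0<..?m} = C \<inter> {0<..t}"
  proof
    show "C \<inter> {0<..t} \<subseteq> C \<inter> {0<..?m}" using Max_ge[OF finite_pos] by auto
  qed (use m(3) in auto)
  then show "npos C ?m = npos C t" by (simp add: npos_def)
qed

text \<open>The count increases only at points of C, so the infimum is attained at one of them. The
  equivalence reduces comparisons with \<open>nth_pos\<close> to counts in intervals, on which both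
  measurability and the Markov property rest.\<close>

lemma nth_pos_props:
  assumes "k < npos C t0"
  shows "nth_pos k C \<in> C" "0 < nth_pos k C" "k < npos C t \<longleftrightarrow> nth_pos k C \<le> t"
proof -
  define F where "F = {x \<in> C \<inter> {0<..t0}. k < npos C x}"
  define m where "m = Min F"
  have ne: "C \<inter> {0<..s} \<noteq> {}" if "k < npos C s" for s using that by (auto simp: npos_def)
  have "finite F" by (rule finite_subset[OF _ finite_pos[of t0]]) (auto simp: F_def)
  moreover have "F \<noteq> {}" using npos_Max[OF ne[OF assms]] assms by (auto simp: F_def)
  ultimately have "m \<in> F" unfolding m_def by (rule Min_in)
  then have m: "m \<in> C" "0 < m" "m \<le> t0" "k < npos C m" by (auto simp: F_def)
  have iff: "k < npos C t \<longleftrightarrow> m \<le> t" for t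
  proof
    assume "m \<le> t" then show "k < npos C t" using m(4) npos_mono[of m t] by simp
  next
    assume k: "k < npos C t"
    show "m \<le> t"
    proof (rule ccontr)
      assume "\<not> m \<le> t"
      note x = npos_Max[OF ne[OF k]]
      have "Max (C \<inter> {0<..t}) \<in> F" using x k \<open>\<not> m \<le> t\<close> m(3) by (auto simp: F_def)
      then have "m \<le> Max (C \<inter> {0<..t})" unfolding m_def using \<open>finite F\<close> by (rule Min_le[rotated])
      with x(4) \<open>\<not> m \<le> t\<close> show False by simp
    qed
  qed
  obtain n :: nat where "t0 \<le> real n" using real_arch_simple by blast
  then have "k < npos C (real n)" using assms npos_mono[of t0 "real n"] by simp
  then have "\<exists>n::nat. k < npos C (real n)" by blast
  then have "nth_pos k C = Inf {t. k < npos C t}" unfolding nth_pos_def by (rule if_P)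
  also have "{t. k < npos C t} = {m..}" by (simp only: iff atLeast_def)
  finally have "nth_pos k C = m" by simp
  then show "nth_pos k C \<in> C" "0 < nth_pos k C" "k < npos C t \<longleftrightarrow> nth_pos k C \<le> t"
    using m iff by auto
qed

lemma nth_pos_le_iff:
  "nth_pos k C \<le> t \<longleftrightarrow> (if \<exists>n::nat. k < npos C (real n) then k < npos C t else 1 \<le> t)"
proof (cases "\<exists>n::nat. k < npos C (real n)")
  case True
  then obtain n :: nat where "k < npos C (real n)" by blast
  from nth_pos_props(3)[OF this, of t] True show ?thesis by (simp only: if_True simp_thms)
next
  case False
  then have "nth_pos k C = 1" unfolding nth_pos_def by (rule if_not_P)
  with False show ?thesis by (simp only: if_False simp_thms)
qed

lemma nth_pos_pos: "0 < nth_pos k C"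
proof (cases "\<exists>n::nat. k < npos C (real n)")
  case True
  then obtain n :: nat where "k < npos C (real n)" by blast
  then show ?thesis by (rule nth_pos_props(2))
next
  case False
  then have "nth_pos k C = 1" unfolding nth_pos_def by (rule if_not_P)
  then show ?thesis by simp
qed

context
  assumes unb: "unbounded_pos C"
begin

lemma nth_pos_iff: "k < npos C t \<longleftrightarrow> nth_pos k C \<le> t"
  and nth_pos_in: "nth_pos k C \<in> C"
proof -
  obtain n :: nat where "k < npos C (real n)" using unb unfolding unbounded_pos_def by blast
  from nth_pos_props[OF this] show "k < npos C t \<longleftrightarrow> nth_pos k C \<le> t" "nth_pos k C \<in> C" by auto
qed

lemma nth_pos_strict_mono: "strict_mono (\<lambda>k. nth_pos k C)"
  unfolding strict_mono_Suc_iff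
proof
  fix k
  let ?m = "nth_pos (Suc k) C"
  let ?F = "C \<inter> {0<..?m} - {?m}"
  have "Suc k < npos C ?m" using nth_pos_iff[of "Suc k" ?m] by simp
  then have "k < card ?F" by (auto simp: npos_def card_Diff_singleton_if)
  then have ne: "?F \<noteq> {}" by (intro notI) (simp only: card.empty)
  define x where "x = Max ?F"
  have "x \<in> ?F" unfolding x_def using finite_pos ne by (intro Max_in) auto
  then have x: "x \<in> C" "0 < x" "x < ?m" by auto
  have "?F \<subseteq> C \<inter> {0<..x}"
  proof
    fix y assume y: "y \<in> ?F"
    have "y \<le> x" unfolding x_def by (rule Max_ge[OF _ y]) (use finite_pos in blast)
    with y show "y \<in> C \<inter> {0<..x}" by simp
  qed
  then have "card ?F \<le> npos C x" unfolding npos_def by (intro card_mono finite_pos)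
  with \<open>k < card ?F\<close> have "nth_pos k C \<le> x" using nth_pos_iff[of k x] by simp
  with x show "nth_pos k C < ?m" by simp
qed

lemma range_nth_pos: "C \<inter> {0<..} = range (\<lambda>k. nth_pos k C)"
proof
  show "range (\<lambda>k. nth_pos k C) \<subseteq> C \<inter> {0<..}" using nth_pos_in nth_pos_pos by auto
  show "C \<inter> {0<..} \<subseteq> range (\<lambda>k. nth_pos k C)"
  proof
    fix x assume x: "x \<in> C \<inter> {0<..}"
    have "0 < npos C x" unfolding npos_def using finite_pos x by (subst card_gt_0_iff) auto
    \<comment> \<open>The point x is the last of the k + 1 positive points up to x; since the
      enumeration starts at 0, its index is k.\<close>
    then obtain k where k: "npos C x = Suc k" using gr0_implies_Suc by blast
    then have le: "nth_pos k C \<le> x" using nth_pos_iff[of k x] by simp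
    moreover have "\<not> nth_pos k C < x"
    proof
      assume lt: "nth_pos k C < x"
      have "insert x (C \<inter> {0<..nth_pos k C}) \<subseteq> C \<inter> {0<..x}" using x lt by auto
      then have "card (insert x (C \<inter> {0<..nth_pos k C})) \<le> npos C x"
        unfolding npos_def by (intro card_mono finite_pos)
      moreover have "card (insert x (C \<inter> {0<..nth_pos k C})) = Suc (npos C (nth_pos k C))"
        unfolding npos_def using finite_pos lt by (subst card_insert_disjoint) auto
      moreover have "k < npos C (nth_pos k C)" using nth_pos_iff[of k "nth_pos k C"] by simp
      ultimately show False using k by simp
    qed
    ultimately show "x \<in> range (\<lambda>k. nth_pos k C)" by auto
  qed
qed

end

end

lemma nth_pos_cong: "C \<inter> {0<..} = D \<inter> {0<..} \<Longrightarrow> nth_pos k C = nth_pos k D"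
  and unbounded_pos_cong: "C \<inter> {0<..} = D \<inter> {0<..} \<Longrightarrow> unbounded_pos C = unbounded_pos D"
proof -
  assume "C \<inter> {0<..} = D \<inter> {0<..}"
  moreover have "C \<inter> {0<..t} = (C \<inter> {0<..}) \<inter> {..t}" "D \<inter> {0<..t} = (D \<inter> {0<..}) \<inter> {..t}" for t by auto
  ultimately have "npos C = npos D" unfolding npos_def by metis
  then show "nth_pos k C = nth_pos k D" "unbounded_pos C = unbounded_pos D"
    by (simp_all add: nth_pos_def unbounded_pos_def)
qed

subsection \<open>Measurability\<close>

lemma space_config: "space config_space = {S. locally_finite S}"
  unfolding config_space_def by (rule space_measure_of) auto

lemma card_config_sets:
  "B \<in> sets borel \<Longrightarrow> bounded B \<Longrightarrow> {S. locally_finite S \<and> card (S \<inter> B) = k} \<in> sets config_space"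
  unfolding config_space_def by (subst sets_measure_of) auto

lemma measurable_card:
  assumes X: "X \<in> measurable F config_space" and B: "B \<in> sets borel" "bounded B"
  shows "(\<lambda>w. card (X w \<inter> B)) \<in> measurable F (count_space UNIV)"
proof (subst measurable_count_space_eq2_countable, intro conjI ballI)
  fix k :: nat
  have "X -` {S. locally_finite S \<and> card (S \<inter> B) = k} \<inter> space F \<in> sets F"
    using X card_config_sets[OF B] by (rule measurable_sets)
  moreover have "locally_finite (X w)" if "w \<in> space F" for w
    using measurable_space[OF X that] by (simp add: space_config)
  then have "X -` {S. locally_finite S \<and> card (S \<inter> B) = k} \<inter> space F = (\<lambda>w. card (X w \<inter> B)) -` {k} \<inter> space F"
    by auto
  ultimately show "(\<lambda>w. card (X w \<inter> B)) -` {k} \<inter> space F \<in> sets F" by simp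
qed simp

lemma measurable_npos: "X \<in> measurable F config_space \<Longrightarrow> (\<lambda>w. npos (X w) t) \<in> measurable F (count_space UNIV)"
  unfolding npos_def by (rule measurable_card) auto

lemma measurable_nth_pos:
  assumes X: "X \<in> measurable F config_space"
  shows "(\<lambda>w. nth_pos k (X w)) \<in> borel_measurable F"
proof (rule borel_measurableI_le)
  fix t
  note [measurable] = measurable_npos[OF X]
  have "locally_finite (X w)" if "w \<in> space F" for w
    using measurable_space[OF X that] by (simp add: space_config)
  then have "{w \<in> space F. nth_pos k (X w) \<le> t} =
    {w \<in> space F. if \<exists>n::nat. k < npos (X w) (real n) then k < npos (X w) t else 1 \<le> t}"
    by (intro Collect_cong conj_cong refl nth_pos_le_iff)
  also have "\<dots> \<in> sets F" by measurable
  finally show "{w \<in> space F. nth_pos k (X w) \<le> t} \<in> sets F" .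
qed

lemma sets_unbounded_pos:
  "X \<in> measurable F config_space \<Longrightarrow> {w \<in> space F. unbounded_pos (X w)} \<in> sets F"
proof -
  assume X: "X \<in> measurable F config_space"
  note [measurable] = measurable_npos[OF X]
  show ?thesis unfolding unbounded_pos_def by measurable
qed

text \<open>A locally finite set is closed, so membership of a random point is decided by the counts in
  small balls around rationals.\<close>

lemma sets_mem_config:
  assumes Y: "Y \<in> measurable F config_space" and \<xi> [measurable]: "\<xi> \<in> borel_measurable F"
  shows "{w \<in> space F. \<xi> w \<in> Y w} \<in> sets F"
proof -
  have lf: "locally_finite (Y w)" if "w \<in> space F" for w
    using measurable_space[OF Y that] by (simp add: space_config)
  have eq: "\<xi> w \<in> Y w \<longleftrightarrow> (\<forall>m::nat. \<exists>q::rat. \<bar>\<xi> w - of_rat q\<bar> < 1 / (real m + 1) \<and> 0 < card (Y w \<inter> cball (of_rat q) (1 / (real m + 1))))"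
    (is "_ \<longleftrightarrow> ?R") if w: "w \<in> space F" for w
  proof
    assume mem: "\<xi> w \<in> Y w"
    show ?R
    proof
      fix m :: nat
      obtain q where q: "\<xi> w < of_rat q" "of_rat q < \<xi> w + 1 / (real m + 1)"
        using of_rat_dense[of "\<xi> w" "\<xi> w + 1 / (real m + 1)"] by auto
      have "finite (Y w \<inter> cball (of_rat q) (1 / (real m + 1)))"
        using lf[OF w] by (auto simp: locally_finite_def)
      moreover have "\<xi> w \<in> Y w \<inter> cball (of_rat q) (1 / (real m + 1))"
        using mem q by (auto simp: dist_real_def)
      ultimately have "0 < card (Y w \<inter> cball (of_rat q) (1 / (real m + 1)))" by (auto simp: card_gt_0_iff)
      with q show "\<exists>q::rat. \<bar>\<xi> w - of_rat q\<bar> < 1 / (real m + 1) \<and> 0 < card (Y w \<inter> cball (of_rat q) (1 / (real m + 1)))"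
        by (intro exI[of _ q]) auto
    qed
  next
    assume R: ?R
    show "\<xi> w \<in> Y w"
    proof (rule ccontr)
      assume nmem: "\<xi> w \<notin> Y w"
      define A where "A = Y w \<inter> cball (\<xi> w) 2"
      have "finite A" using lf[OF w] by (auto simp: A_def locally_finite_def)
      then have "closed A" by (rule finite_imp_closed)
      then have "open (- A)" by auto
      moreover have "\<xi> w \<in> - A" using nmem by (auto simp: A_def)
      ultimately obtain e where e: "0 < e" "ball (\<xi> w) e \<subseteq> - A" by (auto simp: open_contains_ball)
      define r where "r = min e 2"
      have r: "0 < r" "r \<le> e" "r \<le> 2" using e(1) by (auto simp: r_def)
      obtain m :: nat where m: "2 / r < real m" using reals_Archimedean2 by blast
      then have "2 < real m * r" using r(1) by (simp add: field_simps)
      also have "\<dots> \<le> (real m + 1) * r" using r(1) by (intro mult_right_mono) auto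
      finally have small: "2 / (real m + 1) < r" by (simp add: field_simps)
      obtain q :: rat where q: "\<bar>\<xi> w - of_rat q\<bar> < 1 / (real m + 1)"
        "0 < card (Y w \<inter> cball (of_rat q) (1 / (real m + 1)))" using R by blast
      then obtain y where y: "y \<in> Y w" "\<bar>of_rat q - y\<bar> \<le> 1 / (real m + 1)"
        by (auto simp: card_gt_0_iff dist_real_def)
      have "\<bar>\<xi> w - y\<bar> < 2 / (real m + 1)" using q(1) y(2) by (simp add: add_divide_distrib[symmetric])
      with small r have "\<bar>\<xi> w - y\<bar> < e" "\<bar>\<xi> w - y\<bar> \<le> 2" by linarith+
      then have "y \<in> A" "y \<in> ball (\<xi> w) e" using y(1) by (auto simp: A_def dist_real_def)
      with e(2) show False by auto
    qed
  qed
  have [measurable]: "(\<lambda>w. card (Y w \<inter> cball a r)) \<in> measurable F (count_space UNIV)" for a r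
    by (rule measurable_card[OF Y]) auto
  have "{w \<in> space F. \<xi> w \<in> Y w} = {w \<in> space F. \<forall>m::nat. \<exists>q::rat. \<bar>\<xi> w - of_rat q\<bar> < 1 / (real m + 1) \<and> 0 < card (Y w \<inter> cball (of_rat q) (1 / (real m + 1)))}"
    using eq by auto
  also have "\<dots> \<in> sets F" by measurable
  finally show ?thesis .
qed

lemma space_sigma_gen [simp]: "space (sigma_gen M X) = space M"
  by (simp add: sigma_gen_def)

lemma measurable_sigma_gen:
  "point_process M X \<Longrightarrow> X \<in> measurable (sigma_gen M X) config_space"
  unfolding sigma_gen_def point_process_def
  by (rule measurable_vimage_algebra1) (auto dest: measurable_space)

lemma sets_sigma_gen_subset:
  assumes "X \<in> measurable F config_space" "space F = space M"
  shows "sets (sigma_gen M X) \<subseteq> sets F"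
proof -
  have "X \<in> space M \<rightarrow> space config_space" using measurable_space[OF assms(1)] assms(2) by auto
  then have "sets (sigma_gen M X) = {X -` A \<inter> space M |A. A \<in> sets config_space}"
    unfolding sigma_gen_def by (rule sets_vimage_algebra2)
  then show ?thesis using measurable_sets[OF assms(1)] assms(2) by auto
qed

section \<open>Gaps of a Poisson process\<close>

text \<open>For j = 0, where j - 1 is 0, both sides are false because x is positive.\<close>

lemma nat_ceiling_eq_iff:
  fixes x :: real assumes "0 < x"
  shows "nat \<lceil>x\<rceil> = j \<longleftrightarrow> real (j - 1) < x \<and> x \<le> real j"
proof (cases j)
  case 0
  then show ?thesis using assms by simp
next
  case (Suc n)
  have "nat \<lceil>x\<rceil> = Suc n \<longleftrightarrow> \<lceil>x\<rceil> = int (Suc n)" by linarith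
  also have "\<dots> \<longleftrightarrow> real n < x \<and> x \<le> real (Suc n)" by (simp add: ceiling_eq_iff)
  finally show ?thesis using Suc by simp
qed

locale unit_poisson = prob_space M for M :: "'w measure" +
  fixes N :: "'w \<Rightarrow> real set"
  assumes poisson: "poisson_process M 1 N"
begin

lemma N_meas: "N \<in> measurable M config_space"
  using poisson by (simp add: poisson_process_def point_process_def)

lemma N_lf: "w \<in> space M \<Longrightarrow> locally_finite (N w)"
  using measurable_space[OF N_meas] by (simp add: space_config)

lemma card_meas [measurable]: "(\<lambda>w. card (N w \<inter> {a<..b})) \<in> measurable M (count_space UNIV)"
  by (rule measurable_card[OF N_meas]) auto

lemma T_meas [measurable]: "(\<lambda>w. nth_pos k (N w)) \<in> borel_measurable M"
  by (rule measurable_nth_pos[OF N_meas])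

lemma T_pos: "w \<in> space M \<Longrightarrow> 0 < nth_pos k (N w)"
  by (rule nth_pos_pos[OF N_lf])

lemma count_prob:
  assumes "a \<le> b"
  shows "prob {w \<in> space M. card (N w \<inter> {a<..b}) = k} = exp (- (b - a)) * (b - a) ^ k / fact k"
proof -
  have "measure lborel {a<..b} = b - a" using assms by simp
  then show ?thesis using poisson by (simp add: poisson_process_def)
qed

lemma AE_unbounded: "AE w in M. unbounded_pos (N w)"
  unfolding unbounded_pos_def AE_all_countable
proof
  fix k
  define F where "F n = {w \<in> space M. npos (N w) (real n) \<le> k}" for n :: nat
  have F_sets: "F n \<in> events" for n
    using measurable_npos[OF N_meas] unfolding F_def by measurable
  have "prob (\<Inter>n. F n) \<le> (\<Sum>j\<le>k. real n ^ j / exp (real n) / fact j)" for n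
  proof -
    have "prob (\<Inter>n. F n) \<le> prob (\<Union>j\<in>{..k}. {w \<in> space M. card (N w \<inter> {0<..real n}) = j})"
      by (intro finite_measure_mono) (auto simp: F_def npos_def)
    also have "\<dots> \<le> (\<Sum>j\<in>{..k}. prob {w \<in> space M. card (N w \<inter> {0<..real n}) = j})"
      by (intro finite_measure_subadditive_finite) auto
    also have "\<dots> = (\<Sum>j\<le>k. real n ^ j / exp (real n) / fact j)"
      by (intro sum.cong refl) (subst count_prob; simp add: exp_minus field_simps)
    finally show ?thesis .
  qed
  moreover have "(\<lambda>n. \<Sum>j\<le>k. real n ^ j / exp (real n) / fact j) \<longlonglongrightarrow> (\<Sum>j\<le>k. 0 / fact j)"
    by (intro tendsto_sum tendsto_divide tendsto_const
        filterlim_compose[OF tendsto_power_div_exp_0 filterlim_real_sequentially]) auto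
  ultimately have "prob (\<Inter>n. F n) \<le> (\<Sum>j\<le>k. 0 / fact j)"
    by (intro LIMSEQ_le_const) auto
  then have "prob (\<Inter>n. F n) = 0" by (simp add: measure_le_0_iff)
  then have "AE w in M. w \<notin> (\<Inter>n. F n)"
    using F_sets by (subst (asm) prob_eq_0) auto
  then show "AE w in M. \<exists>n::nat. k < npos (N w) (real n)"
    using AE_space by eventually_elim (auto simp: F_def not_le)
qed

section \<open>Markov property at the points of the process, through dyadic grids\<close>

definition cells :: "real \<Rightarrow> nat \<Rightarrow> 'w \<Rightarrow> nat \<Rightarrow> nat" where
  "cells h J w = (\<lambda>l\<in>{..<J}. card (N w \<inter> {real l * h<..(real l + 1) * h}))"

text \<open>J is deterministic here; random times are treated by summing over J. Q may be any
  predicate, since every set of count vectors is measurable in a finite product of countable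
  discrete spaces.\<close>

lemma cells_indep:
  assumes h: "0 < h" and s: "0 \<le> s"
  shows "{w \<in> space M. Q (cells h J w)} \<in> events"
    and "prob {w \<in> space M. Q (cells h J w) \<and> card (N w \<inter> {real J * h<..real J * h + s}) = 0} =
      prob {w \<in> space M. Q (cells h J w)} * exp (- s)"
proof -
  \<comment> \<open>The window after time J h is appended as block J, so that a single instance of
    the independence of counts covers past and window.\<close>
  define B where "B l = (if l < J then {real l * h<..(real l + 1) * h} else {real J * h<..real J * h + s})" for l
  have disj: "disjoint_family_on B {..<Suc J}"
    unfolding disjoint_family_on_def
  proof (intro ballI impI)
    fix a b assume ab: "a \<in> {..<Suc J}" "b \<in> {..<Suc J}" "a \<noteq> b"
    have *: "B a \<inter> B b = {}" if "a < b" "b \<le> J" for a b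
    proof -
      have "real a + 1 \<le> real b" using that by simp
      then have "(real a + 1) * h \<le> real b * h" using h by (intro mult_right_mono) auto
      then show ?thesis using that by (auto simp: B_def)
    qed
    show "B a \<inter> B b = {}"
      using ab *[of a b] *[of b a] by (cases a b rule: linorder_cases) auto
  qed
  have "indep_vars (\<lambda>_. count_space UNIV) (\<lambda>i w. card (N w \<inter> B i)) {..<Suc J}"
  proof -
    have "\<forall>i<Suc J. B i \<in> sets borel \<and> bounded (B i)" by (simp add: B_def)
    with poisson disj show ?thesis unfolding poisson_process_def by blast
  qed
  then have ind: "indep_var (PiM {..<J} (\<lambda>_. count_space UNIV)) (\<lambda>w. restrict (\<lambda>i. card (N w \<inter> B i)) {..<J})
      (PiM {J} (\<lambda>_. count_space UNIV)) (\<lambda>w. restrict (\<lambda>i. card (N w \<inter> B i)) {J})"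
    by (rule indep_var_restrict) auto
  have cell: "restrict (\<lambda>i. card (N w \<inter> B i)) {..<J} = cells h J w" for w
    by (auto simp: cells_def B_def fun_eq_iff)
  have all_sets: "Z \<in> sets (PiM I (\<lambda>_. count_space (UNIV :: nat set)))" if "finite I" "Z \<subseteq> PiE I (\<lambda>_. UNIV)" for I :: "nat set" and Z
    using that count_space_PiM_finite[of I "\<lambda>_. UNIV :: nat set"] by (simp add: comp_def)
  define Za where "Za = {f \<in> PiE {..<J} (\<lambda>_. UNIV). Q f}"
  define Zb where "Zb = {f \<in> PiE {J} (\<lambda>_. UNIV). f J = (0::nat)}"
  have Z: "Za \<in> sets (PiM {..<J} (\<lambda>_. count_space UNIV))" "Zb \<in> sets (PiM {J} (\<lambda>_. count_space UNIV))"
    by (auto intro!: all_sets simp: Za_def Zb_def)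
  define R where "R w = restrict (\<lambda>i. card (N w \<inter> B i)) {J}" for w
  have ind': "indep_var (PiM {..<J} (\<lambda>_. count_space UNIV)) (cells h J) (PiM {J} (\<lambda>_. count_space UNIV)) R"
    using ind by (simp only: cell R_def[abs_def])
  have mem: "cells h J w \<in> Za \<longleftrightarrow> Q (cells h J w)"
    "R w \<in> Zb \<longleftrightarrow> card (N w \<inter> {real J * h<..real J * h + s}) = 0" for w
    by (auto simp: Za_def Zb_def cells_def B_def R_def)
  have pre: "cells h J -` Za \<inter> space M = {w \<in> space M. Q (cells h J w)}"
    "R -` Zb \<inter> space M = {w \<in> space M. card (N w \<inter> {real J * h<..real J * h + s}) = 0}"
    "(\<lambda>w. (cells h J w, R w)) -` (Za \<times> Zb) \<inter> space M =
      {w \<in> space M. Q (cells h J w) \<and> card (N w \<inter> {real J * h<..real J * h + s}) = 0}"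
    by (auto simp only: vimage_eq mem mem_Times_iff fst_conv snd_conv Int_iff mem_Collect_eq)
  show "{w \<in> space M. Q (cells h J w)} \<in> events"
    using measurable_sets[OF indep_var_rv1[OF ind'] Z(1)] by (simp only: pre)
  have "prob {w \<in> space M. card (N w \<inter> {real J * h<..real J * h + s}) = 0} = exp (- s)"
    using count_prob[of "real J * h" "real J * h + s" 0] s by simp
  then show "prob {w \<in> space M. Q (cells h J w) \<and> card (N w \<inter> {real J * h<..real J * h + s}) = 0} =
      prob {w \<in> space M. Q (cells h J w)} * exp (- s)"
    using indep_varD[OF ind' Z] by (simp only: pre)
qed

lemma npos_cells:
  assumes h: "0 < h" and w: "w \<in> space M" and "a \<le> J"
  shows "npos (N w) (real a * h) = (\<Sum>l<a. cells h J w l)"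
  using assms(3)
proof (induction a)
  case 0
  show ?case by (simp add: npos_def)
next
  case (Suc a)
  have ah: "0 \<le> real a * h" "real a * h \<le> (real a + 1) * h" using h by auto
  have "N w \<inter> {0<..(real a + 1) * h} = (N w \<inter> {0<..real a * h}) \<union> (N w \<inter> {real a * h<..(real a + 1) * h})"
    using ah by auto
  moreover have "finite (N w \<inter> {x<..y})" for x y using N_lf[OF w] by (simp add: locally_finite_def)
  ultimately have "npos (N w) ((real a + 1) * h) = npos (N w) (real a * h) + card (N w \<inter> {real a * h<..(real a + 1) * h})"
    unfolding npos_def by (simp add: card_Un_disjoint disjoint_iff)
  then show ?case using Suc by (simp add: cells_def add.commute)
qed

abbreviation T :: "nat \<Rightarrow> 'w \<Rightarrow> real" where
  "T k w \<equiv> nth_pos k (N w)"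

text \<open>Dyadic thresholds make the event almost surely decidable from counts on a fine grid. For
  fixed k these events are stable under intersection and generate the information in
  \<open>T 0, ..., T k\<close>.\<close>

definition later :: "nat \<Rightarrow> nat \<Rightarrow> (nat \<Rightarrow> nat) \<Rightarrow> 'w set" where
  "later k m \<alpha> = {w \<in> space M. \<forall>i\<le>k. real (\<alpha> i) / 2 ^ m < T i w}"

lemma later_sets [measurable]: "later k m \<alpha> \<in> events"
  unfolding later_def by measurable

text \<open>The strong Markov property at \<open>T k\<close>, by rounding \<open>T k\<close> up to the dyadic grid.\<close>

lemma strong_markov:
  assumes s: "0 \<le> s"
  shows "prob (later k m0 \<alpha> \<inter> {w \<in> space M. s < T (Suc k) w - T k w}) = exp (- s) * prob (later k m0 \<alpha>)"
proof -
  define U where "U = {w \<in> space M. unbounded_pos (N w)}"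
  \<comment> \<open>On U every \<open>T i\<close> is a genuine point governed by the counts; the
    identities below are proved there and U is then discarded as an almost sure event.\<close>
  have U [measurable]: "U \<in> events" unfolding U_def by (rule sets_unbounded_pos[OF N_meas])
  have AE_U: "AE w in M. w \<in> U" using AE_unbounded AE_space by eventually_elim (simp add: U_def)
  have cut: "prob (E \<inter> U) = prob E" if [measurable]: "E \<in> events" for E
    by (rule finite_measure_eq_AE) (use AE_U in auto)
  define J where "J m w = nat \<lceil>T k w * 2 ^ m\<rceil>" for m :: nat and w
  have [measurable]: "J m \<in> measurable M (count_space UNIV)" for m
    unfolding J_def by measurable
  define G where "G m = {w \<in> space M. card (N w \<inter> {real (J m w) * (1 / 2 ^ m)<..real (J m w) * (1 / 2 ^ m) + s}) = 0}" for m
  have G [measurable]: "G m \<in> events" for m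
  proof -
    have "(\<lambda>w. card (N w \<inter> {real (J m w) * (1 / 2 ^ m)<..real (J m w) * (1 / 2 ^ m) + s})) \<in> measurable M (count_space UNIV)"
      by (rule measurable_compose_countable[where f = "\<lambda>j w. card (N w \<inter> {real j * (1 / 2 ^ m)<..real j * (1 / 2 ^ m) + s})"])
        measurable
    then show ?thesis unfolding G_def by measurable
  qed
  define A where "A = later k m0 \<alpha>"
  have A [measurable]: "A \<in> events" by (simp add: A_def)
  have iff: "i < npos (N w) t \<longleftrightarrow> T i w \<le> t" if "w \<in> U" for w i t
    using that N_lf by (intro nth_pos_iff) (auto simp: U_def)
  have mono: "T i w < T j w" if "w \<in> U" "i < j" for w i j
    using that N_lf strict_monoD[OF nth_pos_strict_mono] by (auto simp: U_def)
  have step: "prob (A \<inter> U \<inter> G m) = exp (- s) * prob (A \<inter> U)" if m: "m0 \<le> m" for m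
  proof -
    define h :: real where "h = 1 / 2 ^ m"
    have h: "0 < h" by (simp add: h_def)
    \<comment> \<open>Expresses through the first j counts that \<open>T k\<close> lies in the last
      of these cells and that all thresholds are exceeded. A threshold \<alpha> i at level m0 is
      \<alpha> i * 2 ^ (m - m0) at level m; capping it at j is harmless because \<open>T i\<close>
      is at most \<open>T k\<close>.\<close>
    define Q where "Q j f \<longleftrightarrow> (\<forall>i\<le>k. (\<Sum>l<min (\<alpha> i * 2 ^ (m - m0)) j. f l) \<le> i) \<and> (\<Sum>l<j - 1. f l) \<le> k \<and> k < (\<Sum>l<j. f l)"
      for j :: nat and f :: "nat \<Rightarrow> nat"
    define E where "E j = {w \<in> space M. Q j (cells h j w)}" for j
    define V where "V j = {w \<in> space M. card (N w \<inter> {real j * h<..real j * h + s}) = 0}" for j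
    have [measurable]: "E j \<in> events" "V j \<in> events" for j
      unfolding E_def V_def by (rule cells_indep(1)[OF h s], measurable)
    have EV: "prob (E j \<inter> V j) = prob (E j) * exp (- s)" for j
      using cells_indep(2)[OF h s, of "Q j" j] by (simp add: E_def V_def Int_def conj_ac)
    have E_iff: "w \<in> E j \<longleftrightarrow> w \<in> A \<and> J m w = j" if w: "w \<in> U" for w j
    proof -
      have sp: "w \<in> space M" using w by (simp add: U_def)
      have n: "npos (N w) (real a * h) = (\<Sum>l<a. cells h j w l)" if "a \<le> j" for a
        by (rule npos_cells[OF h sp that])
      have Jj: "J m w = j \<longleftrightarrow> real (j - 1) * h < T k w \<and> T k w \<le> real j * h"
      proof -
        have T: "0 < T k w * 2 ^ m" using T_pos[OF sp] by simp
        have "J m w = j \<longleftrightarrow> real (j - 1) < T k w * 2 ^ m \<and> T k w * 2 ^ m \<le> real j"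
          unfolding J_def by (rule nat_ceiling_eq_iff[OF T])
        then show ?thesis by (simp add: h_def field_simps)
      qed
      have "w \<in> E j \<longleftrightarrow> (\<forall>i\<le>k. real (min (\<alpha> i * 2 ^ (m - m0)) j) * h < T i w) \<and> real (j - 1) * h < T k w \<and> T k w \<le> real j * h"
        using sp by (simp add: E_def Q_def n[symmetric] not_less[symmetric] iff[OF w] not_le)
      also have "\<dots> \<longleftrightarrow> (\<forall>i\<le>k. real (\<alpha> i * 2 ^ (m - m0)) * h < T i w) \<and> real (j - 1) * h < T k w \<and> T k w \<le> real j * h"
      proof -
        have "real (min a j) * h < T i w \<longleftrightarrow> real a * h < T i w" if "i \<le> k" "T k w \<le> real j * h" for i a
        proof (cases "a \<le> j")
          case False
          have "T i w \<le> T k w" using mono[OF w, of i k] that(1) by (cases "i = k") auto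
          moreover have "real j * h \<le> real a * h" using False h by (intro mult_right_mono) auto
          ultimately show ?thesis using False that(2) by (simp add: min_def)
        qed (simp add: min_def)
        then show ?thesis by blast
      qed
      also have "(\<forall>i\<le>k. real (\<alpha> i * 2 ^ (m - m0)) * h < T i w) \<longleftrightarrow> w \<in> A"
      proof -
        have "(2::real) ^ m = 2 ^ m0 * 2 ^ (m - m0)" using m by (simp flip: power_add)
        then have "real (a * 2 ^ (m - m0)) * h = real a / 2 ^ m0" for a by (simp add: h_def)
        then show ?thesis using sp by (simp add: A_def later_def)
      qed
      finally show ?thesis by (simp only: Jj)
    qed
    have un: "A \<inter> U = (\<Union>j. E j \<inter> U)" "A \<inter> U \<inter> G m = (\<Union>j. E j \<inter> V j \<inter> U)"
    proof -
      show "A \<inter> U = (\<Union>j. E j \<inter> U)" using E_iff by auto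
      have "w \<in> G m \<longleftrightarrow> w \<in> V (J m w)" for w by (simp add: G_def V_def h_def)
      then show "A \<inter> U \<inter> G m = (\<Union>j. E j \<inter> V j \<inter> U)" using E_iff by auto
    qed
    have disj: "disjoint_family (\<lambda>j. E j \<inter> U)" "disjoint_family (\<lambda>j. E j \<inter> V j \<inter> U)"
      using E_iff by (auto simp: disjoint_family_on_def)
    have "(\<lambda>j. prob (E j \<inter> U)) sums prob (A \<inter> U)"
      unfolding un(1) by (intro finite_measure_UNION disj) auto
    then have "(\<lambda>j. exp (- s) * prob (E j \<inter> U)) sums (exp (- s) * prob (A \<inter> U))" by (rule sums_mult)
    moreover have "(\<lambda>j. prob (E j \<inter> V j \<inter> U)) sums prob (A \<inter> U \<inter> G m)"
      unfolding un(2) by (intro finite_measure_UNION disj) auto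
    moreover have "prob (E j \<inter> V j \<inter> U) = exp (- s) * prob (E j \<inter> U)" for j
      using cut[of "E j \<inter> V j"] cut[of "E j"] EV[of j] by (simp add: mult.commute)
    ultimately show ?thesis using sums_unique2 by simp
  qed
  define H where "H = {w \<in> space M. s < T (Suc k) w - T k w}"
  have H [measurable]: "H \<in> events" unfolding H_def by measurable
  \<comment> \<open>On U the events \<open>G m\<close> and \<open>H\<close> agree for all large m.
    If the gap exceeds s, the window is empty once the mesh is below the excess; otherwise
    \<open>T (Suc k)\<close> falls into it once the mesh is below the gap.\<close>
  have "(\<lambda>m. \<integral>w. indicator (A \<inter> U \<inter> G m) w \<partial>M) \<longlonglongrightarrow> (\<integral>w. indicator (A \<inter> U \<inter> H) w \<partial>M :: real)"
  proof (rule integral_dominated_convergence[where w = "\<lambda>_. 1"])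
    show "AE w in M. (\<lambda>m. indicator (A \<inter> U \<inter> G m) w :: real) \<longlonglongrightarrow> indicator (A \<inter> U \<inter> H) w"
    proof (rule AE_I2)
      fix w assume sp: "w \<in> space M"
      show "(\<lambda>m. indicator (A \<inter> U \<inter> G m) w :: real) \<longlonglongrightarrow> indicator (A \<inter> U \<inter> H) w"
      proof (cases "w \<in> U")
        case w: True
        let ?\<tau> = "\<lambda>m. real (J m w) * (1 / 2 ^ m)"
        have \<tau>: "T k w \<le> ?\<tau> m" "?\<tau> m < T k w + 1 / 2 ^ m" for m
        proof -
          have "0 < T k w * 2 ^ m" using T_pos[OF sp] by simp
          then have "real (J m w) = of_int \<lceil>T k w * 2 ^ m\<rceil>" by (simp add: J_def)
          then have "T k w * 2 ^ m \<le> real (J m w)" "real (J m w) < T k w * 2 ^ m + 1" by linarith+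
          then show "T k w \<le> ?\<tau> m" "?\<tau> m < T k w + 1 / 2 ^ m" by (simp_all add: field_simps)
        qed
        have small: "\<forall>\<^sub>F m in sequentially. 1 / 2 ^ m < e" if "0 < e" for e :: real
        proof -
          have "(\<lambda>m. (1/2) ^ m :: real) \<longlonglongrightarrow> 0" by (intro LIMSEQ_power_zero) simp
          from order_tendstoD(2)[OF this that] show ?thesis by (simp add: power_one_over)
        qed
        have points: "x \<in> N w \<and> 0 < x \<longleftrightarrow> (\<exists>i. x = T i w)" for x
          using range_nth_pos[OF N_lf[OF sp]] w by (auto simp: U_def set_eq_iff)
        have fin: "finite (N w \<inter> {x<..y})" for x y using N_lf[OF sp] by (simp add: locally_finite_def)
        have "\<forall>\<^sub>F m in sequentially. w \<in> G m \<longleftrightarrow> w \<in> H"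
        proof (cases "w \<in> H")
          case True
          then have "0 < T (Suc k) w - T k w - s" by (simp add: H_def)
          from small[OF this] show ?thesis
          proof eventually_elim
            fix m assume m: "1 / 2 ^ m < T (Suc k) w - T k w - s"
            have "N w \<inter> {?\<tau> m<..?\<tau> m + s} = {}"
            proof (rule ccontr)
              assume "\<not> ?thesis"
              then obtain x where x: "x \<in> N w" "?\<tau> m < x" "x \<le> ?\<tau> m + s" by auto
              have "T k w < x" "x < T (Suc k) w" using \<tau>[of m] m x by linarith+
              moreover obtain i where "x = T i w" using points[of x] x(1) T_pos[OF sp, of k] \<open>T k w < x\<close> by auto
              ultimately have "T k w < T i w" "T i w < T (Suc k) w" by simp_all
              moreover have "i \<le> k \<or> Suc k \<le> i" by linarith
              ultimately show False using mono[OF w, of i k] mono[OF w, of "Suc k" i]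
                by (auto simp: le_less)
            qed
            then show "w \<in> G m \<longleftrightarrow> w \<in> H" using True sp by (simp add: G_def)
          qed
        next
          case False
          then have le: "T (Suc k) w \<le> T k w + s" using sp by (simp add: H_def)
          have "0 < T (Suc k) w - T k w" using mono[OF w, of k "Suc k"] by simp
          from small[OF this] show ?thesis
          proof eventually_elim
            fix m assume m: "1 / 2 ^ m < T (Suc k) w - T k w"
            have "T (Suc k) w \<in> N w \<inter> {?\<tau> m<..?\<tau> m + s}" using \<tau>[of m] m le points[of "T (Suc k) w"] by auto
            then have "card (N w \<inter> {?\<tau> m<..?\<tau> m + s}) \<noteq> 0" using fin by auto
            then show "w \<in> G m \<longleftrightarrow> w \<in> H" using False by (simp add: G_def)
          qed
        qed
        then have "\<forall>\<^sub>F m in sequentially. (indicator (A \<inter> U \<inter> G m) w :: real) = indicator (A \<inter> U \<inter> H) w"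
          by eventually_elim (simp add: indicator_def)
        then show ?thesis by (rule tendsto_eventually)
      qed simp
    qed
  qed (auto simp: indicator_def)
  then have "(\<lambda>m. prob (A \<inter> U \<inter> G m)) \<longlonglongrightarrow> prob (A \<inter> U \<inter> H)" by simp
  moreover have "(\<lambda>m. prob (A \<inter> U \<inter> G m)) \<longlonglongrightarrow> exp (- s) * prob (A \<inter> U)"
    by (rule tendsto_eventually) (use step in \<open>auto intro: eventually_sequentiallyI[of m0]\<close>)
  ultimately have "prob (A \<inter> U \<inter> H) = exp (- s) * prob (A \<inter> U)" by (rule LIMSEQ_unique)
  moreover have "A \<inter> U \<inter> H = (A \<inter> H) \<inter> U" by auto
  ultimately show ?thesis using cut[of "A \<inter> H"] cut[of A] by (simp add: A_def H_def)
qed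

section \<open>Independence of the next gap from the past\<close>

definition past :: "nat \<Rightarrow> 'w measure" where
  "past k = sigma (space M) {later k m \<alpha> | m \<alpha>. True}"

lemma space_past [simp]: "space (past k) = space M"
  unfolding past_def by (rule space_measure_of) (auto simp: later_def)

lemma sets_past: "sets (past k) = sigma_sets (space M) {later k m \<alpha> | m \<alpha>. True}"
  unfolding past_def by (rule sets_measure_of) (auto simp: later_def)

lemma later_refine: "m \<le> m' \<Longrightarrow> later k m \<alpha> = later k m' (\<lambda>i. \<alpha> i * 2 ^ (m' - m))"
proof -
  assume "m \<le> m'"
  then have "(2::real) ^ m' = 2 ^ m * 2 ^ (m' - m)" by (simp flip: power_add)
  then show ?thesis by (simp add: later_def)
qed

lemma later_Int: "later k m \<alpha> \<inter> later k m \<beta> = later k m (\<lambda>i. max (\<alpha> i) (\<beta> i))"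
proof -
  have "real (max a b) / 2 ^ m < t \<longleftrightarrow> real a / 2 ^ m < t \<and> real b / 2 ^ m < t" for a b t
  proof (cases "a \<le> b")
    case True
    then have "real a / 2 ^ m \<le> real b / 2 ^ m" by (intro divide_right_mono) auto
    with True show ?thesis by (auto simp: max_def)
  next
    case False
    then have "real b / 2 ^ m \<le> real a / 2 ^ m" by (intro divide_right_mono) auto
    with False show ?thesis by (auto simp: max_def)
  qed
  then show ?thesis unfolding later_def by blast
qed

lemma past_independent:
  assumes A: "A \<in> sets (past k)" and s: "0 \<le> s"
  shows "prob (A \<inter> {w \<in> space M. s < T (Suc k) w - T k w}) = exp (- s) * prob A"
proof -
  define H where "H = {w \<in> space M. s < T (Suc k) w - T k w}"
  have H [measurable]: "H \<in> events" unfolding H_def by measurable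
  \<comment> \<open>With all thresholds 0 the strong Markov property yields the law of the next
    gap.\<close>
  have "later k 0 (\<lambda>_. 0) = space M" using T_pos by (auto simp: later_def)
  then have prob_H: "prob H = exp (- s)"
    using strong_markov[OF s, of k 0 "\<lambda>_. 0"] sets.sets_into_space[OF H]
    by (simp add: H_def[symmetric] prob_space Int_absorb1)
  have "indep_set {later k m \<alpha> | m \<alpha>. True} {H}"
  proof (rule indep_setI)
    fix a b assume "a \<in> {later k m \<alpha> | m \<alpha>. True}" "b \<in> {H}"
    then obtain m \<alpha> where "a = later k m \<alpha>" "b = H" by blast
    then show "prob (a \<inter> b) = prob a * prob b"
      using strong_markov[OF s, of k m \<alpha>] prob_H by (simp add: H_def)
  qed auto
  then have "indep_set (sigma_sets (space M) {later k m \<alpha> | m \<alpha>. True}) (sigma_sets (space M) {H})"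
  proof (rule indep_set_sigma_sets)
    show "Int_stable {later k m \<alpha> | m \<alpha>. True}"
    proof (rule Int_stableI)
      fix a b assume "a \<in> {later k m \<alpha> | m \<alpha>. True}" "b \<in> {later k m \<alpha> | m \<alpha>. True}"
      then obtain m \<alpha> m' \<beta> where "a = later k m \<alpha>" "b = later k m' \<beta>" by blast
      then have "a \<inter> b = later k (max m m') (\<lambda>i. max (\<alpha> i * 2 ^ (max m m' - m)) (\<beta> i * 2 ^ (max m m' - m')))"
        using later_refine[of m "max m m'" k \<alpha>] later_refine[of m' "max m m'" k \<beta>] by (simp add: later_Int)
      then show "a \<inter> b \<in> {later k m \<alpha> | m \<alpha>. True}" by blast
    qed
  qed (auto simp: Int_stable_def)
  then have "prob (A \<inter> H) = prob A * prob H"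
    by (rule indep_setD) (use A in \<open>auto simp: sets_past\<close>)
  then show ?thesis unfolding H_def[symmetric] by (simp add: prob_H)
qed

lemma T_past:
  assumes i: "i \<le> k" shows "(\<lambda>w. T i w) \<in> borel_measurable (past k)"
proof (rule borel_measurableI_greater)
  fix y
  \<comment> \<open>A dyadic number at or above y lies below \<open>T i\<close> as soon as y does;
    the thresholds 0 at the other indices are exceeded because all points are positive.\<close>
  define L where "L = (\<Union>m. \<Union>a\<in>{a. y \<le> real a / 2 ^ m}. later k m (\<lambda>j. if j = i then a else 0))"
  have later_iff: "w \<in> later k m (\<lambda>j. if j = i then a else 0) \<longleftrightarrow> w \<in> space M \<and> real a / 2 ^ m < T i w" for w m a
    using i T_pos by (auto simp: later_def)
  have "{w \<in> space (past k). y < T i w} = L"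
  proof (intro equalityI subsetI)
    fix w assume "w \<in> {w \<in> space (past k). y < T i w}"
    then have w: "w \<in> space M" "max y 0 < T i w" using T_pos by auto
    obtain m :: nat where m: "1 / (T i w - max y 0) < 2 ^ m"
      using real_arch_pow[of 2 "1 / (T i w - max y 0)"] by auto
    define a where "a = nat \<lceil>max y 0 * 2 ^ m\<rceil>"
    have "0 \<le> max y 0 * 2 ^ m" by simp
    then have "real a = of_int \<lceil>max y 0 * 2 ^ m\<rceil>" by (simp add: a_def)
    then have a: "max y 0 * 2 ^ m \<le> real a" "real a < max y 0 * 2 ^ m + 1" by linarith+
    have "1 < (T i w - max y 0) * 2 ^ m" using m w(2) by (simp add: field_simps)
    then have "real a < T i w * 2 ^ m" using a(2) by (simp add: algebra_simps)
    then have "real a / 2 ^ m < T i w" by (simp add: field_simps)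
    moreover have "y * 2 ^ m \<le> max y 0 * 2 ^ m" by (intro mult_right_mono) auto
    then have "y * 2 ^ m \<le> real a" using a(1) by (rule order_trans)
    then have "y \<le> real a / 2 ^ m" by (simp add: field_simps)
    ultimately show "w \<in> L" using w(1) by (auto simp: L_def later_iff)
  next
    fix w assume "w \<in> L"
    then show "w \<in> {w \<in> space (past k). y < T i w}" by (auto simp: L_def later_iff)
  qed
  moreover have "later k m \<alpha> \<in> sets (past k)" for m \<alpha> unfolding sets_past by blast
  then have "L \<in> sets (past k)" unfolding L_def by (intro sets.countable_UN' sets.countable_UN) auto
  ultimately show "{w \<in> space (past k). y < T i w} \<in> sets (past k)" by simp
qed

text \<open>The survival of the first n gaps is an event of \<open>past n\<close>, of which the gap
  after \<open>T n\<close> is independent.\<close>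

lemma gaps_survival:
  assumes s: "\<And>i. 0 \<le> s i"
  shows "prob {w \<in> space M. \<forall>i<n. s i < T (Suc i) w - T i w} = (\<Prod>i<n. exp (- s i))"
proof (induction n)
  case 0
  show ?case by (simp add: prob_space)
next
  case (Suc n)
  let ?A = "{w \<in> space M. \<forall>i<n. s i < T (Suc i) w - T i w}"
  have "{w \<in> space (past n). \<forall>i\<in>{..<n}. s i < T (Suc i) w - T i w} \<in> sets (past n)"
  proof (rule sets.sets_Collect_finite_All)
    fix i assume i: "i \<in> {..<n}"
    have [measurable]: "(\<lambda>w. T i w) \<in> borel_measurable (past n)" "(\<lambda>w. T (Suc i) w) \<in> borel_measurable (past n)"
      using i by (auto intro!: T_past)
    show "{w \<in> space (past n). s i < T (Suc i) w - T i w} \<in> sets (past n)" by measurable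
  qed simp
  then have "?A \<in> sets (past n)" by (simp only: space_past lessThan_iff Ball_def)
  from past_independent[OF this s]
  have "prob (?A \<inter> {w \<in> space M. s n < T (Suc n) w - T n w}) = exp (- s n) * prob ?A" .
  moreover have "?A \<inter> {w \<in> space M. s n < T (Suc n) w - T n w} = {w \<in> space M. \<forall>i<Suc n. s i < T (Suc i) w - T i w}"
    unfolding All_less_Suc by blast
  ultimately show ?case using Suc by (simp add: mult.commute)
qed

end

section \<open>The law of gaps and marks\<close>

abbreviation gap_mark_space :: "(real \<times> bool) measure" where
  "gap_mark_space \<equiv> borel \<Otimes>\<^sub>M count_space UNIV"

text \<open>With b false the mark is free, so a single family, stable under intersection, generates
  the product \<sigma>-algebra and expresses the tails with and without mark.\<close>

abbreviation ray :: "real \<Rightarrow> bool \<Rightarrow> (real \<times> bool) set" where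
  "ray s b \<equiv> {z. s < fst z \<and> (b \<longrightarrow> snd z)}"

lemma gap_mark_generator:
  "sets gap_mark_space =
     sigma_sets UNIV {ray s b | s b. True}" (is "sets ?B = sigma_sets UNIV ?E")
proof
  have gen: "sets (sigma UNIV ?E) = sigma_sets UNIV ?E" "space (sigma UNIV ?E) = UNIV" by auto
  have basic: "ray s b \<in> sets (sigma UNIV ?E)" for s b
    unfolding gen by blast
  have 1: "fst \<in> borel_measurable (sigma UNIV ?E)"
  proof (rule borel_measurableI_greater)
    fix y show "{x \<in> space (sigma UNIV ?E). y < fst x} \<in> sets (sigma UNIV ?E)"
      using basic[of y False] by simp
  qed
  have "{z. snd z} = (\<Union>n::nat. ray (- real n) True)"
  proof (intro equalityI subsetI)
    fix z :: "real \<times> bool" assume "z \<in> {z. snd z}"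
    moreover obtain n :: nat where "- fst z < real n" using reals_Archimedean2 by blast
    ultimately show "z \<in> (\<Union>n::nat. ray (- real n) True)"
      by (auto intro!: exI[of _ n])
  qed auto
  also have "\<dots> \<in> sets (sigma UNIV ?E)" by (intro sets.countable_UN image_subsetI basic)
  finally have "Measurable.pred (sigma UNIV ?E) snd" by (simp add: Measurable.pred_def gen)
  then have "(\<lambda>z. (fst z, snd z)) \<in> measurable (sigma UNIV ?E) ?B"
    using 1 by (intro measurable_Pair) auto
  then have id: "(\<lambda>z. z) \<in> measurable (sigma UNIV ?E) ?B" by simp
  show "sets ?B \<subseteq> sigma_sets UNIV ?E"
  proof
    fix A assume "A \<in> sets ?B"
    from measurable_sets[OF id this] show "A \<in> sigma_sets UNIV ?E" by (simp add: gen)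
  qed
  have "?E \<subseteq> sets ?B"
  proof safe
    fix s :: real and b
    have "{z \<in> space ?B. s < fst z \<and> (b \<longrightarrow> snd z)} \<in> sets ?B" by measurable
    then show "ray s b \<in> sets ?B" by (simp add: space_pair_measure)
  qed
  from sets.sigma_sets_subset[OF this] show "sigma_sets UNIV ?E \<subseteq> sets ?B"
    by (simp add: space_pair_measure)
qed

lemma gap_mark_Int_stable: "Int_stable {ray s b | s b. True}"
proof (rule Int_stableI, safe)
  fix s s' :: real and b b'
  show "\<exists>t c. ray s b \<inter> {z. s' < fst z \<and> (b' \<longrightarrow> snd z)} =
      {z :: real \<times> bool. t < fst z \<and> (c \<longrightarrow> snd z)} \<and> True"
    by (rule exI[of _ "max s s'"], rule exI[of _ "b \<or> b'"]) auto
qed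

text \<open>Collects what \<open>no_drift\<close> asks of the points on the positive side, so that
  it can be applied to a configuration and to its mirror image. The coded sequence begins at the
  first positive point.\<close>

definition recurrent_side :: "real set \<Rightarrow> real set \<Rightarrow> bool" where
  "recurrent_side X Y \<longleftrightarrow> unbounded_pos X \<and> (\<forall>i. \<forall>K. \<exists>d>K.
     returns (case_nat (d, True) (shift i (\<lambda>i. (nth_pos (Suc i) X - nth_pos i X, nth_pos i X \<in> Y)))) \<and>
     no_ties (case_nat (d, True) (shift i (\<lambda>i. (nth_pos (Suc i) X - nth_pos i X, nth_pos i X \<in> Y)))))"

section \<open>Gaps and marks of the thinned process are i.i.d\<close>

locale thinned_poisson = unit_poisson M N for M :: "'w measure" and N +
  fixes X Y :: "'w \<Rightarrow> real set" and p :: real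
  assumes X_AE: "AE w in M. X w = insert 0 (N w)"
    and thin: "thinning M p X Y" and p: "0 < p" "p < 1"
begin

lemma X_meas: "X \<in> measurable M config_space" and Y_meas: "Y \<in> measurable M config_space"
  and X_proc: "point_process M X"
  using thin by (auto simp: thinning_def point_process_def)

lemma X_lf: "w \<in> space M \<Longrightarrow> locally_finite (X w)"
  using measurable_space[OF X_meas] by (simp add: space_config)

text \<open>Read off from \<open>X\<close> rather than from \<open>N\<close>, to be measurable for
  \<open>sigma_gen M X\<close> as \<open>thinning\<close> requires. It agrees with \<open>T\<close>
  almost surely, since the added point 0 is not positive.\<close>

definition P :: "nat \<Rightarrow> 'w \<Rightarrow> real" where
  "P k w = nth_pos k (X w)"

lemma P_meas [measurable]: "P k \<in> borel_measurable M"
  unfolding P_def[abs_def] by (rule measurable_nth_pos[OF X_meas])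

lemma P_meas_X: "P k \<in> borel_measurable (sigma_gen M X)"
  unfolding P_def[abs_def] by (rule measurable_nth_pos[OF measurable_sigma_gen[OF X_proc]])

lemma AE_P: "AE w in M. unbounded_pos (X w) \<and> (\<forall>k. P k w = T k w)"
  using X_AE AE_unbounded
proof eventually_elim
  fix w assume w: "X w = insert 0 (N w)" "unbounded_pos (N w)"
  then have "X w \<inter> {0<..} = N w \<inter> {0<..}" by auto
  from nth_pos_cong[OF this] unbounded_pos_cong[OF this] w(2)
  show "unbounded_pos (X w) \<and> (\<forall>k. P k w = T k w)" by (simp add: P_def)
qed

lemma AE_increasing: "AE w in M. strict_mono (\<lambda>k. P k w) \<and> (\<forall>k. P k w \<in> X w)"
  using AE_P AE_space
proof eventually_elim
  fix w assume "unbounded_pos (X w) \<and> (\<forall>k. P k w = T k w)" "w \<in> space M"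
  then show "strict_mono (\<lambda>k. P k w) \<and> (\<forall>k. P k w \<in> X w)"
    unfolding P_def using nth_pos_strict_mono[OF X_lf] nth_pos_in[OF X_lf] by blast
qed

lemma P_survival:
  assumes "\<And>i. 0 \<le> s i"
  shows "prob {w \<in> space M. \<forall>i<n. s i < P (Suc i) w - P i w} = (\<Prod>i<n. exp (- s i))"
proof -
  have "prob {w \<in> space M. \<forall>i<n. s i < P (Suc i) w - P i w} = prob {w \<in> space M. \<forall>i<n. s i < T (Suc i) w - T i w}"
  proof (rule finite_measure_eq_AE)
    show "AE w in M. w \<in> {w \<in> space M. \<forall>i<n. s i < P (Suc i) w - P i w} \<longleftrightarrow>
        w \<in> {w \<in> space M. \<forall>i<n. s i < T (Suc i) w - T i w}"
      using AE_P by eventually_elim simp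
    show "{w \<in> space M. \<forall>i<n. s i < P (Suc i) w - P i w} \<in> events"
      "{w \<in> space M. \<forall>i<n. s i < T (Suc i) w - T i w} \<in> events"
      by measurable
  qed
  then show ?thesis using gaps_survival[OF assms] by simp
qed

lemma mark_sets [measurable]: "Measurable.pred M (\<lambda>w. P k w \<in> Y w)"
  unfolding Measurable.pred_def by (rule sets_mem_config[OF Y_meas P_meas])

text \<open>The \<open>P i\<close> are functions of \<open>X\<close> and almost surely distinct
  points of it, so \<open>thinning\<close> applies to them; the conditional probability is the
  constant \<open>p ^ card I\<close>, which is then integrated over A.\<close>

lemma marks_given_X:
  assumes I: "finite I" and A: "A \<in> sets (sigma_gen M X)"
  shows "prob (A \<inter> {w \<in> space M. \<forall>i\<in>I. P i w \<in> Y w}) = p ^ card I * prob A"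
proof -
  obtain e where e: "bij_betw e {0..<card I} I" using ex_bij_betw_nat_finite[OF I] by blast
  define \<xi> where "\<xi> j w = P (e j) w" for j w
  define E where "E = {w \<in> space M. \<forall>j<card I. \<xi> j w \<in> Y w}"
  have "(\<forall>j<card I. \<xi> j w \<in> Y w) \<longleftrightarrow> (\<forall>i\<in>e ` {0..<card I}. P i w \<in> Y w)" for w
    by (auto simp: \<xi>_def)
  then have "(\<forall>j<card I. \<xi> j w \<in> Y w) \<longleftrightarrow> (\<forall>i\<in>I. P i w \<in> Y w)" for w
    by (simp only: bij_betw_imp_surj_on[OF e])
  then have E_eq: "E = {w \<in> space M. \<forall>i\<in>I. P i w \<in> Y w}" by (simp add: E_def)
  have E [measurable]: "E \<in> events" unfolding E_eq using I by measurable
  have sub: "subalgebra M (sigma_gen M X)"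
    using sets_sigma_gen_subset[OF X_meas] by (simp add: subalgebra_def)
  then interpret sg: finite_measure_subalgebra M "sigma_gen M X"
    by unfold_locales
  have A_ev [measurable]: "A \<in> events" using A sub by (auto simp: subalgebra_def)
  have "AE w in M. (\<forall>j<card I. \<xi> j w \<in> X w) \<and> inj_on (\<lambda>j. \<xi> j w) {..<card I} \<longrightarrow>
      real_cond_exp M (sigma_gen M X) (indicator E) w = p ^ card I"
    unfolding E_def by (rule thin[unfolded thinning_def, THEN conjunct2, THEN conjunct2, THEN conjunct2,
      THEN spec[of _ "card I"], THEN spec[of _ \<xi>], THEN mp]) (simp add: \<xi>_def[abs_def] P_meas_X)
  then have ce: "AE w in M. real_cond_exp M (sigma_gen M X) (indicator E) w = p ^ card I"
    using AE_increasing
  proof eventually_elim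
    fix w assume *: "(\<forall>j<card I. \<xi> j w \<in> X w) \<and> inj_on (\<lambda>j. \<xi> j w) {..<card I} \<longrightarrow>
      real_cond_exp M (sigma_gen M X) (indicator E) w = p ^ card I" "strict_mono (\<lambda>k. P k w) \<and> (\<forall>k. P k w \<in> X w)"
    have "inj_on (\<lambda>j. \<xi> j w) {..<card I}"
      using bij_betw_imp_inj_on[OF e] strict_mono_eq[OF conjunct1[OF *(2)]]
      by (auto simp: inj_on_def \<xi>_def lessThan_atLeast0)
    moreover have "\<forall>j<card I. \<xi> j w \<in> X w" using *(2) by (simp add: \<xi>_def)
    ultimately show "real_cond_exp M (sigma_gen M X) (indicator E) w = p ^ card I" using *(1) by blast
  qed
  have "prob (A \<inter> E) = (\<integral>w\<in>A. indicator E w \<partial>M)"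
    by (simp add: set_lebesgue_integral_def indicator_inter_arith[symmetric])
  also have "\<dots> = (\<integral>w\<in>A. real_cond_exp M (sigma_gen M X) (indicator E) w \<partial>M)"
    using A by (intro sg.real_cond_exp_intA) (auto simp: less_top[symmetric])
  also have "\<dots> = (\<integral>w. indicator A w * p ^ card I \<partial>M)"
    unfolding set_lebesgue_integral_def
    by (rule integral_cong_AE) (use ce in \<open>auto elim!: eventually_mono\<close>)
  also have "\<dots> = p ^ card I * prob A" by simp
  finally show ?thesis by (simp add: E_eq)
qed

definition Z :: "nat \<Rightarrow> 'w \<Rightarrow> real \<times> bool" where
  "Z i w = (P (Suc i) w - P i w, P i w \<in> Y w)"

lemma Z_meas [measurable]: "Z i \<in> measurable M gap_mark_space"
  unfolding Z_def[abs_def] by measurable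

lemma joint_law:
  assumes J: "finite J"
  shows "prob {w \<in> space M. \<forall>j\<in>J. s j < fst (Z j w) \<and> (b j \<longrightarrow> snd (Z j w))} =
    (\<Prod>j\<in>J. exp (- max 0 (s j)) * (if b j then p else 1))"
proof -
  obtain n where n: "J \<subseteq> {..<n}" using J finite_nat_iff_bounded by blast
  \<comment> \<open>Threshold 0 replaces negative thresholds and is used at indices outside J; it
    holds almost surely because the gaps are positive.\<close>
  define s' where "s' i = (if i \<in> J then max 0 (s i) else 0)" for i
  define I where "I = {j \<in> J. b j}"
  define A where "A = {w \<in> space M. \<forall>i<n. s' i < P (Suc i) w - P i w}"
  have A: "A \<in> sets (sigma_gen M X)"
  proof -
    note P_meas_X [measurable]
    have "{w \<in> space (sigma_gen M X). \<forall>i<n. s' i < P (Suc i) w - P i w} \<in> sets (sigma_gen M X)" by measurable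
    then show ?thesis by (simp only: A_def space_sigma_gen)
  qed
  have fI: "finite I" using J by (simp add: I_def)
  have "prob {w \<in> space M. \<forall>j\<in>J. s j < fst (Z j w) \<and> (b j \<longrightarrow> snd (Z j w))} =
      prob (A \<inter> {w \<in> space M. \<forall>i\<in>I. P i w \<in> Y w})"
  proof (rule finite_measure_eq_AE)
    show "AE w in M. w \<in> {w \<in> space M. \<forall>j\<in>J. s j < fst (Z j w) \<and> (b j \<longrightarrow> snd (Z j w))} \<longleftrightarrow>
        w \<in> A \<inter> {w \<in> space M. \<forall>i\<in>I. P i w \<in> Y w}"
      using AE_increasing
    proof eventually_elim
      fix w assume "strict_mono (\<lambda>k. P k w) \<and> (\<forall>k. P k w \<in> X w)"
      then have "0 < P (Suc i) w - P i w" for i by (simp add: strict_mono_Suc_iff)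
      then have "(\<forall>i<n. s' i < P (Suc i) w - P i w) \<longleftrightarrow> (\<forall>j\<in>J. s j < P (Suc j) w - P j w)"
        using n by (auto simp: s'_def subset_eq)
      then show "w \<in> {w \<in> space M. \<forall>j\<in>J. s j < fst (Z j w) \<and> (b j \<longrightarrow> snd (Z j w))} \<longleftrightarrow>
        w \<in> A \<inter> {w \<in> space M. \<forall>i\<in>I. P i w \<in> Y w}"
        by (auto simp: A_def I_def Z_def)
    qed
    show "{w \<in> space M. \<forall>j\<in>J. s j < fst (Z j w) \<and> (b j \<longrightarrow> snd (Z j w))} \<in> events"
      using J by measurable
    show "A \<inter> {w \<in> space M. \<forall>i\<in>I. P i w \<in> Y w} \<in> events"
      unfolding A_def using fI by measurable
  qed
  also have "\<dots> = p ^ card I * (\<Prod>i<n. exp (- s' i))"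
    unfolding marks_given_X[OF fI A] unfolding A_def by (subst P_survival) (auto simp: s'_def)
  also have "(\<Prod>i<n. exp (- s' i)) = (\<Prod>j\<in>J. exp (- max 0 (s j)))"
    by (rule prod.mono_neutral_cong_right) (use n in \<open>auto simp: s'_def\<close>)
  also have "p ^ card I = (\<Prod>j\<in>J. if b j then p else 1)"
    using J by (simp add: I_def prod.If_cases Int_def)
  finally show ?thesis by (simp add: prod.distrib mult.commute)
qed

lemma Z_law: "distr M gap_mark_space (Z i) = distr M gap_mark_space (Z 0)"
proof (rule measure_eqI_generator_eq[OF gap_mark_Int_stable, where \<Omega> = UNIV and A = "\<lambda>n. ray (- real n) False"])
  have em: "emeasure (distr M gap_mark_space (Z i)) (ray s b) =
      ennreal (exp (- max 0 s) * (if b then p else 1))" for i s b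
  proof -
    have "ray s b \<in> sets gap_mark_space"
      unfolding gap_mark_generator by blast
    then have "emeasure (distr M gap_mark_space (Z i)) (ray s b) =
        emeasure M (Z i -` (ray s b) \<inter> space M)"
      by (intro emeasure_distr) auto
    also have "Z i -` (ray s b) \<inter> space M =
        {w \<in> space M. \<forall>j\<in>{i}. s < fst (Z j w) \<and> (b \<longrightarrow> snd (Z j w))}" by auto
    finally show ?thesis using joint_law[of "{i}" "\<lambda>_. s" "\<lambda>_. b"] by (simp add: emeasure_eq_measure)
  qed
  show "emeasure (distr M gap_mark_space (Z i)) W = emeasure (distr M gap_mark_space (Z 0)) W"
    if W: "W \<in> {ray s b | s b. True}" for W
  proof -
    obtain s b where "W = ray s b" using W by blast
    then show ?thesis by (simp only: em)
  qed
  show "(\<Union>n. ray (- real n) False) = UNIV"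
  proof (intro equalityI subsetI)
    fix z :: "real \<times> bool"
    obtain n :: nat where "- fst z < real n" using reals_Archimedean2 by blast
    then have "z \<in> ray (- real n) False" by auto
    then show "z \<in> (\<Union>n. ray (- real n) False)" by blast
  qed simp
  show "emeasure (distr M gap_mark_space (Z i)) (ray (- real n) False) \<noteq> \<infinity>" for n
    unfolding em by simp
  show "range (\<lambda>n::nat. ray (- real n) False) \<subseteq>
      {ray s b | s b. True}" by blast
  show "sets (distr M gap_mark_space (Z i)) = sigma_sets UNIV {ray s b | s b. True}"
    "sets (distr M gap_mark_space (Z 0)) = sigma_sets UNIV {ray s b | s b. True}"
    by (simp_all only: sets_distr gap_mark_generator)
qed simp

text \<open>The rays are an intersection-stable generator, and \<open>joint_law\<close> is the
  product formula on them.\<close>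

lemma Z_indep: "indep_vars (\<lambda>_. gap_mark_space) Z UNIV"
  unfolding indep_vars_def2
proof (intro conjI ballI)
  define E where "E = {ray s b | s b. True}"
  define ev where "ev i s b = {w \<in> space M. s < fst (Z i w) \<and> (b \<longrightarrow> snd (Z i w))}" for i s b
  define F where "F i = {ev i s b | s b. True}" for i
  have pre: "Z i -` (ray s b) \<inter> space M = ev i s b" for i s b
    by (auto simp: ev_def)
  have F_vimage: "{Z i -` A \<inter> space M | A. A \<in> E} = F i" for i
  proof (intro equalityI subsetI)
    fix W assume "W \<in> {Z i -` A \<inter> space M | A. A \<in> E}"
    then obtain A where A: "A \<in> E" "W = Z i -` A \<inter> space M" by blast
    from A(1) obtain s b where "A = ray s b" unfolding E_def by blast
    with A(2) have "W = ev i s b" by (simp only: pre)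
    then show "W \<in> F i" unfolding F_def by blast
  next
    fix W assume "W \<in> F i"
    then obtain s b where "W = ev i s b" unfolding F_def by blast
    moreover have "ray s b \<in> E" unfolding E_def by blast
    ultimately show "W \<in> {Z i -` A \<inter> space M | A. A \<in> E}" using pre[of i s b] by blast
  qed
  have ev_prob: "prob (ev j s b) = exp (- max 0 s) * (if b then p else 1)" for j s b
  proof -
    have "ev j s b = {w \<in> space M. \<forall>i\<in>{j}. s < fst (Z i w) \<and> (b \<longrightarrow> snd (Z i w))}" by (simp add: ev_def)
    then show ?thesis using joint_law[of "{j}" "\<lambda>_. s" "\<lambda>_. b"] by simp
  qed
  have "indep_sets F UNIV"
  proof (rule indep_setsI)
    have "ev i s b \<in> events" for i s b unfolding ev_def by measurable
    then show "F i \<subseteq> events" for i unfolding F_def by blast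
    fix A and J :: "nat set"
    assume J: "J \<noteq> {}" "finite J" "\<forall>j\<in>J. A j \<in> F j"
    have "\<exists>sb. A j = ev j (fst sb) (snd sb)" if j: "j \<in> J" for j
    proof -
      obtain s b where "A j = ev j s b" using J(3) j unfolding F_def by blast
      then show ?thesis by (intro exI[of _ "(s, b)"]) simp
    qed
    then obtain f where f: "\<And>j. j \<in> J \<Longrightarrow> A j = ev j (fst (f j)) (snd (f j))" by metis
    have "(\<Inter>j\<in>J. A j) = (\<Inter>j\<in>J. ev j (fst (f j)) (snd (f j)))" by (rule INF_cong[OF refl f])
    also have "\<dots> = {w \<in> space M. \<forall>j\<in>J. fst (f j) < fst (Z j w) \<and> (snd (f j) \<longrightarrow> snd (Z j w))}"
      using J(1) unfolding ev_def by blast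
    finally have "prob (\<Inter>j\<in>J. A j) = (\<Prod>j\<in>J. exp (- max 0 (fst (f j))) * (if snd (f j) then p else 1))"
      using joint_law[OF J(2), of "\<lambda>j. fst (f j)" "\<lambda>j. snd (f j)"] by simp
    also have "\<dots> = (\<Prod>j\<in>J. prob (A j))"
      by (rule prod.cong[OF refl]) (simp only: f ev_prob)
    finally show "prob (\<Inter>j\<in>J. A j) = (\<Prod>j\<in>J. prob (A j))" .
  qed
  then have "indep_sets (\<lambda>i. sigma_sets (space M) (F i)) UNIV"
  proof (rule indep_sets_sigma)
    fix i
    show "Int_stable (F i)"
    proof (rule Int_stableI)
      fix a b assume "a \<in> F i" "b \<in> F i"
      then obtain A B where "A \<in> E" "B \<in> E" "a = Z i -` A \<inter> space M" "b = Z i -` B \<inter> space M"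
        unfolding F_vimage[symmetric] by blast
      moreover from this have "A \<inter> B \<in> E"
        using gap_mark_Int_stable unfolding E_def[symmetric] Int_stable_def by blast
      moreover have "Z i -` A \<inter> space M \<inter> (Z i -` B \<inter> space M) = Z i -` (A \<inter> B) \<inter> space M" by auto
      ultimately show "a \<inter> b \<in> F i" unfolding F_vimage[symmetric] by blast
    qed
  qed
  moreover have "sigma_sets (space M) (F i) = {Z i -` A \<inter> space M | A. A \<in> sets gap_mark_space}" for i
    unfolding F_vimage[symmetric] gap_mark_generator E_def[symmetric] by (rule sigma_sets_vimage_commute[symmetric]) simp
  ultimately show "indep_sets (\<lambda>i. {Z i -` A \<inter> space M | A. A \<in> sets gap_mark_space}) UNIV" by simp
qed simp

lemma AE_hits:
  "AE w in M. \<forall>i. \<forall>K. \<exists>d>K. returns (case_nat (d, True) (shift i (\<lambda>i. Z i w))) \<and> no_ties (case_nat (d, True) (shift i (\<lambda>i. Z i w)))"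
proof -
  define B where "B = gap_mark_space"
  define \<mu> where "\<mu> = distr M B (Z 0)"
  have Z_B: "Z i \<in> measurable M B" for i unfolding B_def by (rule Z_meas)
  interpret law: prob_space \<mu> unfolding \<mu>_def by (rule prob_space_distr[OF Z_B])
  have law_prob: "law.prob {z \<in> space \<mu>. s < fst z \<and> (b \<longrightarrow> snd z)} = exp (- max 0 s) * (if b then p else 1)" for s b
  proof -
    have sp: "space \<mu> = UNIV" by (simp add: \<mu>_def B_def space_pair_measure)
    have "ray s b \<in> sets B" unfolding B_def gap_mark_generator by blast
    then have "law.prob (ray s b) = prob (Z 0 -` (ray s b) \<inter> space M)"
      unfolding \<mu>_def by (intro measure_distr Z_B)
    also have "Z 0 -` (ray s b) \<inter> space M =
        {w \<in> space M. \<forall>j\<in>{0}. s < fst (Z j w) \<and> (b \<longrightarrow> snd (Z j w))}" by auto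
    finally show ?thesis using joint_law[of "{0}" "\<lambda>_. s" "\<lambda>_. b"] by (simp add: sp)
  qed
  interpret law: gap_mark_law \<mu> p
  proof
    show "sets \<mu> = sets gap_mark_space" by (simp add: \<mu>_def B_def)
    show "law.prob {z \<in> space \<mu>. s < fst z} = exp (- s)" if "0 \<le> s" for s
      using law_prob[of s False] that by simp
    show "law.prob {z \<in> space \<mu>. s < fst z \<and> snd z} = p * exp (- s)" if "0 \<le> s" for s
      using law_prob[of s True] that by simp
  qed (rule p)+
  \<comment> \<open>Independence and equal marginals identify the law of the whole sequence with the
    product measure, so the almost sure statement on i.i.d. sequences carries over.\<close>
  have "distr M (PiM UNIV (\<lambda>_. B)) (\<lambda>w. \<lambda>i\<in>UNIV. Z i w) = PiM UNIV (\<lambda>i. distr M B (Z i))"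
    using Z_indep unfolding B_def[symmetric]
    by (subst (asm) indep_vars_iff_distr_eq_PiM) (auto intro: Z_B)
  also have "PiM UNIV (\<lambda>i. distr M B (Z i)) = PiM UNIV (\<lambda>i. \<mu>)"
    unfolding \<mu>_def B_def by (intro PiM_cong refl Z_law)
  finally have eq: "distr M (PiM UNIV (\<lambda>_. B)) (\<lambda>w i. Z i w) = PiM UNIV (\<lambda>i. \<mu>)"
    by (simp only: restrict_UNIV)
  have "(\<lambda>w i. Z i w) \<in> measurable M (PiM UNIV (\<lambda>_. B))" by (rule measurable_abs_UNIV) (rule Z_B)
  then show ?thesis
    by (rule AE_distrD) (simp only: eq law.AE_barrier_hit)
qed

lemma AE_recurrent_side: "AE w in M. recurrent_side (X w) (Y w)"
  using AE_hits AE_P by eventually_elim (simp add: recurrent_side_def Z_def P_def)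

end

section \<open>Reflection\<close>

lemma uminus_image_borel: "B \<in> sets borel \<Longrightarrow> uminus ` B \<in> sets (borel :: real measure)"
proof -
  assume B: "B \<in> sets (borel :: real measure)"
  have "uminus -` B \<inter> space borel \<in> sets (borel :: real measure)"
    by (rule measurable_sets[OF _ B]) measurable
  moreover have "uminus -` B \<inter> space borel = uminus ` B" by (force simp: image_iff)
  ultimately show ?thesis by simp
qed

lemma bounded_uminus_image: "bounded B \<Longrightarrow> bounded (uminus ` B :: real set)"
  by (simp add: bounded_uminus)

lemma uminus_image_Int: "uminus ` S \<inter> B = uminus ` (S \<inter> uminus ` B)" for S B :: "real set"
  by (force simp: image_iff)

lemma card_uminus_Int: "card (uminus ` S \<inter> B) = card (S \<inter> uminus ` B)" for S B :: "real set"
  unfolding uminus_image_Int by (rule card_image) auto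

lemma locally_finite_uminus: "locally_finite S \<Longrightarrow> locally_finite (uminus ` S)"
  unfolding locally_finite_def uminus_image_Int by (auto intro: bounded_uminus_image)

lemma measurable_uminus_config: "(\<lambda>S. uminus ` S) \<in> measurable config_space config_space"
  unfolding config_space_def
proof (rule measurable_sigma_sets)
  let ?\<Omega> = "{S. locally_finite S}"
  let ?G = "{{S. locally_finite S \<and> card (S \<inter> B) = k} | B k. B \<in> sets borel \<and> bounded B}"
  have sp: "space (sigma ?\<Omega> ?G) = ?\<Omega>" by (rule space_measure_of) auto
  show "sets (sigma ?\<Omega> ?G) = sigma_sets ?\<Omega> ?G" by (rule sets_measure_of) auto
  show "?G \<subseteq> Pow ?\<Omega>" by auto
  show "(\<lambda>S. uminus ` S) \<in> space (sigma ?\<Omega> ?G) \<rightarrow> ?\<Omega>"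
    unfolding sp using locally_finite_uminus by auto
  fix A assume "A \<in> ?G"
  then obtain B k where B: "A = {S. locally_finite S \<and> card (S \<inter> B) = k}" "B \<in> sets borel" "bounded B" by blast
  have "(\<lambda>S. uminus ` S) -` A \<inter> space (sigma ?\<Omega> ?G) = {S. locally_finite S \<and> card (S \<inter> uminus ` B) = k}"
    unfolding sp B(1) using locally_finite_uminus by (auto simp: card_uminus_Int)
  also have "\<dots> \<in> sets config_space"
    by (rule card_config_sets[OF uminus_image_borel[OF B(2)] bounded_uminus_image[OF B(3)]])
  finally show "(\<lambda>S. uminus ` S) -` A \<inter> space (sigma ?\<Omega> ?G) \<in> sets (sigma ?\<Omega> ?G)"
    unfolding config_space_def .
qed

lemma point_process_uminus: "point_process M X \<Longrightarrow> point_process M (\<lambda>w. uminus ` X w)"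
  unfolding point_process_def by (rule measurable_compose[OF _ measurable_uminus_config])

text \<open>Reflection is a measurable involution, so each of the two processes is a measurable
  function of the other.\<close>

lemma sigma_gen_uminus:
  assumes X: "point_process M X"
  shows "sigma_gen M (\<lambda>w. uminus ` X w) = sigma_gen M X"
proof (rule measure_eqI)
  have "sets (sigma_gen M (\<lambda>w. uminus ` X w)) \<subseteq> sets (sigma_gen M X)"
    using measurable_compose[OF measurable_sigma_gen[OF X] measurable_uminus_config]
    by (rule sets_sigma_gen_subset) simp
  moreover have "(\<lambda>w. uminus ` uminus ` X w) \<in> measurable (sigma_gen M (\<lambda>w. uminus ` X w)) config_space"
    by (rule measurable_compose[OF measurable_sigma_gen[OF point_process_uminus[OF X]] measurable_uminus_config])
  then have "X \<in> measurable (sigma_gen M (\<lambda>w. uminus ` X w)) config_space" by (simp add: image_image)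
  then have "sets (sigma_gen M X) \<subseteq> sets (sigma_gen M (\<lambda>w. uminus ` X w))"
    by (rule sets_sigma_gen_subset) simp
  ultimately show "sets (sigma_gen M (\<lambda>w. uminus ` X w)) = sets (sigma_gen M X)" by (rule equalityI)
  show "emeasure (sigma_gen M (\<lambda>w. uminus ` X w)) A = emeasure (sigma_gen M X) A" for A
    by (simp add: sigma_gen_def vimage_algebra_def emeasure_sigma)
qed

lemma poisson_uminus:
  assumes "poisson_process M l N" shows "poisson_process M l (\<lambda>w. uminus ` N w)"
  unfolding poisson_process_def
proof (intro conjI allI impI)
  have N: "point_process M N"
    "\<And>B k. B \<in> sets borel \<Longrightarrow> bounded B \<Longrightarrow> measure M {w \<in> space M. card (N w \<inter> B) = k} =
       exp (- (l * measure lborel B)) * (l * measure lborel B) ^ k / fact k"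
    "\<And>(n :: nat) B. (\<forall>i<n. B i \<in> sets borel \<and> bounded (B i)) \<Longrightarrow> disjoint_family_on B {..<n} \<Longrightarrow>
       prob_space.indep_vars M (\<lambda>_. count_space (UNIV :: nat set)) (\<lambda>i w. card (N w \<inter> B i)) {..<n}"
    using assms unfolding poisson_process_def by blast+
  show "point_process M (\<lambda>w. uminus ` N w)" by (rule point_process_uminus[OF N(1)])
  show "measure M {w \<in> space M. card (uminus ` N w \<inter> B) = k} =
      exp (- (l * measure lborel B)) * (l * measure lborel B) ^ k / fact k"
    if B: "B \<in> sets borel" "bounded B" for B k
  proof -
    have "measure lborel B = measure (distr lborel borel uminus) B" by (simp add: lborel_distr_uminus)
    also have "\<dots> = measure lborel (uminus -` B \<inter> space lborel)"
      using B(1) by (intro measure_distr) auto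
    also have "uminus -` B \<inter> space lborel = uminus ` B" by (force simp: image_iff)
    finally show ?thesis
      unfolding card_uminus_Int by (simp only: N(2)[OF uminus_image_borel[OF B(1)] bounded_uminus_image[OF B(2)]])
  qed
  show "prob_space.indep_vars M (\<lambda>_. count_space (UNIV :: nat set)) (\<lambda>i w. card (uminus ` N w \<inter> B i)) {..<n}"
    if B: "\<forall>i<n. B i \<in> sets borel \<and> bounded (B i)" "disjoint_family_on B {..<n}" for n :: nat and B
    unfolding card_uminus_Int
  proof (rule N(3))
    show "\<forall>i<n. uminus ` B i \<in> sets borel \<and> bounded (uminus ` B i)"
      using B(1) uminus_image_borel bounded_uminus_image by blast
    show "disjoint_family_on (\<lambda>i. uminus ` B i) {..<n}"
      unfolding disjoint_family_on_def
    proof (intro ballI impI)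
      fix a b assume "a \<in> {..<n}" "b \<in> {..<n}" "a \<noteq> b"
      then have "B a \<inter> B b = {}" using B(2) by (intro disjoint_family_onD)
      then show "uminus ` B a \<inter> uminus ` B b = {}" by (subst image_Int[symmetric]) auto
    qed
  qed
qed

text \<open>A choice \<xi> of points of the mirrored process is the choice -\<xi> of points of the
  original one, measurable for the same \<sigma>-algebra.\<close>

lemma thinning_uminus:
  assumes "thinning M p X Y" shows "thinning M p (\<lambda>w. uminus ` X w) (\<lambda>w. uminus ` Y w)"
proof -
  have X: "point_process M X" and Y: "point_process M Y" and sub: "\<forall>w\<in>space M. Y w \<subseteq> X w"
    and ce: "\<And>k (\<xi> :: nat \<Rightarrow> _ \<Rightarrow> real). \<forall>i<k. \<xi> i \<in> borel_measurable (sigma_gen M X) \<Longrightarrow>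
      AE w in M. (\<forall>i<k. \<xi> i w \<in> X w) \<and> inj_on (\<lambda>i. \<xi> i w) {..<k} \<longrightarrow>
        real_cond_exp M (sigma_gen M X) (indicator {w \<in> space M. \<forall>i<k. \<xi> i w \<in> Y w}) w = p ^ k"
    using assms unfolding thinning_def by simp_all
  have mem: "x \<in> uminus ` S \<longleftrightarrow> - x \<in> S" for x :: real and S by (force simp: image_iff)
  show ?thesis
    unfolding thinning_def sigma_gen_uminus[OF X] mem
  proof (intro conjI allI impI)
    show "\<forall>w\<in>space M. uminus ` Y w \<subseteq> uminus ` X w" using sub by (simp add: image_mono)
    fix k :: nat and \<xi> :: "nat \<Rightarrow> 'a \<Rightarrow> real"
    assume "\<forall>i<k. \<xi> i \<in> borel_measurable (sigma_gen M X)"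
    then have "\<forall>i<k. (\<lambda>w. - \<xi> i w) \<in> borel_measurable (sigma_gen M X)" by auto
    from ce[OF this]
    show "AE w in M. (\<forall>i<k. - \<xi> i w \<in> X w) \<and> inj_on (\<lambda>i. \<xi> i w) {..<k} \<longrightarrow>
        real_cond_exp M (sigma_gen M X) (indicator {w \<in> space M. \<forall>i<k. - \<xi> i w \<in> Y w}) w = p ^ k"
      by (simp add: inj_on_def)
  qed (rule point_process_uminus[OF X], rule point_process_uminus[OF Y])
qed

section \<open>Every point is removed\<close>

lemma greedy_env_le: "greedy_env \<omega> n y \<le> \<omega> y"
  by (induction n) (auto intro: order_trans)

lemma greedy_env_unvisited: "(\<And>t. t < n \<Longrightarrow> greedy_walk \<omega> t \<noteq> y) \<Longrightarrow> greedy_env \<omega> n y = \<omega> y"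
  by (induction n) auto

text \<open>A minimiser exists at every step: an infinite X has an unvisited point
  \<open>y0\<close>, and by local finiteness only finitely many points are as close as
  \<open>y0\<close>. Hence \<open>arg_min\<close> returns an actual minimiser.\<close>

lemma greedy_run_greedy_walk:
  assumes X: "locally_finite X" "infinite X" and "Y \<subseteq> X" "0 \<in> X"
  shows "greedy_run (greedy_env (marks X Y)) (greedy_walk (marks X Y))"
  unfolding greedy_run_def
proof (intro conjI allI)
  let ?E = "greedy_env (marks X Y)" and ?S = "greedy_walk (marks X Y)"
  show "?E (Suc n) y = ?E n y - of_bool (y = ?S n)" for n y by simp
  show "0 \<le> ?E 0 y" for y by (simp add: marks_def)
  show "1 \<le> ?E 0 (?S 0)" using assms by (simp add: marks_def)
  fix n
  define K where "K = {y. y \<noteq> ?S n \<and> 1 \<le> ?E n y}"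
  have KX: "K \<subseteq> X"
  proof
    fix y assume "y \<in> K"
    then have "1 \<le> marks X Y y" using greedy_env_le[of "marks X Y" n y] by (simp add: K_def)
    then show "y \<in> X" using assms(3) by (cases "y \<in> X"; cases "y \<in> Y") (auto simp: marks_def)
  qed
  obtain y0 where y0: "y0 \<in> X" "y0 \<notin> ?S ` {..n}" using X(2) by (meson finite_atMost finite_imageI finite_subset subsetI)
  have "?E n y0 = marks X Y y0" using y0(2) by (intro greedy_env_unvisited) auto
  then have y0K: "y0 \<in> K" using y0 by (auto simp: K_def marks_def)
  define D where "D = K \<inter> cball (?S n) \<bar>y0 - ?S n\<bar>"
  have "finite (X \<inter> cball (?S n) \<bar>y0 - ?S n\<bar>)" using X(1) by (simp add: locally_finite_def)
  then have "finite D" by (rule rev_finite_subset) (use KX in \<open>auto simp: D_def\<close>)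
  moreover have y0D: "y0 \<in> D" using y0K by (simp add: D_def dist_real_def abs_minus_commute)
  ultimately obtain x where x: "x \<in> D" "\<And>y. y \<in> D \<Longrightarrow> \<bar>x - ?S n\<bar> \<le> \<bar>y - ?S n\<bar>"
    using ex_is_arg_min_if_finite[of D "\<lambda>y. \<bar>y - ?S n\<bar>"] by (auto simp: is_arg_min_linorder)
  have min: "\<bar>x - ?S n\<bar> \<le> \<bar>y - ?S n\<bar>" if "y \<in> K" for y
  proof (cases "y \<in> D")
    case False
    then have "\<bar>y0 - ?S n\<bar> < \<bar>y - ?S n\<bar>" using that by (simp add: D_def dist_real_def abs_minus_commute)
    then show ?thesis using x(2)[OF y0D] by simp
  qed (rule x(2))
  have "?S (Suc n) \<noteq> ?S n \<and> 1 \<le> ?E n (?S (Suc n)) \<and> (\<forall>y. y \<noteq> ?S n \<longrightarrow> 1 \<le> ?E n y \<longrightarrow> \<bar>?S (Suc n) - ?S n\<bar> \<le> \<bar>y - ?S n\<bar>)"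
    unfolding greedy_walk.simps(2)
  proof (rule arg_minI[where x = x])
    show "x \<noteq> ?S n \<and> 1 \<le> ?E n x" using x(1) by (simp add: D_def K_def)
    show "\<not> \<bar>y - ?S n\<bar> < \<bar>x - ?S n\<bar>" if "y \<noteq> ?S n \<and> 1 \<le> ?E n y" for y
      using min[of y] that by (simp add: K_def not_less)
  qed (auto simp: not_less)
  then show "?S (Suc n) \<noteq> ?S n" "1 \<le> ?E n (?S (Suc n))"
    "\<And>y. y \<noteq> ?S n \<longrightarrow> 1 \<le> ?E n y \<longrightarrow> \<bar>?S (Suc n) - ?S n\<bar> \<le> \<bar>y - ?S n\<bar>" by blast+
qed

lemma recurrent_side_no_drift:
  assumes run: "greedy_run E S" and X: "locally_finite X" "Y \<subseteq> X" and side: "recurrent_side X Y"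
    and E0: "\<And>y. E 0 y = of_bool (y \<in> X) + of_bool (y \<in> Y)"
    and \<xi>: "\<And>n. 1 \<le> E n \<xi>" and right: "\<And>n. m \<le> n \<Longrightarrow> \<xi> < S n"
  shows False
proof (rule no_drift[OF run X E0])
  have unb: "unbounded_pos X" using side by (simp add: recurrent_side_def)
  show "strict_mono (\<lambda>k. nth_pos k X)" by (rule nth_pos_strict_mono[OF X(1) unb])
  show "X \<inter> {0<..} = range (\<lambda>k. nth_pos k X)" by (rule range_nth_pos[OF X(1) unb])
  show "\<exists>d>K. returns (case_nat (d, True) (shift i (\<lambda>i. (nth_pos (Suc i) X - nth_pos i X, nth_pos i X \<in> Y)))) \<and>
     no_ties (case_nat (d, True) (shift i (\<lambda>i. (nth_pos (Suc i) X - nth_pos i X, nth_pos i X \<in> Y))))" for i K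
    using side by (simp add: recurrent_side_def)
qed (use \<xi> right in auto)

lemma nothing_left:
  assumes X: "locally_finite X" "Y \<subseteq> X" "0 \<in> X"
    and side: "recurrent_side X Y" "recurrent_side (uminus ` X) (uminus ` Y)"
  shows "points_left_forever (marks X Y) = {}"
proof (rule ccontr)
  assume "points_left_forever (marks X Y) \<noteq> {}"
  then obtain \<xi> where \<xi>: "\<And>n. 1 \<le> greedy_env (marks X Y) n \<xi>"
    by (auto simp: points_left_forever_def points_left_def)
  have unb: "unbounded_pos X" using side by (simp add: recurrent_side_def)
  have "infinite (range (\<lambda>k. nth_pos k X))"
    by (rule range_inj_infinite[OF strict_mono_imp_inj_on[OF nth_pos_strict_mono[OF X(1) unb]]])
  then have "infinite X" unfolding range_nth_pos[OF X(1) unb, symmetric] by blast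
  then have run: "greedy_run (greedy_env (marks X Y)) (greedy_walk (marks X Y))"
    using X by (intro greedy_run_greedy_walk)
  let ?E = "greedy_env (marks X Y)" and ?S = "greedy_walk (marks X Y)"
  obtain n1 where n1: "\<And>t. n1 \<le> t \<Longrightarrow> ?S t \<noteq> \<xi>" using run_leaves_finite[OF run, of "{\<xi>}"] by auto
  consider "\<xi> < ?S n1" | "?S n1 < \<xi>" using n1[of n1] by fastforce
  then show False
  proof cases
    case 1
    have "\<xi> < ?S n" if "n1 \<le> n" for n
      using n1 by (intro run_no_jump_left[OF run that \<xi> _ 1]) auto
    then show False
      by (intro recurrent_side_no_drift[OF run X(1,2) side(1) _ \<xi>]) (auto simp: marks_def)
  next
    case 2
    have "?S n < \<xi>" if "n1 \<le> n" for n
      using n1 by (intro run_no_jump_right[OF run that \<xi> _ 2]) auto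
    then show False
      using locally_finite_uminus[OF X(1)] X(2) \<xi>
      by (intro recurrent_side_no_drift[OF run_reflect[OF run] _ _ side(2), where \<xi> = "- \<xi>" and m = n1])
        (auto simp: marks_def image_iff of_bool_def minus_equation_iff)
  qed
qed

theorem theorem1:
  fixes M :: "'w measure" and p :: real and N X Y :: "'w \<Rightarrow> real set"
  assumes "prob_space M"
    and "0 < p" and "p < 1"
    and "poisson_process M 1 N"
    and "AE w in M. X w = insert 0 (N w)"
    and "thinning M p X Y"
  shows "AE w in M. points_left_forever (marks (X w) (Y w)) = {}"
proof -
  interpret prob_space M by fact
  interpret pos: thinned_poisson M N X Y p
    using assms by unfold_locales auto
  interpret neg: thinned_poisson M "\<lambda>w. uminus ` N w" "\<lambda>w. uminus ` X w" "\<lambda>w. uminus ` Y w" p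
  proof
    show "poisson_process M 1 (\<lambda>w. uminus ` N w)" using assms(4) by (rule poisson_uminus)
    show "AE w in M. uminus ` X w = insert 0 (uminus ` N w)" using assms(5) by eventually_elim simp
    show "thinning M p (\<lambda>w. uminus ` X w) (\<lambda>w. uminus ` Y w)" using assms(6) by (rule thinning_uminus)
  qed (fact assms)+
  show ?thesis
    using pos.AE_recurrent_side neg.AE_recurrent_side assms(5) AE_space
  proof eventually_elim
    fix w
    assume sides: "recurrent_side (X w) (Y w)" "recurrent_side (uminus ` X w) (uminus ` Y w)"
    assume w: "X w = insert 0 (N w)" "w \<in> space M"
    have "Y w \<subseteq> X w" using assms(6) w(2) by (simp add: thinning_def)
    then show "points_left_forever (marks (X w) (Y w)) = {}"
      using sides w pos.X_lf[OF w(2)] by (intro nothing_left) auto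
  qed
qed

end
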